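(* Let $n\ge2$ and $N\ge3$ be integers and let $h$ be an absolutely monotone potential. Let $\tau=\tau(n,N)$, $k=\lceil(\tau+1)/2\rceil$, and let $\alpha_i,\rho_i$, $i=1,\ldots,k$, be the associated Levenshtein quadrature nodes and weights. Then $$\mathcal{E}(n,N;h)\ge R_\tau(n,N;h):=N^2\sum_{i=1}^{k}\rho_i h(\alpha_i).$$ Moreover, let $f=f^h_{\tau}$ be the Hermite interpolation polynomial of degree at most $\tau$ defined as follows: if $\tau=2k-2$ is even (in which case $\alpha_1=-1$), by $$f(-1)=h(-1),\qquad f(\alpha_i)=h(\alpha_i),\quad f'(\alpha_i)=h'(\alpha_i),\quad i=2,\ldots,k;$$ if $\tau=2k-1$ is odd, by $$f(\alpha_i)=h(\alpha_i),\quad f'(\alpha_i)=h'(\alpha_i),\quad i=1,\ldots,k.$$ Then $f\in\mathcal{P}_\tau\cap A_{n,h}$ is the unique optimal solution of the problem of maximizing $N^2(u_0-u(1)/N)$ over $u\in\mathcal{P}_\tau\cap A_{n,h}$, and consequently $$\mathcal{W}(n,N,\mathcal{P}_\tau;h)=R_\tau(n,N;h).$$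
   Context: Energy. For a finite set (spherical code) $C\subset\mathbb{S}^{n-1}$, $E(C;h):=\sum_{x,y\in C,\,x\ne y}h(\langle x,y\rangle)$, and $\mathcal{E}(n,N;h):=\inf\{E(C;h):C\subset\mathbb{S}^{n-1},|C|=N\}$. A potential $h:[-1,1]\to[0,+\infty]$ is absolutely monotone if it is finite and infinitely differentiable on $[-1,1)$ with $h^{(i)}(t)\ge0$ for all $t\in[-1,1)$, $i=0,1,2,\ldots$, and $h(1)=\lim_{t\to1^-}h(t)\in[0,+\infty]$. Linear programming. The Gegenbauer polynomials are $P_0^{(n)}=1$, $P_1^{(n)}=t$, $(i+n-2)P_{i+1}^{(n)}(t)=(2i+n-2)tP_i^{(n)}(t)-iP_{i-1}^{(n)}(t)$, $i\ge1$. Put $\gamma_n:=\Gamma(n/2)/(\sqrt{\pi}\,\Gamma((n-1)/2))$ and $f_0:=\gamma_n\int_{-1}^1f(t)(1-t^2)^{(n-3)/2}dt$. $A_{n,h}$ is the set of functions $f\le h$ on $[-1,1]$ of the form $f=\sum_{k\ge0}f_kP_k^{(n)}$ with $f_k\ge0$ for all $k\ge1$ (and $\sum_k f_k=f(1)<\infty$). $\mathcal{P}_m$ is the space of real polynomials of degree at most $m$. For a subspace $\Lambda\subset C([-1,1])$, $\mathcal{W}(n,N,\Lambda;h):=\sup_{f\in\Lambda\cap A_{n,h}}N^2(f_0-f(1)/N)$. Levenshtein framework. The Delsarte–Goethals–Seidel numbers are $D(n,2\ell-1)=2\binom{n+\ell-2}{n-1}$ and $D(n,2\ell)=\binom{n+\ell-1}{n-1}+\binom{n+\ell-2}{n-1}$,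 $\ell\ge1$. $\tau(n,N)$ is the unique integer $\tau\ge1$ with $N\in(D(n,\tau),D(n,\tau+1)]$. For $a,b\in\{0,1\}$, $i\ge1$, let $t_i^{a,b}$ be the greatest zero of the Jacobi polynomial $P_i^{(a+\frac{n-3}2,\,b+\frac{n-3}2)}$, and $t_0^{1,1}:=-1$. Put $\mathcal{I}_{2\ell-1}=[t_{\ell-1}^{1,1},t_\ell^{1,0}]$, $\mathcal{I}_{2\ell}=[t_\ell^{1,0},t_\ell^{1,1}]$, and $$L_{2\ell-1}(n,s)=\binom{\ell+n-3}{\ell-1}\left[\frac{2\ell+n-3}{n-1}-\frac{P_{\ell-1}^{(n)}(s)-P_\ell^{(n)}(s)}{(1-s)P_\ell^{(n)}(s)}\right],$$ $$L_{2\ell}(n,s)=\binom{\ell+n-2}{\ell}\left[\frac{2\ell+n-1}{n-1}-\frac{(1+s)(P_\ell^{(n)}(s)-P_{\ell+1}^{(n)}(s))}{(1-s)(P_\ell^{(n)}(s)+P_{\ell+1}^{(n)}(s))}\right].$$ With $\tau=\tau(n,N)$, $k=\lceil(\tau+1)/2\rceil$, let $\alpha_k=s$ be the unique solution in $\mathcal{I}_\tau$ of $L_\tau(n,s)=N$. The nodes $-1\le\alpha_1<\cdots<\alpha_k<1$ are as follows. If $\tau=2k-1$: $\alpha_1,\ldots,\alpha_k$ are the roots of $P_k(t)P_{k-1}(\alpha_k)-P_k(\alpha_k)P_{k-1}(t)=0$ with $P_i=P_i^{(\frac{n-1}2,\frac{n-3}2)}$ (Jacobi). If $\tau=2k-2$: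 $\alpha_1=-1$ and $\alpha_2,\ldots,\alpha_k$ are the roots of $P_{k-1}(t)P_{k-2}(\alpha_k)-P_{k-1}(\alpha_k)P_{k-2}(t)=0$ with $P_i=P_i^{(\frac{n-1}2,\frac{n-1}2)}$. The weights $\rho_1,\ldots,\rho_k>0$ are the uniquely determined numbers with $f_0=\frac{f(1)}N+\sum_{i=1}^k\rho_if(\alpha_i)$ for all $f\in\mathcal{P}_\tau$. *)

theory Defs
  imports "HOL-Analysis.Analysis"
begin

section \<open>Potentials and energy\<close>

text \<open>
  Only \<open>h 1\<close> may be infinite. \<open>D i\<close> is the \<open>i\<close>-th derivative of \<open>h\<close> on \<open>[-1,1)\<close>, one-sided
  at \<open>-1\<close>. Nonnegativity of \<open>h\<close> on all of \<open>[-1,1]\<close> follows from \<open>D 0 \<ge> 0\<close> and the limit.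
  Values of \<open>h\<close> outside \<open>[-1,1]\<close> play no role.
\<close>

definition absolutely_monotone :: "(real \<Rightarrow> ereal) \<Rightarrow> bool" where
  "absolutely_monotone h \<longleftrightarrow>
     (\<exists>D :: nat \<Rightarrow> real \<Rightarrow> real.
        (\<forall>t\<in>{-1..<1}. h t = ereal (D 0 t)) \<and>
        (\<forall>i. \<forall>t\<in>{-1..<1}.
           (D i has_real_derivative D (Suc i) t) (at t within {-1..<1}) \<and> D i t \<ge> 0)) \<and>
     (h \<longlongrightarrow> h 1) (at_left 1)"

definition energy :: "(real ^ 'n) set \<Rightarrow> (real \<Rightarrow> ereal) \<Rightarrow> ereal" where
  "energy C h = (\<Sum>x\<in>C. \<Sum>y\<in>C - {x}. h (x \<bullet> y))"

text \<open>The index type \<open>'n\<close> carries the dimension of the ambient space.\<close>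

definition min_energy :: "'n::finite itself \<Rightarrow> nat \<Rightarrow> (real \<Rightarrow> ereal) \<Rightarrow> ereal" where
  "min_energy _ N h =
     (INF C\<in>{C :: (real ^ 'n) set. C \<subseteq> sphere 0 1 \<and> finite C \<and> card C = N}. energy C h)"


section \<open>Linear programming\<close>

text \<open>
  The third equation is the usual recurrence, solved for the polynomial of index \<open>i + 1\<close>,
  with \<open>i = Suc j\<close>.
\<close>

fun gegenbauer :: "nat \<Rightarrow> nat \<Rightarrow> real \<Rightarrow> real" where
  "gegenbauer n 0 t = 1"
| "gegenbauer n (Suc 0) t = t"
| "gegenbauer n (Suc (Suc j)) t =
     ((2 * real (Suc j) + real n - 2) * t * gegenbauer n (Suc j) t
        - real (Suc j) * gegenbauer n j t) / (real (Suc j) + real n - 2)"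

definition gamma_const :: "nat \<Rightarrow> real" where
  "gamma_const n = Gamma (real n / 2) / (sqrt pi * Gamma ((real n - 1) / 2))"

definition zeroth_coeff :: "nat \<Rightarrow> (real \<Rightarrow> real) \<Rightarrow> real" where
  "zeroth_coeff n f =
     gamma_const n * integral {-1..1} (\<lambda>t. f t * (1 - t\<^sup>2) powr ((real n - 3) / 2))"

definition lp_class :: "nat \<Rightarrow> (real \<Rightarrow> ereal) \<Rightarrow> (real \<Rightarrow> real) set" where
  "lp_class n h =
     {f. (\<forall>t\<in>{-1..1}. ereal (f t) \<le> h t) \<and>
         (\<exists>c :: nat \<Rightarrow> real. (\<forall>k\<ge>1. c k \<ge> 0) \<and> c sums f 1 \<and>
            (\<forall>t\<in>{-1..1}. (\<lambda>k. c k * gegenbauer n k t) sums f t))}"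

definition poly_space :: "nat \<Rightarrow> (real \<Rightarrow> real) set" where
  "poly_space m = {poly p | p :: real poly. degree p \<le> m}"

definition lp_objective :: "nat \<Rightarrow> nat \<Rightarrow> (real \<Rightarrow> real) \<Rightarrow> real" where
  "lp_objective n N f = (real N)\<^sup>2 * (zeroth_coeff n f - f 1 / real N)"

definition lp_value :: "nat \<Rightarrow> nat \<Rightarrow> (real \<Rightarrow> real) set \<Rightarrow> (real \<Rightarrow> ereal) \<Rightarrow> ereal" where
  "lp_value n N \<Lambda> h = (SUP f\<in>\<Lambda> \<inter> lp_class n h. ereal (lp_objective n N f))"


section \<open>The Levenshtein framework\<close>

text \<open>Delsarte--Goethals--Seidel numbers \<open>D(n,m)\<close>, for \<open>m \<ge> 1\<close>.\<close>

definition dgs_number :: "nat \<Rightarrow> nat \<Rightarrow> nat" where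
  "dgs_number n m =
     (if odd m then let l = (m + 1) div 2 in 2 * ((n + l - 2) choose (n - 1))
      else let l = m div 2 in ((n + l - 1) choose (n - 1)) + ((n + l - 2) choose (n - 1)))"

definition levenshtein_tau :: "nat \<Rightarrow> nat \<Rightarrow> nat" where
  "levenshtein_tau n N = (THE \<tau>. \<tau> \<ge> 1 \<and> dgs_number n \<tau> < N \<and> N \<le> dgs_number n (\<tau> + 1))"

definition num_nodes :: "nat \<Rightarrow> nat" where
  "num_nodes \<tau> = nat \<lceil>(real \<tau> + 1) / 2\<rceil>"

text \<open>
  Jacobi polynomials in the standard normalization. Below they enter only through their zeros
  and through node equations that are invariant under rescaling.
\<close>

definition jacobi :: "real \<Rightarrow> real \<Rightarrow> nat \<Rightarrow> real \<Rightarrow> real" where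
  "jacobi a b i t =
     (\<Sum>s\<le>i. ((real i + a) gchoose (i - s)) * ((real i + b) gchoose s)
              * ((t - 1) / 2) ^ s * ((t + 1) / 2) ^ (i - s))"

abbreviation adj_jacobi :: "nat \<Rightarrow> nat \<Rightarrow> nat \<Rightarrow> nat \<Rightarrow> real \<Rightarrow> real" where
  "adj_jacobi n a b i \<equiv> jacobi (real a + (real n - 3) / 2) (real b + (real n - 3) / 2) i"

text \<open>Index \<open>0\<close> is used only for \<open>a = b = 1\<close>, where the value \<open>-1\<close> is a convention.\<close>

definition greatest_zero :: "nat \<Rightarrow> nat \<Rightarrow> nat \<Rightarrow> nat \<Rightarrow> real" where
  "greatest_zero n a b i = (if i = 0 then -1 else Max {t. adj_jacobi n a b i t = 0})"

definition levenshtein_interval :: "nat \<Rightarrow> nat \<Rightarrow> real set" where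
  "levenshtein_interval n m =
     (if odd m then let l = (m + 1) div 2 in {greatest_zero n 1 1 (l - 1)..greatest_zero n 1 0 l}
      else let l = m div 2 in {greatest_zero n 1 0 l..greatest_zero n 1 1 l})"

definition levenshtein_fun :: "nat \<Rightarrow> nat \<Rightarrow> real \<Rightarrow> real" where
  "levenshtein_fun n m s =
     (if odd m then let l = (m + 1) div 2 in
        real ((l + n - 3) choose (l - 1)) *
          ((2 * real l + real n - 3) / (real n - 1)
           - (gegenbauer n (l - 1) s - gegenbauer n l s) / ((1 - s) * gegenbauer n l s))
      else let l = m div 2 in
        real ((l + n - 2) choose l) *
          ((2 * real l + real n - 1) / (real n - 1)
           - (1 + s) * (gegenbauer n l s - gegenbauer n (l + 1) s)
             / ((1 - s) * (gegenbauer n l s + gegenbauer n (l + 1) s))))"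

text \<open>
  \<open>\<alpha>\<close> and \<open>\<rho>\<close> are the Levenshtein nodes and weights for \<open>(n,N)\<close>, indexed by \<open>1..k\<close>;
  their values at other indices are irrelevant.
\<close>

definition levenshtein_quadrature ::
    "nat \<Rightarrow> nat \<Rightarrow> (nat \<Rightarrow> real) \<Rightarrow> (nat \<Rightarrow> real) \<Rightarrow> bool" where
  "levenshtein_quadrature n N \<alpha> \<rho> \<longleftrightarrow>
     (let \<tau> = levenshtein_tau n N; k = num_nodes \<tau> in
        \<alpha> k \<in> levenshtein_interval n \<tau> \<and>
        levenshtein_fun n \<tau> (\<alpha> k) = real N \<and>
        -1 \<le> \<alpha> 1 \<and> strict_mono_on {1..k} \<alpha> \<and> \<alpha> k < 1 \<and>
        (if odd \<tau> then
           \<alpha> ` {1..k} =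
             {t. adj_jacobi n 1 0 k t * adj_jacobi n 1 0 (k - 1) (\<alpha> k)
                   - adj_jacobi n 1 0 k (\<alpha> k) * adj_jacobi n 1 0 (k - 1) t = 0}
         else
           \<alpha> 1 = -1 \<and>
           \<alpha> ` {2..k} =
             {t. adj_jacobi n 1 1 (k - 1) t * adj_jacobi n 1 1 (k - 2) (\<alpha> k)
                   - adj_jacobi n 1 1 (k - 1) (\<alpha> k) * adj_jacobi n 1 1 (k - 2) t = 0}) \<and>
        (\<forall>i\<in>{1..k}. \<rho> i > 0) \<and>
        (\<forall>f\<in>poly_space \<tau>.
           zeroth_coeff n f = f 1 / real N + (\<Sum>i=1..k. \<rho> i * f (\<alpha> i))))"

definition universal_bound ::
    "nat \<Rightarrow> nat \<Rightarrow> (nat \<Rightarrow> real) \<Rightarrow> (nat \<Rightarrow> real) \<Rightarrow> (real \<Rightarrow> ereal) \<Rightarrow> ereal" where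
  "universal_bound k N \<alpha> \<rho> h = ereal ((real N)\<^sup>2) * (\<Sum>i=1..k. ereal (\<rho> i) * h (\<alpha> i))"

text \<open>
  The derivative of \<open>h\<close> at a node is taken within \<open>[-1,1)\<close>, the set on which \<open>h\<close> is finite;
  at nodes in \<open>(-1,1)\<close> this is the ordinary derivative.
\<close>

definition matches_to_first_order :: "(real \<Rightarrow> ereal) \<Rightarrow> real poly \<Rightarrow> real \<Rightarrow> bool" where
  "matches_to_first_order h f a \<longleftrightarrow>
     ereal (poly f a) = h a \<and>
     ((\<lambda>t. real_of_ereal (h t)) has_real_derivative poly (pderiv f) a) (at a within {-1..<1})"

definition hermite_interpolant ::
    "nat \<Rightarrow> nat \<Rightarrow> (nat \<Rightarrow> real) \<Rightarrow> (real \<Rightarrow> ereal) \<Rightarrow> real poly \<Rightarrow> bool" where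
  "hermite_interpolant \<tau> k \<alpha> h f \<longleftrightarrow>
     degree f \<le> \<tau> \<and>
     (if even \<tau> then
        ereal (poly f (-1)) = h (-1) \<and> (\<forall>i\<in>{2..k}. matches_to_first_order h f (\<alpha> i))
      else (\<forall>i\<in>{1..k}. matches_to_first_order h f (\<alpha> i)))"

end

theory Submission
  imports Defs
begin

text \<open>
  Every polynomial \<open>f \<le> h\<close> with nonnegative Gegenbauer coefficients bounds the energy of an
  \<open>N\<close>-point code from below by \<open>N\<^sup>2 (f\<^sub>0 - f(1)/N)\<close>, because the Gegenbauer polynomials are
  positive definite on the sphere (\<open>gegenbauer_positive_definite\<close>, \<open>lp_energy_bound\<close>). If
  moreover \<open>f\<close> has degree at most \<open>\<tau>\<close>, the Levenshtein quadrature turns that number into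
  \<open>N\<^sup>2 \<Sum>\<^sub>i \<rho>\<^sub>i f(\<alpha>\<^sub>i)\<close>, which is at most \<open>N\<^sup>2 \<Sum>\<^sub>i \<rho>\<^sub>i h(\<alpha>\<^sub>i)\<close> with equality precisely when \<open>f\<close> touches
  \<open>h\<close> at all nodes. At a node in \<open>(-1,1)\<close> touching from below forces equal derivatives, so an
  optimal \<open>f\<close> has to be the Hermite interpolant. All that is left is to show that the Hermite
  interpolant is admissible.

  Iterated difference quotients write \<open>h\<close> as a Newton interpolation polynomial plus a
  remainder (\<open>newton_form\<close>). Difference quotients of absolutely monotone functions are
  absolutely monotone, so the Newton coefficients and the last factor of the remainder are
  nonnegative. The other factor of the remainder is a product of squares, times \<open>1 + t\<close> if \<open>\<tau>\<close>
  is even; hence \<open>f \<le> h\<close>. If the nodes are taken in increasing order, each of them twice, and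
  the simple node \<open>-1\<close> of the even case comes last, then every Newton basis polynomial is a
  product of two polynomials \<open>\<Prod>\<^sub>i\<^sub><\<^sub>a (t - \<beta>\<^sub>i)\<close> over an initial segment of the double nodes
  (\<open>doubled_node_product\<close>). Products of Gegenbauer polynomials are nonnegative combinations of
  Gegenbauer polynomials (\<open>linearization_nonneg\<close>, by Szwarc's discrete wave equation), so it
  suffices to treat these initial segments.

  For a discrete measure with nodes \<open>x\<^sub>0 < x\<^sub>1 < \<dots>\<close> the products \<open>\<Prod>\<^sub>i\<^sub><\<^sub>j (t - x\<^sub>i)\<close> are nonnegative
  combinations of the orthogonal polynomials of the measure (\<open>node_products_expand\<close>). In the
  odd case this applies to the quadrature measure itself, with the extra node \<open>1\<close> of weight
  \<open>1/N\<close>, whose orthogonal polynomials are the Gegenbauer polynomials. In the even case the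
  weights are multiplied by \<open>1 - t\<^sup>2\<close>, and the orthogonal polynomials become the kernels
  \<open>parity_kernel m\<close>, sums of Gegenbauer polynomials of one parity. That covers all initial
  segments but the full one; its Gegenbauer coefficients are positive multiples of just two
  numbers, one of them obviously positive, and the sign of the other one follows from
  \<open>D(n,\<tau>) < N \<le> D(n,\<tau>+1)\<close>, because the value of \<open>parity_kernel m\<close> at \<open>1\<close> is \<open>D(n,2m+1)/2\<close>
  (\<open>even_full_product\<close>). The same value shows that \<open>-1\<close> is not a node in the odd case
  (\<open>odd_first_node\<close>).
\<close>

section \<open>Gegenbauer polynomials and the spherical weight\<close>

text \<open>
  The coefficients of the recurrence \<open>t P\<^sub>m = geg_up P\<^sub>m\<^sub>+\<^sub>1 + geg_down P\<^sub>m\<^sub>-\<^sub>1\<close>. They sum to \<open>1\<close> because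
  every \<open>P\<^sub>m\<close> has value \<open>1\<close> at \<open>1\<close>. For \<open>n = 2\<close> and \<open>m = 0\<close> division by zero gives the correct
  values \<open>1\<close> and \<open>0\<close>.
\<close>
definition geg_up :: "nat \<Rightarrow> nat \<Rightarrow> real" where
  "geg_up n m = 1 - real m / (2 * real m + real n - 2)"
definition geg_down :: "nat \<Rightarrow> nat \<Rightarrow> real" where
  "geg_down n m = real m / (2 * real m + real n - 2)"

fun geg_poly :: "nat \<Rightarrow> nat \<Rightarrow> real poly" where
  "geg_poly n 0 = 1"
| "geg_poly n (Suc 0) = [:0, 1:]"
| "geg_poly n (Suc (Suc j)) = smult (1 / (real (Suc j) + real n - 2))
     (smult (2 * real (Suc j) + real n - 2) ([:0, 1:] * geg_poly n (Suc j))
      - smult (real (Suc j)) (geg_poly n j))"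

lemma poly_geg_poly: "poly (geg_poly n m) t = gegenbauer n m t"
proof (induction n m t rule: gegenbauer.induct)
  case (3 n j t)
  then show ?case by (simp add: diff_divide_distrib mult_ac)
qed simp_all

lemma geg_recurrence:
  assumes "n \<ge> 2"
  shows "[:0, 1:] * geg_poly n m =
    smult (geg_up n m) (geg_poly n (Suc m)) + smult (geg_down n m) (geg_poly n (m - 1))"
proof (cases m)
  case 0 then show ?thesis by (simp add: geg_up_def geg_down_def)
next
  case (Suc j)
  define a where "a = real (Suc j) + real n - 2"
  define b where "b = 2 * real (Suc j) + real n - 2"
  have a: "a > 0" and b: "b > 0" using assms by (auto simp: a_def b_def)
  have u: "geg_up n m = a / b" "geg_down n m = real (Suc j) / b"
    using b by (auto simp: geg_up_def geg_down_def Suc a_def b_def field_simps)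
  have "geg_poly n (Suc m) = smult (1 / a) (smult b ([:0, 1:] * geg_poly n m)
      - smult (real (Suc j)) (geg_poly n j))" unfolding Suc geg_poly.simps a_def b_def by simp
  then show ?thesis unfolding u using a b by (simp add: Suc smult_diff_right)
qed

lemma geg_up_pos: "n \<ge> 2 \<Longrightarrow> geg_up n m > 0"
  unfolding geg_up_def by (cases "2 * real m + real n - 2 = 0") (auto simp: field_simps)

lemma geg_down_pos: "n \<ge> 2 \<Longrightarrow> m \<ge> 1 \<Longrightarrow> geg_down n m > 0"
  unfolding geg_down_def by (auto simp: field_simps)

lemma geg_1: "n \<ge> 2 \<Longrightarrow> poly (geg_poly n m) 1 = 1"
proof (induction n m rule: geg_poly.induct)
  case (3 n j)
  then have "real n + real j - 1 > 0" by simp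
  with 3 show ?case by (simp add: field_simps)
qed auto

lemma geg_minus: "poly (geg_poly n m) (- t) = (- 1) ^ m * poly (geg_poly n m) t"
  by (induction n m rule: geg_poly.induct) (simp_all add: field_simps)

lemma geg_deg_lead:
  assumes "n \<ge> 2"
  shows "degree (geg_poly n m) = m \<and> lead_coeff (geg_poly n m) > 0"
  using assms
proof (induction n m rule: geg_poly.induct)
  case (3 n j)
  define a where "a = real (Suc j) + real n - 2"
  define b where "b = 2 * real (Suc j) + real n - 2"
  have a: "a > 0" and b: "b > 0" using 3 by (auto simp: a_def b_def)
  let ?p = "[:0, 1:] * geg_poly n (Suc j)"
  have IH: "degree (geg_poly n (Suc j)) = Suc j" "lead_coeff (geg_poly n (Suc j)) > 0"
    "degree (geg_poly n j) = j" using 3 by auto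
  then have "geg_poly n (Suc j) \<noteq> 0" by auto
  then have p: "degree ?p = Suc (Suc j)" "lead_coeff ?p > 0"
    using IH by simp_all
  let ?q = "smult b ?p + smult (- real (Suc j)) (geg_poly n j)"
  have "degree (smult (- real (Suc j)) (geg_poly n j)) < degree (smult b ?p)"
    using p b IH by (simp del: mult_pCons_left)
  moreover have "coeff (geg_poly n j) (Suc (Suc j)) = 0"
    by (rule coeff_eq_0) (simp add: IH)
  ultimately have "degree ?q = Suc (Suc j)" "lead_coeff ?q > 0"
    using p b by (simp_all add: degree_add_eq_left lead_coeff_add_le del: mult_pCons_left)
  moreover have "geg_poly n (Suc (Suc j)) = smult (1 / a) ?q"
    by (simp only: geg_poly.simps a_def b_def smult_minus_left diff_conv_add_uminus)
  ultimately show ?case using a by simp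
qed auto

text \<open>
  The two relations imply each other along the recurrence: the second one at \<open>m\<close> removes
  \<open>P\<^sub>m\<^sub>-\<^sub>1'\<close> from the differentiated recurrence and leaves a formula for \<open>P\<^sub>m\<^sub>+\<^sub>1'\<close> in terms of \<open>P\<^sub>m\<close>
  and \<open>P\<^sub>m'\<close>, from which both relations at \<open>m + 1\<close> follow. Together they contain the Gegenbauer
  differential equation.
\<close>
lemma geg_derivative:
  assumes "n \<ge> 2"
  shows "(1 - t\<^sup>2) * poly (pderiv (geg_poly n m)) t
           = real m * (poly (geg_poly n (m - 1)) t - t * poly (geg_poly n m) t) \<and>
         real m * poly (pderiv (geg_poly n (m - 1))) t
           = (real n - 3 + real m) * t * poly (pderiv (geg_poly n m)) t
             - real m * (real m + real n - 3) * poly (geg_poly n m) t"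
proof (induction m)
  case 0 then show ?case by (simp add: pderiv_1)
next
  case (Suc m)
  show ?case
  proof (cases m)
    case 0 then show ?thesis by (simp add: pderiv_pCons pderiv_1 power2_eq_square)
  next
    case (Suc j)
    define a where "a = real m + real n - 2"
    have a: "a > 0" using assms by (simp add: a_def Suc)
    define p where "p = geg_poly n m"
    define q where "q = geg_poly n (m - 1)"
    define r where "r = geg_poly n (Suc m)"
    define P where "P = poly p t"
    define P' where "P' = poly (pderiv p) t"
    define Q where "Q = poly q t"
    define Q' where "Q' = poly (pderiv q) t"
    define R where "R = poly r t"
    define R' where "R' = poly (pderiv r) t"
    have rec: "smult a r = smult (a + real m) ([:0,1:] * p) - smult (real m) q"
      unfolding p_def q_def r_def a_def using a[unfolded a_def] Suc
      by (simp add: algebra_simps)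
    have aR: "a * R = (a + real m) * t * P - real m * Q"
      using arg_cong[OF rec, of "\<lambda>u. poly u t"] by (simp add: R_def P_def Q_def)
    have "pderiv (smult a r) = pderiv (smult (a + real m) ([:0,1:] * p) - smult (real m) q)"
      by (simp only: rec)
    then have "smult a (pderiv r) = smult (a + real m) ([:0,1:] * pderiv p + p) - smult (real m) (pderiv q)"
      by (simp only: pderiv_smult pderiv_diff pderiv_mult) (simp add: pderiv_pCons)
    from arg_cong[OF this, of "\<lambda>u. poly u t"]
    have aR': "a * R' = (a + real m) * (P + t * P') - real m * Q'"
      by (simp add: R'_def P_def Q'_def P'_def algebra_simps)
    have A: "(1 - t\<^sup>2) * P' = real m * (Q - t * P)"
      using Suc.IH by (simp add: P'_def p_def Q_def q_def P_def)
    have B: "real m * Q' = (a - 1) * t * P' - real m * (a - 1) * P"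
      using Suc.IH by (simp add: P'_def p_def Q'_def q_def P_def a_def algebra_simps)
    have C: "a * R' = (real m + 1) * (a * P + t * P')"
      unfolding aR' B by (simp add: algebra_simps)
    have A2: "t\<^sup>2 * P' = P' - real m * (Q - t * P)" using A by (simp add: algebra_simps)
    have "a * ((1 - t\<^sup>2) * R') = (1 - t\<^sup>2) * (a * R')" by simp
    also have "\<dots> = (real m + 1) * (a * (1 - t\<^sup>2) * P + t * ((1 - t\<^sup>2) * P'))"
      unfolding C by (simp add: algebra_simps)
    also have "\<dots> = (real m + 1) * (a * P - t * (a * R))"
      unfolding A aR by (simp add: algebra_simps power2_eq_square)
    finally have "a * ((1 - t\<^sup>2) * R') = a * ((real m + 1) * (P - t * R))"
      by (simp add: algebra_simps)
    then have G1: "(1 - t\<^sup>2) * R' = (real m + 1) * (P - t * R)" using a by simp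
    have "t * (a * R') = (real m + 1) * (a * t * P + t\<^sup>2 * P')"
      unfolding C by (simp add: algebra_simps power2_eq_square)
    also have "\<dots> = (real m + 1) * (a * R + P')"
      unfolding A2 aR by (simp add: algebra_simps)
    finally have G2: "(real m + 1) * P' = a * t * R' - (real m + 1) * a * R"
      by (simp add: algebra_simps)
    show ?thesis
      using G1 G2 by (simp add: P_def P'_def R_def R'_def r_def p_def a_def algebra_simps)
  qed
qed

declare geg_poly.simps(3) [simp del]

definition sph_weight :: "nat \<Rightarrow> real \<Rightarrow> real" where
  "sph_weight n t = (1 - t\<^sup>2) powr ((real n - 3) / 2)"

text \<open>
  The Gegenbauer equation says that \<open>- (1 - t\<^sup>2)\<^bsup>(n-1)/2\<^esup> P\<^sub>m' / (m (m + n - 2))\<close> is a primitive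
  of the integrand; it vanishes at both endpoints. The open interval suffices for the
  derivative, so the endpoint singularity of the weight for \<open>n = 2\<close> does no harm.
\<close>
lemma geg_has_integral_0:
  assumes n: "n \<ge> 2" and m: "m \<ge> 1"
  shows "((\<lambda>t. poly (geg_poly n m) t * sph_weight n t) has_integral 0) {-1..1}"
proof -
  define c where "c = real m * (real m + real n - 2)"
  have c: "c > 0" using n m by (simp add: c_def)
  let ?P = "geg_poly n m"
  define F where "F t = - ((1 - t\<^sup>2) powr ((real n - 1) / 2) * poly (pderiv ?P) t / c)" for t :: real
  have "((\<lambda>t. poly ?P t * sph_weight n t) has_integral (F 1 - F (-1))) {-1..1}"
  proof (rule fundamental_theorem_of_calculus_interior)
    show "continuous_on {-1..1} F" unfolding F_def using n
      by (intro continuous_on_minus continuous_on_divide continuous_on_mult continuous_on_powr'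
            continuous_intros) (use c in \<open>auto simp: abs_square_le_1 abs_le_iff\<close>)
  next
    fix t :: real assume t: "t \<in> {-1<..<1}"
    then have t1: "1 - t\<^sup>2 > 0" by (simp add: abs_square_less_1 abs_less_iff)
    have w: "(1 - t\<^sup>2) powr ((real n - 1) / 2) = (1 - t\<^sup>2) * sph_weight n t"
      "(1 - t\<^sup>2) powr ((real n - 1) / 2 - 1) = sph_weight n t"
      using t1 by (simp_all add: sph_weight_def powr_mult_base diff_divide_distrib)
    define b where "b = (real n - 1) / 2"
    have "((\<lambda>t. (1 - t\<^sup>2) powr b) has_real_derivative
        b * (1 - t\<^sup>2) powr (b - 1) * (0 - 2 * t)) (at t)"
      using t1 by (auto intro!: derivative_eq_intros simp: divide_simps powr_diff)
    then have dw: "((\<lambda>t. (1 - t\<^sup>2) powr ((real n - 1) / 2)) has_real_derivative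
        - (real n - 1) * t * sph_weight n t) (at t)"
      unfolding b_def w by (rule DERIV_cong) (simp add: field_simps)
    have dF: "(F has_real_derivative
        - (- (real n - 1) * t * sph_weight n t * poly (pderiv ?P) t
           + (1 - t\<^sup>2) * sph_weight n t * poly (pderiv (pderiv ?P)) t) / c) (at t)"
      unfolding F_def
      by (rule DERIV_cong[OF DERIV_minus[OF DERIV_cdivide[OF DERIV_mult[OF dw poly_DERIV]]]])
         (use c in \<open>simp add: w field_simps\<close>)
    have ode: "(1 - t\<^sup>2) * poly (pderiv (pderiv ?P)) t - (real n - 1) * t * poly (pderiv ?P) t
        = - c * poly ?P t"
    proof -
      have d: "((\<lambda>t. (1 - t\<^sup>2) * poly (pderiv ?P) t - real m * (poly (geg_poly n (m - 1)) t - t * poly ?P t))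
          has_real_derivative ((1 - t\<^sup>2) * poly (pderiv (pderiv ?P)) t - 2 * t * poly (pderiv ?P) t
            - real m * (poly (pderiv (geg_poly n (m - 1))) t - poly ?P t - t * poly (pderiv ?P) t))) (at t)"
        by (auto intro!: derivative_eq_intros poly_DERIV simp: algebra_simps)
      have z: "(\<lambda>t. (1 - t\<^sup>2) * poly (pderiv ?P) t - real m * (poly (geg_poly n (m - 1)) t - t * poly ?P t)) = (\<lambda>t. 0)"
        using geg_derivative[OF n, of _ m] by auto
      have "(1 - t\<^sup>2) * poly (pderiv (pderiv ?P)) t - 2 * t * poly (pderiv ?P) t
            - real m * (poly (pderiv (geg_poly n (m - 1))) t - poly ?P t - t * poly (pderiv ?P) t) = 0"
        by (rule DERIV_unique[OF d[unfolded z] DERIV_const])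
      then show ?thesis using geg_derivative[OF n, of t m]
        by (simp add: c_def algebra_simps)
    qed
    have e: "- (real n - 1) * t * sph_weight n t * poly (pderiv ?P) t
           + (1 - t\<^sup>2) * sph_weight n t * poly (pderiv (pderiv ?P)) t
        = sph_weight n t * ((1 - t\<^sup>2) * poly (pderiv (pderiv ?P)) t - (real n - 1) * t * poly (pderiv ?P) t)"
      by (simp add: algebra_simps)
    have "(F has_real_derivative - (sph_weight n t * (- c * poly ?P t)) / c) (at t)"
      by (rule dF[unfolded e ode])
    then show "(F has_vector_derivative poly ?P t * sph_weight n t) (at t)"
      using c by (simp add: has_real_derivative_iff_has_vector_derivative mult.commute)
  qed simp
  moreover have "F 1 = 0" "F (-1) = 0" using n by (simp_all add: F_def)
  ultimately show ?thesis by simp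
qed

lemma gamma_const_pos: "n \<ge> 2 \<Longrightarrow> gamma_const n > 0"
  unfolding gamma_const_def by (intro divide_pos_pos mult_pos_pos Gamma_real_pos) auto

text \<open>
  The substitution \<open>t = 2u - 1\<close> reduces the mass of the weight to the Beta integral \<open>Beta a a\<close>
  with \<open>a = (n-1)/2\<close>, and Legendre's duplication formula identifies it with the reciprocal of
  the normalizing constant.
\<close>
lemma weight_has_integral:
  assumes n: "n \<ge> 2"
  shows "(sph_weight n has_integral 1 / gamma_const n) {-1..1}"
proof -
  define a where "a = (real n - 1) / 2"
  have a: "a > 0" using n by (simp add: a_def)
  from has_integral_affinity'[OF has_integral_Beta_real[OF a a, unfolded cbox_interval[symmetric]], of "1/2" "1/2"]
  have "((\<lambda>x. ((x + 1) / 2) powr (a - 1) * ((1 - x) / 2) powr (a - 1)) has_integral 2 * Beta a a) {-1..1}"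
    by (simp add: field_simps)
  then have "((\<lambda>x. 2 powr (2 * a - 2) * (((x + 1) / 2) powr (a - 1) * ((1 - x) / 2) powr (a - 1)))
      has_integral 2 powr (2 * a - 2) * (2 * Beta a a)) {-1..1}"
    by (rule has_integral_mult_right)
  moreover have "2 powr (2 * a - 2) * (((x + 1) / 2) powr (a - 1) * ((1 - x) / 2) powr (a - 1)) = sph_weight n x"
    if "x \<in> {-1..1}" for x
  proof -
    have "2 powr (2 * a - 2) = (2 powr (a - 1)) * (2 powr (a - 1) :: real)"
      by (simp add: powr_add[symmetric])
    moreover have "(1 - x\<^sup>2) powr (a - 1) = (1 + x) powr (a - 1) * (1 - x) powr (a - 1)"
      using that by (subst powr_mult[symmetric]) (auto simp: power2_eq_square algebra_simps)
    moreover have "(real n - 3) / 2 = a - 1" by (simp add: a_def field_simps)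
    moreover note \<open>(real n - 3) / 2 = a - 1\<close>
    ultimately show ?thesis using that unfolding sph_weight_def
      by (simp only: \<open>(real n - 3) / 2 = a - 1\<close>) (simp add: powr_divide add.commute)
  qed
  ultimately have I: "(sph_weight n has_integral 2 powr (2 * a - 2) * (2 * Beta a a)) {-1..1}"
    by (rule has_integral_cong[THEN iffD1, rotated]) auto
  have "Gamma (complex_of_real a) * Gamma (complex_of_real a + 1/2) =
      exp ((1 - 2 * complex_of_real a) * of_real (ln 2)) * of_real (sqrt pi) * Gamma (2 * complex_of_real a)"
    using a by (intro Gamma_legendre_duplication) (auto simp: nonpos_Ints_def complex_eq_iff)
  also have "\<dots> = of_real (exp ((1 - 2 * a) * ln 2) * sqrt pi * Gamma (2 * a))"
    by (simp add: exp_of_real[symmetric] Gamma_complex_of_real[symmetric])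
  also have "Gamma (complex_of_real a) * Gamma (complex_of_real a + 1/2) = of_real (Gamma a * Gamma (a + 1/2))"
    by (simp add: Gamma_complex_of_real[symmetric])
  finally have "Gamma a * Gamma (a + 1/2) = exp ((1 - 2 * a) * ln 2) * sqrt pi * Gamma (2 * a)"
    by (simp only: of_real_eq_iff)
  then have dup: "Gamma a * Gamma (a + 1/2) = 2 powr (1 - 2 * a) * sqrt pi * Gamma (2 * a)"
    by (simp add: powr_def)
  have pos: "Gamma a > 0" "Gamma (a + 1/2) > 0" "Gamma (2 * a) > 0"
    using a by (auto intro: Gamma_real_pos)
  have p2: "2 powr (1 - 2 * a) = 1 / (2 * 2 powr (2 * a - 2) :: real)"
    by (simp add: powr_diff field_simps)
  have g: "gamma_const n = Gamma (a + 1/2) / (sqrt pi * Gamma a)"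
    unfolding gamma_const_def a_def by (simp add: field_simps)
  have "2 powr (2 * a - 2) * (2 * Beta a a) = 1 / gamma_const n"
    using dup pos unfolding g Beta_def p2 by (simp add: field_simps)
  with I show ?thesis by simp
qed

section \<open>Orthogonality and parity kernels\<close>

lemma smult_sum_right: "smult c (\<Sum>i\<in>A. f i) = (\<Sum>i\<in>A. smult c (f i))"
  by (induction A rule: infinite_finite_induct) (simp_all add: smult_add_right)

lemma poly_basis_expansion:
  fixes p :: "nat \<Rightarrow> 'a::field poly"
  assumes "\<And>l. l \<le> m \<Longrightarrow> degree (p l) = l" "\<And>l. l \<le> m \<Longrightarrow> p l \<noteq> 0" "degree q \<le> m"
  obtains c where "q = (\<Sum>l\<le>m. smult (c l) (p l))"
proof -
  have "\<exists>c. q = (\<Sum>l\<le>m. smult (c l) (p l))" using assms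
  proof (induction m arbitrary: q)
    case 0
    from 0(1)[of 0] obtain a where a: "p 0 = [:a:]" by (auto elim: degree_eq_zeroE)
    from 0(3) obtain b where b: "q = [:b:]" by (auto elim: degree_eq_zeroE)
    show ?case using 0(2)[of 0] a b by (auto intro!: exI[of _ "\<lambda>_. b / a"])
  next
    case (Suc m)
    define b where "b = coeff q (Suc m) / lead_coeff (p (Suc m))"
    have l: "degree (p (Suc m)) = Suc m" "lead_coeff (p (Suc m)) \<noteq> 0"
      using Suc.prems(1)[of "Suc m"] Suc.prems(2)[of "Suc m"] leading_coeff_0_iff[of "p (Suc m)"]
      by auto
    have "degree (q - smult b (p (Suc m))) \<le> m"
    proof (rule degree_le, intro allI impI)
      fix i assume "i > m"
      then consider "i = Suc m" | "i > Suc m" by linarith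
      then show "coeff (q - smult b (p (Suc m))) i = 0"
      proof cases
        case 1 then show ?thesis using l by (simp add: b_def)
      next
        case 2 then show ?thesis using l Suc.prems(3) by (simp add: coeff_eq_0)
      qed
    qed
    from Suc.IH[OF _ _ this] Suc.prems(1,2) obtain c
      where c: "q - smult b (p (Suc m)) = (\<Sum>l\<le>m. smult (c l) (p l))" by auto
    have "q = (\<Sum>l\<le>Suc m. smult ((c(Suc m := b)) l) (p l))"
      using c by (simp add: diff_eq_eq)
    then show ?case by blast
  qed
  then show ?thesis using that by blast
qed

locale sphere_dimension =
  fixes n :: nat
  assumes n_ge_2: "n \<ge> 2"
begin

abbreviation P :: "nat \<Rightarrow> real poly" where "P \<equiv> geg_poly n"

lemma P_degree [simp]: "degree (P m) = m"
  and P_lead: "lead_coeff (P m) > 0"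
  and P_nonzero [simp]: "P m \<noteq> 0"
  using geg_deg_lead[OF n_ge_2, of m] by auto

lemma P_expansion:
  assumes "degree q \<le> m"
  obtains c where "q = (\<Sum>l\<le>m. smult (c l) (P l))"
  using poly_basis_expansion[of m P q] assms by auto

text \<open>
  The average over the sphere of the zonal function \<open>x \<mapsto> p(\<langle>x,y\<rangle>)\<close>, for any point \<open>y\<close> of the
  sphere.
\<close>
definition mean :: "real poly \<Rightarrow> real" where "mean p = zeroth_coeff n (poly p)"

lemma geg_integral:
  "((\<lambda>t. poly (P m) t * sph_weight n t) has_integral (if m = 0 then 1 / gamma_const n else 0)) {-1..1}"
  using geg_has_integral_0[OF n_ge_2, of m] weight_has_integral[OF n_ge_2] by (cases m) auto

lemma mean_integrable: "(\<lambda>t. poly p t * sph_weight n t) integrable_on {-1..1}"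
proof -
  obtain c where "p = (\<Sum>l\<le>degree p. smult (c l) (P l))" by (rule P_expansion[OF order_refl])
  then have "poly p t = (\<Sum>l\<le>degree p. c l * poly (P l) t)" for t
    by (subst (asm) poly_eq_poly_eq_iff[symmetric]) (simp only: poly_sum poly_smult)
  then have "(\<lambda>t. poly p t * sph_weight n t) =
      (\<lambda>t. \<Sum>l\<le>degree p. c l * (poly (P l) t * sph_weight n t))"
    by (simp add: sum_distrib_right mult.assoc)
  moreover have "(\<lambda>t. \<Sum>l\<le>degree p. c l * (poly (P l) t * sph_weight n t)) integrable_on {-1..1}"
    using geg_integral by (intro integrable_sum integrable_on_mult_right) (auto simp: integrable_on_def)
  ultimately show ?thesis by simp
qed

lemma mean_alt: "mean p = gamma_const n * integral {-1..1} (\<lambda>t. poly p t * sph_weight n t)"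
  by (simp add: mean_def zeroth_coeff_def sph_weight_def)

lemma mean_add: "mean (p + q) = mean p + mean q"
  unfolding mean_alt by (simp add: distrib_right integral_add[OF mean_integrable mean_integrable] distrib_left)

lemma mean_smult: "mean (smult c p) = c * mean p"
  unfolding mean_alt by (simp add: mult.assoc)

lemma mean_0: "mean 0 = 0" by (simp add: mean_alt)

lemma mean_sum: "mean (sum f A) = (\<Sum>x\<in>A. mean (f x))"
  by (induction A rule: infinite_finite_induct) (auto simp: mean_0 mean_add)

lemma mean_P: "mean (P m) = (if m = 0 then 1 else 0)"
  unfolding mean_alt integral_unique[OF geg_integral] using gamma_const_pos[OF n_ge_2] by simp

lemma recurrence: "[:0, 1:] * P m = smult (geg_up n m) (P (Suc m)) + smult (geg_down n m) (P (m - 1))"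
  by (rule geg_recurrence[OF n_ge_2])

lemma mean_recurrence:
  "geg_up n i * mean (P (Suc i) * p) + geg_down n i * mean (P (i - 1) * p) = mean (P i * ([:0, 1:] * p))"
proof -
  have "mean (P i * ([:0, 1:] * p)) = mean (([:0, 1:] * P i) * p)"
    by (simp only: mult_ac)
  then show ?thesis unfolding recurrence by (simp add: distrib_right mean_add mean_smult)
qed

text \<open>
  The recurrence alone propagates orthogonality from \<open>P\<^sub>0\<close>, that is from \<open>mean P\<^sub>j = 0\<close>: the
  multiplication by \<open>t\<close> moves freely between the factors.
\<close>
lemma P_orthogonal_less: "i < j \<Longrightarrow> mean (P i * P j) = 0"
proof (induction i arbitrary: j rule: less_induct)
  case (less i)
  show ?case
  proof (cases i)
    case 0 then show ?thesis using less by (simp add: mean_P)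
  next
    case (Suc i')
    have "geg_up n i' * mean (P i * P j) + geg_down n i' * mean (P (i' - 1) * P j) = mean (P i' * ([:0, 1:] * P j))"
      using mean_recurrence[of i' "P j"] by (simp add: Suc)
    also have "\<dots> = geg_up n j * mean (P i' * P (Suc j)) + geg_down n j * mean (P i' * P (j - 1))"
      unfolding recurrence by (simp add: distrib_left mean_add mean_smult)
    also have "\<dots> = 0" using less Suc by simp
    also have "geg_down n i' * mean (P (i' - 1) * P j) = 0"
      using less.IH[of "i' - 1" j] less.prems Suc by (cases i') (auto simp: geg_down_def)
    finally show ?thesis using geg_up_pos[OF n_ge_2, of i'] by simp
  qed
qed

lemma P_orthogonal: "i \<noteq> j \<Longrightarrow> mean (P i * P j) = 0"
  using P_orthogonal_less[of i j] P_orthogonal_less[of j i] by (auto simp: mult.commute neq_iff)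

lemma norm_step: "geg_up n m * mean (P (Suc m) * P (Suc m)) = geg_down n (Suc m) * mean (P m * P m)"
proof -
  have "mean (P m * ([:0, 1:] * P (Suc m))) = geg_up n m * mean (P (Suc m) * P (Suc m))"
    using mean_recurrence[of m "P (Suc m)"] P_orthogonal[of "m - 1" "Suc m"] by simp
  moreover have "mean (P m * ([:0, 1:] * P (Suc m))) = geg_down n (Suc m) * mean (P m * P m)"
    unfolding recurrence using P_orthogonal[of m "Suc (Suc m)"] by (simp add: distrib_left mean_add mean_smult)
  ultimately show ?thesis by simp
qed

lemma norm_pos: "mean (P m * P m) > 0"
proof (induction m)
  case 0 then show ?case using mean_P[of 0] by simp
next
  case (Suc m)
  have "geg_up n m * mean (P (Suc m) * P (Suc m)) > 0"
    unfolding norm_step using Suc geg_down_pos[OF n_ge_2, of "Suc m"] by simp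
  then show ?case using geg_up_pos[OF n_ge_2, of m] by (simp add: zero_less_mult_iff)
qed

text \<open>
  The dimension of the space of spherical harmonics of degree \<open>m\<close>. It is the reciprocal of the
  squared norm because \<open>P\<^sub>m\<close> has value \<open>1\<close> at \<open>1\<close>.
\<close>
definition harm_dim :: "nat \<Rightarrow> real" where "harm_dim m = 1 / mean (P m * P m)"

lemma harm_dim_pos: "harm_dim m > 0" using norm_pos by (simp add: harm_dim_def)

lemma harm_dim_0 [simp]: "harm_dim 0 = 1" using mean_P[of 0] by (simp add: harm_dim_def)

lemma harm_dim_step: "geg_down n (Suc m) * harm_dim (Suc m) = geg_up n m * harm_dim m"
  using norm_step[of m] norm_pos[of m] norm_pos[of "Suc m"] by (simp add: harm_dim_def field_simps)

lemma mean_PP: "mean (P i * P j) = (if i = j then 1 / harm_dim i else 0)"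
  using P_orthogonal by (simp add: harm_dim_def)

lemma expansion_coeffs:
  assumes "degree q \<le> m"
  shows "q = (\<Sum>l\<le>m. smult (mean (q * P l) * harm_dim l) (P l))"
proof -
  obtain c where c: "q = (\<Sum>l\<le>m. smult (c l) (P l))" by (rule P_expansion[OF assms])
  have "mean (q * P l) * harm_dim l = c l" if "l \<le> m" for l
  proof -
    have "mean (q * P l) = (\<Sum>i\<le>m. c i * mean (P i * P l))"
      unfolding c by (simp add: sum_distrib_right mean_sum mean_smult)
    also have "\<dots> = (\<Sum>i\<le>m. if i = l then c l / harm_dim l else 0)"
      by (intro sum.cong) (auto simp: mean_PP)
    also have "\<dots> = c l / harm_dim l" using that by simp
    finally show ?thesis using harm_dim_pos[of l] by simp
  qed
  then have "(\<Sum>l\<le>m. smult (mean (q * P l) * harm_dim l) (P l)) = (\<Sum>l\<le>m. smult (c l) (P l))"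
    by (intro sum.cong) auto
  with c show ?thesis by simp
qed

lemma mean_high_degree: "degree q < m \<Longrightarrow> mean (q * P m) = 0"
proof -
  assume a: "degree q < m"
  obtain c where c: "q = (\<Sum>l\<le>degree q. smult (c l) (P l))" by (rule P_expansion[OF order_refl])
  have "mean (q * P m) = (\<Sum>l\<le>degree q. c l * mean (P l * P m))"
    by (subst c) (simp add: sum_distrib_right mean_sum mean_smult)
  also have "\<dots> = 0" using a by (intro sum.neutral) (auto simp: mean_PP)
  finally show ?thesis .
qed

text \<open>
  The reproducing kernel at \<open>1\<close> of the polynomials of degree at most \<open>m\<close> with the parity of
  \<open>m\<close>; up to a factor, the Gegenbauer polynomial of degree \<open>m\<close> in dimension \<open>n + 2\<close>.
\<close>
definition parity_kernel :: "nat \<Rightarrow> real poly" where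
  "parity_kernel m = (\<Sum>j | j \<le> m \<and> even (m + j). smult (harm_dim j) (P j))"

text \<open>
  The right-hand side is the value at \<open>1\<close> of the part of \<open>q\<close> with the parity of \<open>m\<close>. One extra
  degree is allowed because \<open>P\<^sub>m\<^sub>+\<^sub>1\<close> has the other parity.
\<close>
lemma parity_kernel_reproduces:
  assumes "degree q \<le> Suc m"
  shows "mean (q * parity_kernel m) = (poly q 1 + (-1) ^ m * poly q (-1)) / 2"
proof -
  obtain c where c: "q = (\<Sum>l\<le>Suc m. smult (c l) (P l))" by (rule P_expansion[OF assms])
  let ?A = "{j. j \<le> m \<and> even (m + j)}"
  have fin: "finite ?A" by simp
  have PK: "mean (P l * parity_kernel m) = (if even (m + l) then 1 else 0)" if "l \<le> Suc m" for l
  proof -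
    have "mean (P l * parity_kernel m) = (\<Sum>j\<in>?A. harm_dim j * mean (P l * P j))"
      by (simp add: parity_kernel_def sum_distrib_left mean_sum mean_smult)
    also have "\<dots> = (\<Sum>j\<in>?A. if j = l then 1 else 0)"
      using harm_dim_pos by (intro sum.cong) (auto simp: mean_PP less_imp_neq[OF harm_dim_pos, symmetric])
    also have "\<dots> = (if l \<in> ?A then 1 else 0)" using fin by simp
    also have "l \<in> ?A \<longleftrightarrow> even (m + l)" using that by (cases "l = Suc m") auto
    finally show ?thesis .
  qed
  have m1: "poly (P l) (-1) = (-1) ^ l" for l
    using geg_minus[of n l 1] geg_1[OF n_ge_2] by simp
  have "mean (q * parity_kernel m) = (\<Sum>l\<le>Suc m. c l * mean (P l * parity_kernel m))"
    by (subst c) (simp only: sum_distrib_right mean_sum mean_smult mult_smult_left)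
  also have "\<dots> = (\<Sum>l\<le>Suc m. c l * ((1 + (-1) ^ (m + l)) / 2))"
    by (intro sum.cong) (auto simp: PK)
  also have "\<dots> = (poly q 1 + (-1) ^ m * poly q (-1)) / 2"
  proof -
    have "poly q 1 = (\<Sum>l\<le>Suc m. c l)" "poly q (-1) = (\<Sum>l\<le>Suc m. c l * (-1) ^ l)"
      by (subst c, simp only: poly_sum poly_smult m1 geg_1[OF n_ge_2] mult_1_right)+
    then show ?thesis
      by (simp only: sum_distrib_left sum.distrib[symmetric] sum_divide_distrib)
         (intro sum.cong refl, simp add: field_simps power_add)
  qed
  finally show ?thesis .
qed

lemma parity_kernel_step: "parity_kernel (Suc (Suc m)) = parity_kernel m + smult (harm_dim (Suc (Suc m))) (P (Suc (Suc m)))"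
proof -
  have "{j. j \<le> Suc (Suc m) \<and> even (Suc (Suc m) + j)} = insert (Suc (Suc m)) {j. j \<le> m \<and> even (m + j)}"
    by (auto simp: le_Suc_eq)
  then show ?thesis by (simp add: parity_kernel_def add.commute)
qed

lemma choose_step:
  "real ((n + Suc j - 1) choose (n - 1)) * (real j + 1) = real ((n + j - 1) choose (n - 1)) * (real n + real j)"
proof -
  have "Suc j * (n + j choose Suc j) = (n + j) * (n + j - 1 choose j)"
    by (rule binomial_absorption)
  moreover have "n + j choose Suc j = n + j choose (n - 1)" "n + j - 1 choose j = n + j - 1 choose (n - 1)"
    using n_ge_2 by (subst binomial_symmetric; simp)+
  ultimately have "Suc j * (n + j choose (n - 1)) = (n + j) * (n + j - 1 choose (n - 1))" by simp
  from arg_cong[OF this, of real] show ?thesis by (simp add: algebra_simps)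
qed

text \<open>
  If \<open>C\<^sub>m\<close> is the dimension of the space of homogeneous polynomials of degree \<open>m\<close>, this is the
  formula \<open>C\<^sub>m - C\<^sub>m\<^sub>-\<^sub>2\<close> for the dimension of the harmonic ones, expressed by \<open>C\<^sub>m\<close> alone and with
  denominators cleared. Both sides satisfy the same recurrence of first order.
\<close>
lemma harm_dim_closed:
  assumes "m \<ge> 1"
  shows "harm_dim m * (real n + real m - 1) * (real n + real m - 2)
    = real ((n + m - 1) choose (n - 1)) * (real n - 1) * (2 * real m + real n - 2)"
  using assms
proof (induction m rule: nat_induct_at_least)
  case base
  have "harm_dim 1 = real n" using harm_dim_step[of 0] n_ge_2 by (simp add: geg_down_def geg_up_def field_simps)
  moreover have "n choose (n - 1) = n" using n_ge_2 by (cases n) simp_all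
  ultimately show ?case by simp
next
  case (Suc m)
  define M where "M = real m"
  define N where "N = real n"
  define B where "B = real ((n + m - 1) choose (n - 1))"
  have MN: "M \<ge> 1" "N \<ge> 2" using Suc n_ge_2 by (auto simp: M_def N_def)
  have bin: "real ((n + Suc m - 1) choose (n - 1)) * (M + 1) = B * (N + M)"
    using choose_step[of m] by (simp add: M_def N_def B_def)
  have "harm_dim (Suc m) * (M + 1) / (2 * M + N) = harm_dim m * (M + N - 2) / (2 * M + N - 2)"
  proof -
    have "geg_down n (Suc m) = (M + 1) / (2 * M + N)" "geg_up n m = (M + N - 2) / (2 * M + N - 2)"
      using MN by (simp_all add: geg_down_def geg_up_def M_def N_def field_simps)
    then show ?thesis using harm_dim_step[of m] by (simp add: mult.commute)
  qed
  then have rs: "harm_dim (Suc m) * (M + 1) * (2 * M + N - 2) = harm_dim m * (M + N - 2) * (2 * M + N)"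
    using MN by (simp add: field_simps)
  have IH: "harm_dim m * (N + M - 1) * (N + M - 2) = B * (N - 1) * (2 * M + N - 2)"
    using Suc by (simp add: M_def N_def B_def)
  have "(harm_dim (Suc m) * (N + M) * (N + M - 1)) * ((M + 1) * (2 * M + N - 2))
     = (harm_dim (Suc m) * (M + 1) * (2 * M + N - 2)) * (N + M) * (N + M - 1)" by (simp add: mult_ac)
  also have "\<dots> = (harm_dim m * (N + M - 1) * (N + M - 2)) * (2 * M + N) * (N + M)"
    unfolding rs by (simp add: mult_ac add.commute)
  also have "\<dots> = (B * (N + M)) * (N - 1) * (2 * M + N) * (2 * M + N - 2)"
    unfolding IH by (simp add: mult_ac)
  also have "\<dots> = (real ((n + Suc m - 1) choose (n - 1)) * (N - 1) * (2 * M + N)) * ((M + 1) * (2 * M + N - 2))"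
    unfolding bin[symmetric] by (simp add: mult_ac)
  finally have "harm_dim (Suc m) * (N + M) * (N + M - 1) = real ((n + Suc m - 1) choose (n - 1)) * (N - 1) * (2 * M + N)"
    using MN by simp
  then show ?case by (simp add: M_def N_def algebra_simps)
qed

text \<open>
  Homogeneous polynomials of degree \<open>m\<close> restrict to the sphere as the sum of the harmonics of
  degrees \<open>m, m - 2, \<dots>\<close>; the value is their dimension, half of \<open>D(n,2m+1)\<close>.
\<close>
lemma parity_kernel_at_1: "poly (parity_kernel m) 1 = real ((n + m - 1) choose (n - 1))"
proof (induction m rule: induct_nat_012)
  case 0
  have "{j. j = 0 \<and> even j} = {0::nat}" by auto
  then show ?case by (simp add: parity_kernel_def)
next
  case 1
  have "{j. j \<le> Suc 0 \<and> even (Suc 0 + j)} = {Suc 0}" by (auto simp: le_Suc_eq)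
  moreover have "harm_dim (Suc 0) = real n" using harm_dim_step[of 0] n_ge_2 by (simp add: geg_down_def geg_up_def field_simps)
  moreover have "n choose (n - 1) = n" using n_ge_2 by (cases n) simp_all
  ultimately show ?case by (simp add: parity_kernel_def)
next
  case (ge2 m)
  define M where "M = real m"
  define N where "N = real n"
  have MN: "M \<ge> 0" "N \<ge> 2" using n_ge_2 by (auto simp: M_def N_def)
  define C where "C j = real ((n + j - 1) choose (n - 1))" for j
  have step: "C (Suc j) * (real j + 1) = C j * (N + real j)" for j
    using choose_step[of j] by (simp add: C_def N_def)
  have s1: "C (Suc m) * (M + 1) = C m * (N + M)" using step[of m] by (simp add: M_def)
  have s2: "C (Suc (Suc m)) * (M + 2) = C (Suc m) * (N + M + 1)"
    using step[of "Suc m"] by (simp add: M_def algebra_simps)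
  have rr: "harm_dim (Suc (Suc m)) * (N + M + 1) * (N + M) = C (Suc (Suc m)) * (N - 1) * (2 * M + N + 2)"
    using harm_dim_closed[of "Suc (Suc m)"] by (simp add: C_def M_def N_def algebra_simps)
  have "(N + M + 1) * (N + M) * (C m + harm_dim (Suc (Suc m)) - C (Suc (Suc m))) = 0"
  proof -
    have "(N + M + 1) * (N + M) * C m = C (Suc (Suc m)) * (M + 2) * (M + 1)"
    proof -
      have "(N + M + 1) * (N + M) * C m = (N + M + 1) * (C (Suc m) * (M + 1))"
        unfolding s1 by (simp only: mult_ac)
      also have "\<dots> = (C (Suc m) * (N + M + 1)) * (M + 1)" by (simp only: mult_ac)
      finally show ?thesis unfolding s2[symmetric] .
    qed
    then show ?thesis using rr by (simp add: algebra_simps)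
  qed
  then have "C m + harm_dim (Suc (Suc m)) = C (Suc (Suc m))" using MN by simp
  then show ?case using ge2 by (simp add: parity_kernel_step geg_1[OF n_ge_2] C_def)
qed

lemma parity_kernel_minus: "poly (parity_kernel m) (-1) = (-1) ^ m * poly (parity_kernel m) 1"
proof -
  have m1: "poly (P l) (-1) = (-1) ^ l" for l
    using geg_minus[of n l 1] geg_1[OF n_ge_2] by simp
  have e: "(-1 :: real) ^ l = (-1) ^ m" if "even (m + l)" for l
    using that by (auto simp: minus_one_power_iff)
  show ?thesis
    unfolding parity_kernel_def poly_sum poly_smult sum_distrib_left m1 geg_1[OF n_ge_2]
    by (intro sum.cong refl, drule CollectD, elim conjE, drule e) simp
qed

end

section \<open>Nonnegative linearization of products\<close>

lemma geg_down_mono: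
  assumes "n \<ge> 2" "i \<le> j"
  shows "geg_down n i \<le> geg_down n j"
proof (cases "i = 0")
  case True
  then show ?thesis using assms by (simp add: geg_down_def)
next
  case False
  then have "2 * real i + real n - 2 > 0" "2 * real j + real n - 2 > 0" using assms by auto
  moreover have "real i * (real n - 2) \<le> real j * (real n - 2)"
    using assms by (intro mult_right_mono) auto
  ultimately show ?thesis by (simp add: geg_down_def field_simps)
qed

lemma geg_down_le_half:
  assumes "n \<ge> 2"
  shows "geg_down n i \<le> 1 / 2"
proof (cases "i = 0")
  case False
  then have "2 * real i + real n - 2 > 0" using assms by auto
  then show ?thesis using assms by (simp add: geg_down_def field_simps)
qed (simp add: geg_down_def)

lemma geg_up_eq: "geg_up n m = 1 - geg_down n m" by (simp add: geg_up_def geg_down_def)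

context sphere_dimension begin

text \<open>
  The factors \<open>P\<^sub>a\<close> and \<open>P\<^sub>b\<close> are taken in the normalization dual to \<open>P\<^sub>m(1) = 1\<close>. In this
  normalization the recurrence becomes a discrete wave equation in \<open>(a,b)\<close>, and the value at a
  point enters the equations at its two neighbours in either direction with the coefficients
  \<open>geg_down\<close> and \<open>geg_up\<close> of one index. These sum to one, so the equation is a conservation
  law.
\<close>
definition lin_coeff :: "nat \<Rightarrow> nat \<Rightarrow> nat \<Rightarrow> real" where
  "lin_coeff l a b = harm_dim a * harm_dim b * mean (P a * P b * P l)"

lemma geg_down_harm_dim: "a \<ge> 1 \<Longrightarrow> geg_down n a * harm_dim a = geg_up n (a - 1) * harm_dim (a - 1)"
  using harm_dim_step[of "a - 1"] by simp

text \<open>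
  Multiplication by \<open>t\<close> can be applied to \<open>P\<^sub>a\<close> or to \<open>P\<^sub>m\<close>.
\<close>
lemma lin_coeff_step:
  assumes "a \<ge> 1"
  shows "geg_down n (Suc m) * lin_coeff l a (Suc m) + (if m = 0 then 0 else geg_up n (m - 1) * lin_coeff l a (m - 1))
    = geg_down n (Suc a) * lin_coeff l (Suc a) m + geg_up n (a - 1) * lin_coeff l (a - 1) m"
proof -
  define W where "W a b = mean (P a * P b * P l)" for a b
  have "geg_up n a * W (Suc a) m + geg_down n a * W (a - 1) m = mean (P a * ([:0, 1:] * (P m * P l)))"
    using mean_recurrence[of a "P m * P l"] by (simp only: W_def mult.assoc)
  also have "\<dots> = mean (P m * ([:0, 1:] * (P a * P l)))" by (simp only: mult_ac)
  also have "\<dots> = geg_up n m * W a (Suc m) + geg_down n m * W a (m - 1)"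
    using mean_recurrence[of m "P a * P l"] by (simp only: W_def mult_ac)
  finally have eq: "geg_up n a * W (Suc a) m + geg_down n a * W (a - 1) m = geg_up n m * W a (Suc m) + geg_down n m * W a (m - 1)" .
  have "geg_down n (Suc m) * lin_coeff l a (Suc m) = (geg_down n (Suc m) * harm_dim (Suc m)) * harm_dim a * W a (Suc m)"
    by (simp add: lin_coeff_def W_def)
  also have "\<dots> = harm_dim a * harm_dim m * (geg_up n m * W a (Suc m))" by (simp add: harm_dim_step)
  finally have 1: "geg_down n (Suc m) * lin_coeff l a (Suc m) = harm_dim a * harm_dim m * (geg_up n m * W a (Suc m))" .
  have 2: "(if m = 0 then 0 else geg_up n (m - 1) * lin_coeff l a (m - 1)) = harm_dim a * harm_dim m * (geg_down n m * W a (m - 1))"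
  proof (cases "m = 0")
    case False
    have "harm_dim a * harm_dim m * (geg_down n m * W a (m - 1)) = (geg_down n m * harm_dim m) * harm_dim a * W a (m - 1)" by simp
    also have "\<dots> = geg_up n (m - 1) * lin_coeff l a (m - 1)" using False by (simp add: geg_down_harm_dim lin_coeff_def W_def)
    finally show ?thesis using False by simp
  qed (simp add: geg_down_def)
  have "geg_down n (Suc a) * lin_coeff l (Suc a) m = (geg_down n (Suc a) * harm_dim (Suc a)) * harm_dim m * W (Suc a) m"
    by (simp add: lin_coeff_def W_def)
  also have "\<dots> = harm_dim a * harm_dim m * (geg_up n a * W (Suc a) m)" by (simp add: harm_dim_step)
  finally have 3: "geg_down n (Suc a) * lin_coeff l (Suc a) m = harm_dim a * harm_dim m * (geg_up n a * W (Suc a) m)" .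
  have "harm_dim a * harm_dim m * (geg_down n a * W (a - 1) m) = (geg_down n a * harm_dim a) * harm_dim m * W (a - 1) m" by simp
  also have "\<dots> = geg_up n (a - 1) * lin_coeff l (a - 1) m" using assms by (simp add: geg_down_harm_dim lin_coeff_def W_def)
  finally have 4: "geg_up n (a - 1) * lin_coeff l (a - 1) m = harm_dim a * harm_dim m * (geg_down n a * W (a - 1) m)" by simp
  show ?thesis unfolding 1 2 3 4 distrib_left[symmetric] eq ..
qed

text \<open>
  The flux through the right edge of a backward light cone, on which the two indices have the
  constant sum \<open>s\<close>.
\<close>
definition flux_right :: "nat \<Rightarrow> nat \<Rightarrow> nat \<Rightarrow> real" where
  "flux_right l s m = (\<Sum>i\<le>m. (geg_down n (s - i) - geg_down n i) * lin_coeff l (s - i) i)"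

text \<open>
  The flux through the left edge, on which the two indices have the constant difference \<open>d\<close>.
\<close>
definition flux_left :: "nat \<Rightarrow> nat \<Rightarrow> nat \<Rightarrow> real" where
  "flux_left l d m = (\<Sum>i\<le>m. (geg_up n (d + i) - geg_down n i) * lin_coeff l (d + i) i)"

text \<open>
  Summing the wave equation over the backward light cone of \<open>(a, m + 1)\<close> leaves only boundary
  terms. The induction compares the cones of \<open>(a + 1, m)\<close>, \<open>(a - 1, m)\<close> and \<open>(a, m - 1)\<close>.
\<close>
lemma lin_coeff_flux:
  "a \<ge> Suc m \<Longrightarrow> geg_down n (Suc m) * lin_coeff l a (Suc m) = flux_right l (a + m + 1) m + flux_left l (a - m - 1) m"
proof (induction m arbitrary: a rule: less_induct)
  case (less m)
  show ?case
  proof (cases m)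
    case 0
    then show ?thesis using lin_coeff_step[of a 0 l] less.prems
      by (simp add: flux_right_def flux_left_def geg_down_def[of n 0])
  next
    case (Suc m')
    have R: "flux_right l (a + m + 1) m = flux_right l (a + m + 1) m' + (geg_down n (a + 1) - geg_down n m) * lin_coeff l (a + 1) m"
      by (simp add: flux_right_def Suc)
    have L: "flux_left l (a - m - 1) m = flux_left l (a - m - 1) m' + (geg_up n (a - 1) - geg_down n m) * lin_coeff l (a - 1) m"
      using less.prems by (simp add: flux_left_def Suc)
    have IH1: "geg_down n m * lin_coeff l (a + 1) m = flux_right l (a + m + 1) m' + flux_left l (a - m') m'"
      using less.IH[of m' "a + 1"] less.prems by (simp add: Suc)
    have IH2: "geg_down n m * lin_coeff l (a - 1) m = flux_right l (a + m') m' + flux_left l (a - m - 1) m'"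
      using less.IH[of m' "a - 1"] less.prems by (simp add: Suc)
    have mid: "flux_right l (a + m') m' + flux_left l (a - m') m' = geg_up n m' * lin_coeff l a m'"
    proof (cases m')
      case 0
      then show ?thesis by (simp add: flux_right_def flux_left_def geg_up_eq geg_down_def[of n 0] algebra_simps)
    next
      case (Suc m'')
      have R': "flux_right l (a + m') m' = flux_right l (a + m') m'' + (geg_down n a - geg_down n m') * lin_coeff l a m'"
        by (simp add: flux_right_def Suc)
      have L': "flux_left l (a - m') m' = flux_left l (a - m') m'' + (geg_up n a - geg_down n m') * lin_coeff l a m'"
        using less.prems \<open>m = Suc m'\<close> by (simp add: flux_left_def Suc)
      have IH3: "geg_down n m' * lin_coeff l a m' = flux_right l (a + m') m'' + flux_left l (a - m') m''"
        using less.IH[of m'' a] less.prems \<open>m = Suc m'\<close> by (simp add: Suc)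
      show ?thesis unfolding R' L' using IH3 by (simp add: geg_up_eq algebra_simps)
    qed
    have "geg_down n (Suc m) * lin_coeff l a (Suc m) + geg_up n m' * lin_coeff l a m'
        = geg_down n (Suc a) * lin_coeff l (Suc a) m + geg_up n (a - 1) * lin_coeff l (a - 1) m"
      using lin_coeff_step[of a m l] less.prems by (simp add: Suc)
    then show ?thesis unfolding R L using IH1 IH2 mid by (simp add: algebra_simps)
  qed
qed

text \<open>
  All coefficients of the boundary terms are nonnegative: on the right edge because \<open>geg_down\<close>
  is increasing, on the left edge because \<open>geg_down \<le> 1/2 \<le> geg_up\<close>. The edges stay in the
  region where the first index is at least the second one.
\<close>
lemma lin_coeff_nonneg_le: "b \<le> a \<Longrightarrow> lin_coeff l a b \<ge> 0"
proof (induction b arbitrary: a rule: less_induct)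
  case (less b)
  show ?case
  proof (cases b)
    case 0
    then show ?thesis using harm_dim_pos[of a] by (auto simp: lin_coeff_def mean_PP less_imp_le[OF harm_dim_pos])
  next
    case (Suc m)
    have a: "a \<ge> Suc m" using less.prems Suc by simp
    have "flux_right l (a + m + 1) m \<ge> 0"
      unfolding flux_right_def using a Suc
      by (intro sum_nonneg mult_nonneg_nonneg less.IH) (auto intro: geg_down_mono[OF n_ge_2])
    moreover have "flux_left l (a - m - 1) m \<ge> 0"
      unfolding flux_left_def
    proof (intro sum_nonneg mult_nonneg_nonneg less.IH)
      fix i assume "i \<in> {..m}"
      show "0 \<le> geg_up n (a - m - 1 + i) - geg_down n i"
        using geg_down_le_half[OF n_ge_2, of i] geg_down_le_half[OF n_ge_2, of "a - m - 1 + i"] by (simp add: geg_up_eq)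
    qed (use a Suc in auto)
    ultimately have "geg_down n (Suc m) * lin_coeff l a (Suc m) \<ge> 0" unfolding lin_coeff_flux[OF a] by simp
    then show ?thesis using geg_down_pos[OF n_ge_2, of "Suc m"] Suc by (simp add: zero_le_mult_iff)
  qed
qed

lemma linearization_nonneg: "mean (P a * P b * P l) \<ge> 0"
proof -
  have "mean (P a * P b * P l) \<ge> 0" if "b \<le> a" for a b
    using lin_coeff_nonneg_le[OF that, of l] mult_pos_pos[OF harm_dim_pos[of a] harm_dim_pos[of b]]
    by (simp add: lin_coeff_def zero_le_mult_iff del: zero_less_mult_iff)
  from this[of b a] this[of a b] show ?thesis by (cases "b \<le> a") (auto simp: mult.commute)
qed

text \<open>
  The cone of the polynomials with nonnegative Gegenbauer coefficients.
\<close>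
definition geg_positive :: "real poly \<Rightarrow> bool" where
  "geg_positive p \<longleftrightarrow> (\<forall>l. mean (p * P l) \<ge> 0)"

lemma geg_positive_P: "geg_positive (P m)"
  by (auto simp: geg_positive_def mean_PP less_imp_le[OF harm_dim_pos])

lemma geg_positive_sum:
  assumes "\<And>i. i \<in> A \<Longrightarrow> c i \<ge> 0" "\<And>i. i \<in> A \<Longrightarrow> geg_positive (f i)"
  shows "geg_positive (\<Sum>i\<in>A. smult (c i) (f i))"
  using assms unfolding geg_positive_def sum_distrib_right mean_sum mult_smult_left mean_smult
  by (auto intro!: sum_nonneg)

lemma geg_positive_mult:
  assumes "geg_positive p" "geg_positive q"
  shows "geg_positive (p * q)"
proof -
  have "p * q = (\<Sum>a\<le>degree p. smult (mean (p * P a) * harm_dim a) (P a)) * (\<Sum>b\<le>degree q. smult (mean (q * P b) * harm_dim b) (P b))"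
    using expansion_coeffs[of p "degree p"] expansion_coeffs[of q "degree q"] by simp
  also have "\<dots> = (\<Sum>a\<le>degree p. smult (mean (p * P a) * harm_dim a) (\<Sum>b\<le>degree q. smult (mean (q * P b) * harm_dim b) (P a * P b)))"
    by (simp only: sum_product mult_smult_left mult_smult_right smult_smult smult_sum_right mult.commute)
  finally show ?thesis using assms linearization_nonneg
    by (simp only:) (intro geg_positive_sum mult_nonneg_nonneg less_imp_le[OF harm_dim_pos],
       auto simp: geg_positive_def)
qed

end

section \<open>Positive definiteness on the sphere\<close>

text \<open>
  For a unit vector \<open>y\<close> let \<open>Z\<^sub>y(x) = |x|\<^sup>d P\<^sub>d(\<langle>x,y\<rangle>/|x|)\<close> be the zonal harmonic of degree \<open>d\<close>
  with pole \<open>y\<close>. In the Fischer inner product, for which multiplication by \<open>x\<^sub>i\<close> and \<open>\<partial>/\<partial>x\<^sub>i\<close>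
  are adjoint, pairing with \<open>\<langle>x,y\<rangle>\<^sup>d / d!\<close> is evaluation at \<open>y\<close>. Since \<open>Z\<^sub>y\<close> is a positive
  multiple of \<open>\<langle>x,y\<rangle>\<^sup>d / d!\<close> plus a multiple of \<open>|x|\<^sup>2\<close>, and the latter is orthogonal to the
  harmonic polynomial \<open>Z\<^sub>x\<close>, the number \<open>P\<^sub>d(\<langle>x,y\<rangle>)\<close> is up to a positive factor the Gram matrix
  entry of \<open>Z\<^sub>x\<close> and \<open>Z\<^sub>y\<close>.

  Polynomials in the coordinates are represented by their coefficient functions on
  multi-indices. Formal power series are admitted, so that the exponential of \<open>\<langle>x,y\<rangle>\<close>
  represents all the functions \<open>\<langle>x,y\<rangle>\<^sup>d / d!\<close> at once; the inner product selects the degree.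
\<close>
type_synonym 'n series = "('n \<Rightarrow> nat) \<Rightarrow> real"

definition degree_set :: "nat \<Rightarrow> ('n::finite \<Rightarrow> nat) set" where
  "degree_set d = {a. (\<Sum>i\<in>UNIV. a i) = d}"

definition mul_var :: "'n \<Rightarrow> 'n series \<Rightarrow> 'n series" where
  "mul_var i c a = (if a i = 0 then 0 else c (a(i := a i - 1)))"

definition partial :: "'n \<Rightarrow> 'n series \<Rightarrow> 'n series" where
  "partial i c a = real (Suc (a i)) * c (a(i := Suc (a i)))"

definition fischer :: "nat \<Rightarrow> 'n::finite series \<Rightarrow> 'n series \<Rightarrow> real" where
  "fischer d c e = (\<Sum>a\<in>degree_set d. (\<Prod>i\<in>UNIV. fact (a i)) * c a * e a)"

definition mul_linear :: "real ^ 'n::finite \<Rightarrow> 'n series \<Rightarrow> 'n series" where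
  "mul_linear y c a = (\<Sum>i\<in>UNIV. y $ i * mul_var i c a)"

definition mul_norm2 :: "'n::finite series \<Rightarrow> 'n series" where
  "mul_norm2 c a = (\<Sum>i\<in>UNIV. mul_var i (mul_var i c) a)"

definition directional :: "real ^ 'n::finite \<Rightarrow> 'n series \<Rightarrow> 'n series" where
  "directional y c a = (\<Sum>i\<in>UNIV. y $ i * partial i c a)"

definition laplacian :: "'n::finite series \<Rightarrow> 'n series" where
  "laplacian c a = (\<Sum>i\<in>UNIV. partial i (partial i c) a)"

definition exp_series :: "real ^ 'n::finite \<Rightarrow> 'n series" where
  "exp_series y a = (\<Prod>i\<in>UNIV. (y $ i) ^ a i / fact (a i))"

lemma finite_degree_set [simp]: "finite (degree_set d :: ('n::finite \<Rightarrow> nat) set)"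
proof (rule finite_subset)
  show "degree_set d \<subseteq> (\<Pi>\<^sub>E i\<in>(UNIV :: 'n set). {..d})"
    unfolding degree_set_def by (auto simp: PiE_def intro!: member_le_sum)
  show "finite (\<Pi>\<^sub>E i\<in>(UNIV :: 'n set). {..d})" by (intro finite_PiE) auto
qed

lemma sum_upd: "(\<Sum>j\<in>UNIV. (a(i := Suc (a i))) j) = Suc (\<Sum>j\<in>UNIV. a (j :: 'n::finite))"
  by (simp add: sum.remove[of UNIV i])

lemma fischer_sym: "fischer d c e = fischer d e c"
  by (simp add: fischer_def mult_ac)

lemma fischer_sum_left:
  "fischer d (\<lambda>a. \<Sum>i\<in>A. f i * g i a) e = (\<Sum>i\<in>A. f i * fischer d (g i) e)"
  unfolding fischer_def by (simp add: sum_distrib_left sum_distrib_right sum.swap[of _ A] mult_ac)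

lemma fischer_sum_left': "fischer d (\<lambda>a. \<Sum>i\<in>A. g i a) e = (\<Sum>i\<in>A. fischer d (g i) e)"
  using fischer_sum_left[where f = "\<lambda>_. 1"] by simp

lemma fischer_lincomb:
  "fischer d (\<lambda>a. u * c a + v * c' a) e = u * fischer d c e + v * fischer d c' e"
  unfolding fischer_def by (simp add: sum_distrib_left sum.distrib[symmetric] algebra_simps)

text \<open>
  The factor that differentiation produces is the quotient of the two multi-index factorials.
\<close>
lemma fischer_adjoint:
  fixes c e :: "'n::finite series"
  shows "fischer (Suc d) (mul_var i c) e = fischer d c (partial i e)"
proof -
  let ?f = "\<lambda>a :: 'n \<Rightarrow> nat. (\<Prod>j\<in>UNIV. fact (a j) :: real)"
  have "fischer (Suc d) (mul_var i c) e
      = (\<Sum>a\<in>{a\<in>degree_set (Suc d). a i \<noteq> 0}. ?f a * mul_var i c a * e a)"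
    unfolding fischer_def by (rule sum.mono_neutral_right) (auto simp: mul_var_def)
  also have "\<dots> = (\<Sum>a\<in>degree_set d. ?f a * c a * partial i e a)"
  proof (rule sum.reindex_bij_witness[of _ "\<lambda>a. a(i := Suc (a i))" "\<lambda>a. a(i := a i - 1)"])
    fix a :: "'n \<Rightarrow> nat" assume a: "a \<in> {a\<in>degree_set (Suc d). a i \<noteq> 0}"
    define b where "b = a(i := a i - 1)"
    have ab: "a = b(i := Suc (b i))" using a by (auto simp: b_def fun_eq_iff)
    show "(a(i := a i - 1))(i := Suc ((a(i := a i - 1)) i)) = a" using a by (auto simp: fun_eq_iff)
    show "a(i := a i - 1) \<in> degree_set d"
      using a sum_upd[of b i] unfolding ab[symmetric] by (simp add: b_def degree_set_def)
    have "?f a = real (Suc (b i)) * ?f b"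
      by (simp add: ab prod.remove[of UNIV i] algebra_simps)
    then show "?f (a(i := a i - 1)) * c (a(i := a i - 1)) * partial i e (a(i := a i - 1))
        = ?f a * mul_var i c a * e a"
      using a ab unfolding b_def[symmetric] by (simp add: partial_def mul_var_def b_def[symmetric])
  next
    fix b :: "'n \<Rightarrow> nat" assume b: "b \<in> degree_set d"
    show "b(i := Suc (b i)) \<in> {a\<in>degree_set (Suc d). a i \<noteq> 0}"
      using b by (simp add: degree_set_def sum_upd del: fun_upd_apply) simp
  qed auto
  finally show ?thesis unfolding fischer_def .
qed

lemma fischer_0: "fischer 0 (mul_var i c) e = 0"
  unfolding fischer_def by (rule sum.neutral) (auto simp: degree_set_def mul_var_def)

lemma partial_mul_var:
  "partial i (mul_var j c) = (\<lambda>a. mul_var j (partial i c) a + (if i = j then c a else 0))"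
proof
  fix a
  show "partial i (mul_var j c) a = mul_var j (partial i c) a + (if i = j then c a else 0)"
    by (cases "i = j") (auto simp: partial_def mul_var_def fun_upd_twist algebra_simps of_nat_diff)
qed

lemma mul_var_0: "mul_var i (\<lambda>_. 0) = (\<lambda>_. 0)"
  by (rule ext) (simp add: mul_var_def)

lemma mul_var_commute: "mul_var i (mul_var j c) = mul_var j (mul_var i c)"
  by (rule ext) (auto simp: mul_var_def fun_upd_twist)

lemma partial_sum: "partial j (\<lambda>a. \<Sum>i\<in>A. f i * g i a) = (\<lambda>a. \<Sum>i\<in>A. f i * partial j (g i) a)"
  by (rule ext) (simp add: partial_def sum_distrib_left mult_ac)

lemma mul_var_sum: "mul_var j (\<lambda>a. \<Sum>i\<in>A. f i * g i a) = (\<lambda>a. \<Sum>i\<in>A. f i * mul_var j (g i) a)"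
  by (rule ext) (simp add: mul_var_def)

lemma partial_lincomb: "partial j (\<lambda>a. u * c a + v * e a) = (\<lambda>a. u * partial j c a + v * partial j e a)"
  by (rule ext) (simp add: partial_def algebra_simps)

lemma partial_scale: "partial j (\<lambda>a. u * c a) = (\<lambda>a. u * partial j c a)"
  by (rule ext) (simp add: partial_def)

lemma mul_var_lincomb: "mul_var j (\<lambda>a. u * c a + v * e a) = (\<lambda>a. u * mul_var j c a + v * mul_var j e a)"
  by (rule ext) (simp add: mul_var_def)

lemma mul_linear_sum: "mul_linear y (\<lambda>a. \<Sum>j\<in>A. f j * g j a) a = (\<Sum>j\<in>A. f j * mul_linear y (g j) a)"
  by (simp add: mul_linear_def mul_var_sum sum_distrib_left sum.swap[of _ A] mult_ac)

lemma mul_norm2_sum: "mul_norm2 (\<lambda>a. \<Sum>j\<in>A. f j * g j a) a = (\<Sum>j\<in>A. f j * mul_norm2 (g j) a)"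
  by (simp add: mul_norm2_def mul_var_sum sum_distrib_left sum.swap[of _ A] mult_ac)

lemma mul_linear_lincomb:
  "mul_linear y (\<lambda>a. u * c a + v * e a) a = u * mul_linear y c a + v * mul_linear y e a"
  by (simp add: mul_linear_def mul_var_lincomb sum_distrib_left sum.distrib[symmetric] algebra_simps)

lemma mul_norm2_lincomb:
  "mul_norm2 (\<lambda>a. u * c a + v * e a) a = u * mul_norm2 c a + v * mul_norm2 e a"
  by (simp add: mul_norm2_def mul_var_lincomb sum_distrib_left sum.distrib)

lemma mul_linear_norm2: "mul_linear y (mul_norm2 c) = mul_norm2 (mul_linear y c)"
proof
  fix a
  have "mul_linear y (mul_norm2 c) a = mul_linear y (\<lambda>a. \<Sum>i\<in>UNIV. 1 * mul_var i (mul_var i c) a) a"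
    by (simp add: mul_norm2_def[abs_def])
  also have "\<dots> = (\<Sum>i\<in>UNIV. \<Sum>j\<in>UNIV. y $ j * mul_var j (mul_var i (mul_var i c)) a)"
    unfolding mul_linear_sum by (simp add: mul_linear_def)
  also have "\<dots> = (\<Sum>j\<in>UNIV. \<Sum>i\<in>UNIV. y $ j * mul_var i (mul_var i (mul_var j c)) a)"
    by (subst sum.swap) (simp add: mul_var_commute[of _ _ c] mul_var_commute[of _ _ "mul_var _ c"])
  also have "\<dots> = mul_norm2 (\<lambda>a. \<Sum>j\<in>UNIV. y $ j * mul_var j c a) a"
    unfolding mul_norm2_sum by (simp add: mul_norm2_def sum_distrib_left)
  also have "\<dots> = mul_norm2 (mul_linear y c) a" by (simp add: mul_linear_def[abs_def])
  finally show "mul_linear y (mul_norm2 c) a = mul_norm2 (mul_linear y c) a" .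
qed

lemma partial_mul_linear:
  "partial j (mul_linear y c) = (\<lambda>a. 1 * mul_linear y (partial j c) a + y $ j * c a)"
proof
  fix a
  have "partial j (mul_linear y c) a = (\<Sum>i\<in>UNIV. y $ i * partial j (mul_var i c) a)"
    unfolding mul_linear_def[abs_def] partial_sum ..
  also have "\<dots> = mul_linear y (partial j c) a + y $ j * c a"
    by (simp add: partial_mul_var mul_linear_def distrib_left sum.distrib if_distrib[of "\<lambda>z. _ * z"] cong: if_cong)
  finally show "partial j (mul_linear y c) a = 1 * mul_linear y (partial j c) a + y $ j * c a" by simp
qed

lemma partial_mul_norm2:
  "partial j (mul_norm2 c) = (\<lambda>a. 1 * mul_norm2 (partial j c) a + 2 * mul_var j c a)"
proof
  fix a
  have *: "partial j (mul_var i (mul_var i c)) a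
      = mul_var i (mul_var i (partial j c)) a + (if j = i then 2 * mul_var j c a else 0)" for i
    unfolding partial_mul_var using mul_var_lincomb[of i 1 "mul_var i (partial j c)" 1 "\<lambda>a. if j = i then c a else 0"]
    by (auto simp: mul_var_def)
  have "partial j (mul_norm2 c) a = partial j (\<lambda>a. \<Sum>i\<in>UNIV. 1 * mul_var i (mul_var i c) a) a"
    by (simp add: mul_norm2_def[abs_def])
  also have "\<dots> = (\<Sum>i\<in>UNIV. partial j (mul_var i (mul_var i c)) a)"
    unfolding partial_sum by simp
  also have "\<dots> = mul_norm2 (partial j c) a + 2 * mul_var j c a"
    unfolding * by (simp add: sum.distrib mul_norm2_def)
  finally show "partial j (mul_norm2 c) a = 1 * mul_norm2 (partial j c) a + 2 * mul_var j c a" by simp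
qed

lemma directional_mul_linear:
  "directional y (mul_linear y c) a = mul_linear y (directional y c) a + (y \<bullet> y) * c a"
  unfolding directional_def partial_mul_linear
  by (simp add: distrib_left sum.distrib directional_def[abs_def] mul_linear_sum
      inner_vec_def sum_distrib_left mult_ac)

lemma directional_mul_norm2:
  "directional y (mul_norm2 c) a = mul_norm2 (directional y c) a + 2 * mul_linear y c a"
  unfolding directional_def partial_mul_norm2
  by (simp add: distrib_left sum.distrib directional_def[abs_def] mul_norm2_sum
      mul_linear_def sum_distrib_left mult_ac)

lemma laplacian_mul_linear:
  "laplacian (mul_linear y c) a = mul_linear y (laplacian c) a + 2 * directional y c a"
proof -
  have "laplacian (mul_linear y c) a
      = (\<Sum>j\<in>UNIV. mul_linear y (partial j (partial j c)) a + 2 * (y $ j * partial j c a))"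
    unfolding laplacian_def partial_mul_linear partial_lincomb
    by (simp add: partial_mul_linear algebra_simps)
  also have "\<dots> = mul_linear y (\<lambda>a. \<Sum>j\<in>UNIV. 1 * partial j (partial j c) a) a + 2 * directional y c a"
    unfolding mul_linear_sum by (simp add: sum.distrib sum_distrib_left directional_def)
  finally show ?thesis by (simp add: laplacian_def[abs_def])
qed

lemma euler_identity: "(\<Sum>j\<in>UNIV. mul_var j (partial j c) a) = real (\<Sum>j\<in>UNIV. a j) * c a"
proof -
  have "mul_var j (partial j c) a = real (a j) * c a" for j
    by (auto simp: mul_var_def partial_def)
  then show ?thesis by (simp add: sum_distrib_right)
qed

text \<open>
  The commutator of the Laplacian with \<open>|x|\<^sup>2\<close> is \<open>4 E + 2 n\<close>, where the Euler operator \<open>E\<close>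
  multiplies the coefficient at \<open>a\<close> by the degree of \<open>a\<close>.
\<close>
lemma laplacian_mul_norm2:
  fixes c :: "'n::finite series"
  shows "laplacian (mul_norm2 c) a = mul_norm2 (laplacian c) a
    + (4 * real (\<Sum>j\<in>UNIV. a j) + 2 * real CARD('n)) * c a"
proof -
  have "laplacian (mul_norm2 c) a
      = (\<Sum>j\<in>UNIV. mul_norm2 (partial j (partial j c)) a + 4 * mul_var j (partial j c) a + 2 * c a)"
    unfolding laplacian_def partial_mul_norm2 partial_lincomb
    by (simp add: partial_mul_norm2 partial_mul_var algebra_simps)
  also have "\<dots> = mul_norm2 (\<lambda>a. \<Sum>j\<in>UNIV. 1 * partial j (partial j c) a) a
      + 4 * (\<Sum>j\<in>UNIV. mul_var j (partial j c) a) + 2 * real CARD('n) * c a"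
    unfolding mul_norm2_sum by (simp add: sum.distrib sum_distrib_left)
  finally show ?thesis by (simp add: laplacian_def[abs_def] euler_identity algebra_simps)
qed

lemma partial_exp_series: "partial i (exp_series y) = (\<lambda>a. y $ i * exp_series y a)"
proof
  fix a
  define c where "c = (\<Prod>j\<in>UNIV - {i}. (y $ j) ^ a j / fact (a j))"
  have "exp_series y a = (y $ i) ^ a i / fact (a i) * c"
    by (simp add: exp_series_def c_def prod.remove[of UNIV i])
  moreover have "exp_series y (a(i := Suc (a i))) = (y $ i) ^ Suc (a i) / fact (Suc (a i)) * c"
    by (simp add: exp_series_def c_def prod.remove[of UNIV i])
  moreover have "real (Suc (a i)) * ((y $ i) ^ Suc (a i) / fact (Suc (a i))) = y $ i * ((y $ i) ^ a i / fact (a i))"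
    by (simp add: fact_Suc del: of_nat_Suc)
  ultimately show "partial i (exp_series y) a = y $ i * exp_series y a"
    by (simp only: partial_def mult.assoc[symmetric])
qed

lemma mul_linear_exp_series:
  "mul_linear y (exp_series y) a = real (\<Sum>j\<in>UNIV. a j) * exp_series y a"
  unfolding euler_identity[symmetric] mul_linear_def partial_exp_series
  by (intro sum.cong) (auto simp: mul_var_def)

lemma eval_mul_linear:
  "fischer (Suc d) (mul_linear x c) (exp_series y) = (x \<bullet> y) * fischer d c (exp_series y)"
proof -
  have *: "fischer d c (\<lambda>a. u * exp_series y a) = u * fischer d c (exp_series y)" for u
    by (simp add: fischer_def sum_distrib_left mult_ac)
  show ?thesis unfolding mul_linear_def[abs_def] fischer_sum_left fischer_adjoint partial_exp_series *
    by (simp add: inner_vec_def sum_distrib_left mult_ac)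
qed

lemma eval_mul_norm2:
  "fischer (Suc (Suc d)) (mul_norm2 c) (exp_series y) = (y \<bullet> y) * fischer d c (exp_series y)"
proof -
  have *: "fischer d c (\<lambda>a. u * exp_series y a) = u * fischer d c (exp_series y)" for u d c
    by (simp add: fischer_def sum_distrib_left mult_ac)
  have p: "partial i (\<lambda>a. u * exp_series y a) = (\<lambda>a. u * (y $ i * exp_series y a))" for i u
    by (simp only: partial_scale partial_exp_series)
  show ?thesis unfolding mul_norm2_def[abs_def] fischer_sum_left' fischer_adjoint partial_exp_series p *
    by (simp add: * inner_vec_def sum_distrib_left mult_ac)
qed

lemma fischer_mul_norm2_harmonic:
  assumes "laplacian e = (\<lambda>_. 0)"
  shows "fischer d (mul_norm2 c) e = 0"
proof -
  have m: "mul_norm2 c = (\<lambda>a. \<Sum>i\<in>UNIV. mul_var i (mul_var i c) a)" by (simp add: mul_norm2_def[abs_def])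
  consider "d = 0" | "d = 1" | d' where "d = Suc (Suc d')"
    by (metis One_nat_def not0_implies_Suc)
  then show ?thesis
  proof cases
    case 3
    have "fischer d (mul_norm2 c) e = (\<Sum>i\<in>UNIV. fischer d' c (partial i (partial i e)))"
      unfolding m 3 by (simp only: fischer_sum_left' fischer_adjoint)
    also have "\<dots> = fischer d' c (laplacian e)"
      unfolding fischer_sym[of d' c] laplacian_def[abs_def] fischer_sum_left' ..
    finally show ?thesis unfolding assms by (simp add: fischer_def)
  qed (unfold m, simp_all only: fischer_sum_left' fischer_0 fischer_adjoint One_nat_def sum.neutral_const mult_zero_right)
qed

text \<open>
  The Gegenbauer recurrence in homogeneous form, for a pole \<open>y\<close> of norm one.
\<close>
fun zonal :: "real ^ 'n::finite \<Rightarrow> nat \<Rightarrow> 'n series" where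
  "zonal y 0 = (\<lambda>a. if a = (\<lambda>_. 0) then 1 else 0)"
| "zonal y (Suc 0) = mul_linear y (zonal y 0)"
| "zonal y (Suc (Suc d)) = (\<lambda>a.
     (2 * real (Suc d) + real CARD('n) - 2) / (real (Suc d) + real CARD('n) - 2)
       * mul_linear y (zonal y (Suc d)) a
     + (- real (Suc d) / (real (Suc d) + real CARD('n) - 2)) * mul_norm2 (zonal y d) a)"

lemma eval_zonal:
  fixes x y :: "real ^ 'n::finite"
  assumes "norm x = 1" "norm y = 1"
  shows "fischer d (zonal x d) (exp_series y) = gegenbauer CARD('n) d (x \<bullet> y)"
proof (induction d rule: induct_nat_012)
  case 0
  have "degree_set 0 = {\<lambda>_ :: 'n. 0 :: nat}" by (auto simp: degree_set_def)
  then show ?case by (simp add: fischer_def exp_series_def)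
next
  case 1
  have "degree_set 0 = {\<lambda>_ :: 'n. 0 :: nat}" by (auto simp: degree_set_def)
  then have "fischer 0 (zonal x 0) (exp_series y) = 1" by (simp add: fischer_def exp_series_def)
  then show ?case by (simp add: eval_mul_linear del: zonal.simps(1))
next
  case (ge2 d)
  have y: "y \<bullet> y = 1" using assms by (simp add: norm_eq_1)
  have alg: "u / q * (s * g) + - k / q * (1 * g') = (u * s * g - k * g') / q" for u q s g k g' :: real
    by (simp add: diff_divide_distrib)
  show ?case
    unfolding zonal.simps fischer_lincomb eval_mul_linear eval_mul_norm2 ge2 y
    by (simp only: alg gegenbauer.simps)
qed

lemma mul_var_support:
  assumes "\<And>a. c a \<noteq> 0 \<Longrightarrow> a \<in> degree_set d" "mul_var i c a \<noteq> 0"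
  shows "a \<in> degree_set (Suc d)"
proof -
  have i: "a i \<noteq> 0" "c (a(i := a i - 1)) \<noteq> 0" using assms(2) by (auto simp: mul_var_def split: if_splits)
  then have "a(i := a i - 1) \<in> degree_set d" using assms(1) by blast
  moreover have "a = (a(i := a i - 1))(i := Suc ((a(i := a i - 1)) i))" using i by auto
  ultimately show ?thesis using sum_upd[of "a(i := a i - 1)" i]
    by (simp add: degree_set_def)
qed

lemma mul_linear_nonzero: "mul_linear y c a \<noteq> 0 \<Longrightarrow> \<exists>i. mul_var i c a \<noteq> 0"
  by (rule ccontr) (simp add: mul_linear_def)

lemma mul_norm2_nonzero: "mul_norm2 c a \<noteq> 0 \<Longrightarrow> \<exists>i. mul_var i (mul_var i c) a \<noteq> 0"
  by (rule ccontr) (simp add: mul_norm2_def)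

text \<open>
  Homogeneity of degree \<open>d\<close> is what turns the Euler operator into a scalar in
  \<open>laplacian_mul_norm2\<close>.
\<close>
lemma zonal_support: "zonal y d a \<noteq> 0 \<Longrightarrow> a \<in> degree_set d"
proof (induction d arbitrary: a rule: induct_nat_012)
  case 0 then show ?case by (auto simp: degree_set_def split: if_splits)
next
  case 1
  then obtain i where "mul_var i (zonal y 0) a \<noteq> 0"
    unfolding zonal.simps(2) using mul_linear_nonzero by blast
  moreover have "b \<in> degree_set 0" if "zonal y 0 b \<noteq> 0" for b
    using that by (auto simp: degree_set_def split: if_splits)
  ultimately show ?case using mul_var_support by blast
next
  case (ge2 d)
  from ge2.prems have "mul_linear y (zonal y (Suc d)) a \<noteq> 0 \<or> mul_norm2 (zonal y d) a \<noteq> 0" by auto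
  then show ?case
  proof
    assume "mul_linear y (zonal y (Suc d)) a \<noteq> 0"
    then obtain i where "mul_var i (zonal y (Suc d)) a \<noteq> 0" using mul_linear_nonzero by blast
    then show ?thesis using mul_var_support[of "zonal y (Suc d)" "Suc d" i a] ge2.IH(2) by blast
  next
    assume "mul_norm2 (zonal y d) a \<noteq> 0"
    then obtain i where "mul_var i (mul_var i (zonal y d)) a \<noteq> 0" using mul_norm2_nonzero by blast
    moreover have "b \<in> degree_set (Suc d)" if "mul_var i (zonal y d) b \<noteq> 0" for b
      using that mul_var_support[of "zonal y d" d i b] ge2.IH(1) by blast
    ultimately show ?thesis using mul_var_support[of "mul_var i (zonal y d)" "Suc d" i a] by blast
  qed
qed

lemma directional_lincomb:
  "directional y (\<lambda>a. u * c a + v * e a) a = u * directional y c a + v * directional y e a"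
  by (simp add: directional_def partial_lincomb sum_distrib_left sum.distrib[symmetric] algebra_simps)

lemma laplacian_lincomb:
  "laplacian (\<lambda>a. u * c a + v * e a) a = u * laplacian c a + v * laplacian e a"
  by (simp add: laplacian_def partial_lincomb sum_distrib_left sum.distrib)

lemma mul_linear_scale: "mul_linear y (\<lambda>a. u * c a) a = u * mul_linear y c a"
  using mul_linear_lincomb[of y u c 0 c a] by simp

lemma mul_norm2_scale: "mul_norm2 (\<lambda>a. u * c a) a = u * mul_norm2 c a"
  using mul_norm2_lincomb[of u c 0 c a] by simp

text \<open>
  Harmonicity by itself is not inductive, since the Laplacian of \<open>\<langle>x,y\<rangle> Z\<^sub>y\<close> contains the
  derivative of \<open>Z\<^sub>y\<close> in direction \<open>y\<close>; that derivative is again a zonal harmonic, by the same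
  recurrence.
\<close>
lemma zonal_derivatives:
  fixes y :: "real ^ 'n::finite"
  assumes "norm y = 1" and n: "CARD('n) \<ge> 2"
  shows "directional y (zonal y d) = (\<lambda>a. real d * zonal y (d - 1) a) \<and> laplacian (zonal y d) = (\<lambda>_. 0)"
proof (induction d rule: induct_nat_012)
  case 0
  have "partial i (zonal y 0) = (\<lambda>a. 0)" for i
    by (rule ext) (auto simp: partial_def fun_eq_iff)
  then show ?case unfolding directional_def[abs_def] laplacian_def[abs_def] by (simp add: partial_def del: zonal.simps)
next
  case 1
  have p: "partial i (zonal y 0) = (\<lambda>a. 0)" for i
    by (rule ext) (auto simp: partial_def fun_eq_iff)
  have y: "y \<bullet> y = 1" using assms by (simp add: norm_eq_1)
  have d0: "directional y (zonal y 0) = (\<lambda>a. 0)" "laplacian (zonal y 0) = (\<lambda>a. 0)"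
    unfolding directional_def[abs_def] laplacian_def[abs_def] p by (simp_all add: partial_def)
  show ?case
    by (auto simp only: zonal.simps(2) directional_mul_linear laplacian_mul_linear d0 y fun_eq_iff)
       (auto simp: mul_linear_def mul_var_def)
next
  case (ge2 d)
  define N where "N = real CARD('n)"
  define q where "q = real (Suc d) + N - 2"
  define u where "u = (2 * real (Suc d) + N - 2) / q"
  define v where "v = - real (Suc d) / q"
  have N: "N \<ge> 2" using n by (simp add: N_def)
  then have q: "q > 0" by (simp add: q_def)
  have y: "y \<bullet> y = 1" using assms by (simp add: norm_eq_1)
  have Z: "zonal y (Suc (Suc d)) = (\<lambda>a. u * mul_linear y (zonal y (Suc d)) a + v * mul_norm2 (zonal y d) a)"
    by (simp add: u_def v_def q_def N_def)
  have D1: "directional y (zonal y (Suc d)) = (\<lambda>a. real (Suc d) * zonal y d a)"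
    and L1: "laplacian (zonal y (Suc d)) = (\<lambda>_. 0)"
    and D0: "directional y (zonal y d) = (\<lambda>a. real d * zonal y (d - 1) a)"
    and L0: "laplacian (zonal y d) = (\<lambda>_. 0)" using ge2 by auto
  have dir: "directional y (zonal y (Suc (Suc d))) a = real (Suc (Suc d)) * zonal y (Suc d) a" for a
  proof -
    have "directional y (zonal y (Suc (Suc d))) a =
        u * (real (Suc d) * mul_linear y (zonal y d) a + zonal y (Suc d) a)
        + v * (real d * mul_norm2 (zonal y (d - 1)) a + 2 * mul_linear y (zonal y d) a)"
      unfolding Z directional_lincomb directional_mul_linear directional_mul_norm2 D1 D0 y
        mul_linear_scale mul_norm2_scale by simp
    moreover have "q * (u * (real (Suc d) * mul_linear y (zonal y d) a + zonal y (Suc d) a)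
        + v * (real d * mul_norm2 (zonal y (d - 1)) a + 2 * mul_linear y (zonal y d) a))
      = q * (real (Suc (Suc d)) * zonal y (Suc d) a)"
    proof (cases d)
      case 0
      have "q * u = N" "q * v = -1" "q = N - 1" using q by (simp_all add: u_def v_def q_def 0)
      define z where "z = mul_linear y (zonal y 0) a"
      have "q * (u * (1 * z + z) + v * (0 * b + 2 * z)) = (q * u) * (2 * z) + (q * v) * (2 * z)" for b
        by (simp add: algebra_simps)
      also have "\<dots> = q * (2 * z)"
        by (simp only: \<open>q * u = N\<close> \<open>q * v = -1\<close>) (simp add: \<open>q = N - 1\<close> algebra_simps)
      finally show ?thesis by (simp add: 0 z_def del: zonal.simps(1))
    next
      case (Suc d')
      define A0 where "A0 = zonal y (Suc d) a"
      have qu: "q * u = 2 * real (Suc d) + N - 2" and qv: "q * v = - real (Suc d)"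
        using q by (simp_all add: u_def v_def)
      have q1: "real (Suc d') + N - 2 > 0" using N by simp
      have rec: "(real (Suc d') + N - 2) * zonal y (Suc d) a =
          (2 * real (Suc d') + N - 2) * mul_linear y (zonal y d) a - real (Suc d') * mul_norm2 (zonal y d') a"
      proof -
        have "p * (U / p * A + - W / p * B) = U * A - W * B" if "p > 0" for p U A W B :: real
          using that by (simp add: field_simps)
        from this[OF q1] show ?thesis by (simp only: Suc zonal.simps N_def[symmetric])
      qed
      have "q * (u * (real (Suc d) * mul_linear y (zonal y d) a + zonal y (Suc d) a)
        + v * (real d * mul_norm2 (zonal y (d - 1)) a + 2 * mul_linear y (zonal y d) a))
        = (q * u) * (real (Suc d) * mul_linear y (zonal y d) a + zonal y (Suc d) a)
        + (q * v) * (real d * mul_norm2 (zonal y (d - 1)) a + 2 * mul_linear y (zonal y d) a)"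
        by (simp only: distrib_left mult.assoc)
      also have "\<dots> = (2 * real (Suc d) + N - 2) * zonal y (Suc d) a
          + real (Suc d) * ((2 * real (Suc d') + N - 2) * mul_linear y (zonal y d) a - real (Suc d') * mul_norm2 (zonal y d') a)"
        unfolding qu qv by (simp add: Suc algebra_simps)
      also have "\<dots> = q * (real (Suc (Suc d)) * zonal y (Suc d) a)"
        unfolding rec[symmetric] A0_def[symmetric] by (simp add: q_def Suc algebra_simps)
      finally show ?thesis .
    qed
    ultimately show ?thesis using q by simp
  qed
  have lap: "laplacian (zonal y (Suc (Suc d))) a = 0" for a
  proof -
    have z: "mul_linear y (\<lambda>_. 0) a = 0" "mul_norm2 (\<lambda>_. 0) a = 0"
      by (simp_all add: mul_linear_def mul_norm2_def mul_var_0)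
    have "laplacian (zonal y (Suc (Suc d))) a = u * (2 * (real (Suc d) * zonal y d a))
        + v * ((4 * real (\<Sum>j\<in>UNIV. a j) + 2 * N) * zonal y d a)"
      unfolding Z laplacian_lincomb laplacian_mul_linear laplacian_mul_norm2 D1 L1 L0 z N_def by simp
    also have "(4 * real (\<Sum>j\<in>UNIV. a j) + 2 * N) * zonal y d a = (4 * real d + 2 * N) * zonal y d a"
      using zonal_support[of y d a] by (cases "zonal y d a = 0") (auto simp: degree_set_def)
    also have "u * (2 * (real (Suc d) * zonal y d a)) + v * ((4 * real d + 2 * N) * zonal y d a) = 0"
      using q by (simp add: u_def v_def field_simps)
    finally show ?thesis .
  qed
  show ?case using dir lap by (auto simp: fun_eq_iff)
qed

lemma mul_linear_cong_degree:
  assumes "a \<in> degree_set (Suc d)" "\<And>b. b \<in> degree_set d \<Longrightarrow> c b = e b"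
  shows "mul_linear y c a = mul_linear y e a"
proof -
  have "mul_var i c a = mul_var i e a" for i
  proof (cases "a i = 0")
    case False
    then have "a = (a(i := a i - 1))(i := Suc ((a(i := a i - 1)) i))" by auto
    then have "a(i := a i - 1) \<in> degree_set d"
      using assms(1) sum_upd[of "a(i := a i - 1)" i] by (simp add: degree_set_def)
    then show ?thesis using assms(2) by (simp add: mul_var_def)
  qed (simp add: mul_var_def)
  then show ?thesis by (simp add: mul_linear_def)
qed

text \<open>
  Each step of the recurrence multiplies the leading term by \<open>\<langle>x,y\<rangle>\<close>, which acts on the
  homogeneous parts of the exponential series as a positive scalar, and sends multiples of
  \<open>|x|\<^sup>2\<close> to multiples of \<open>|x|\<^sup>2\<close>.
\<close>
lemma zonal_leading:
  fixes y :: "real ^ 'n::finite"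
  assumes n: "CARD('n) \<ge> 2"
  obtains \<kappa> :: real where "\<kappa> > 0"
    "\<And>y :: real ^ 'n. \<exists>G. \<forall>a\<in>degree_set d. zonal y d a = \<kappa> * exp_series y a + 1 * mul_norm2 G a"
proof -
  have z: "mul_norm2 (\<lambda>_. 0) a = 0" for a :: "'n \<Rightarrow> nat"
    by (simp add: mul_norm2_def mul_var_0)
  have "\<exists>\<kappa>>0. \<forall>y :: real ^ 'n. \<exists>G. \<forall>a\<in>degree_set d. zonal y d a = \<kappa> * exp_series y a + 1 * mul_norm2 G a"
  proof (induction d rule: induct_nat_012)
    case 0
    have "degree_set 0 = {\<lambda>_ :: 'n. 0 :: nat}" by (auto simp: degree_set_def)
    then show ?case using z by (intro exI[of _ 1] conjI allI exI[of _ "\<lambda>_. 0"]) (auto simp: exp_series_def)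
  next
    case 1
    have d0: "degree_set 0 = {\<lambda>_ :: 'n. 0 :: nat}" by (auto simp: degree_set_def)
    have "zonal y (Suc 0) a = 1 * exp_series y a + 1 * mul_norm2 (\<lambda>_. 0) a"
      if a: "a \<in> degree_set (Suc 0)" for y :: "real ^ 'n" and a
    proof -
      have "zonal y (Suc 0) a = mul_linear y (exp_series y) a" unfolding zonal.simps(2)
        by (rule mul_linear_cong_degree[OF a]) (auto simp: d0 exp_series_def)
      also have "\<dots> = exp_series y a" unfolding mul_linear_exp_series using a by (simp add: degree_set_def)
      finally show ?thesis using z by simp
    qed
    then show ?case by (intro exI[of _ 1] conjI allI exI[of _ "\<lambda>_. 0"]) auto
  next
    case (ge2 d)
    then obtain \<kappa> where \<kappa>: "\<kappa> > 0"
      and IH: "\<And>y :: real ^ 'n. \<exists>G. \<forall>a\<in>degree_set (Suc d). zonal y (Suc d) a = \<kappa> * exp_series y a + 1 * mul_norm2 G a"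
      by auto
    define q where "q = real (Suc d) + real CARD('n) - 2"
    define u where "u = (2 * real (Suc d) + real CARD('n) - 2) / q"
    define v where "v = - real (Suc d) / q"
    have "q > 0" using n by (simp add: q_def)
    then have u: "u > 0" using n by (simp add: u_def)
    have "\<exists>G. \<forall>a\<in>degree_set (Suc (Suc d)). zonal y (Suc (Suc d)) a
        = (u * \<kappa> * real (Suc (Suc d))) * exp_series y a + 1 * mul_norm2 G a" for y :: "real ^ 'n"
    proof -
      obtain G where G: "\<And>a. a \<in> degree_set (Suc d) \<Longrightarrow> zonal y (Suc d) a = \<kappa> * exp_series y a + 1 * mul_norm2 G a"
        using IH by blast
      have "zonal y (Suc (Suc d)) a = (u * \<kappa> * real (Suc (Suc d))) * exp_series y a
          + 1 * mul_norm2 (\<lambda>a. u * mul_linear y G a + v * zonal y d a) a"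
        if a: "a \<in> degree_set (Suc (Suc d))" for a
      proof -
        have "zonal y (Suc (Suc d)) a = u * mul_linear y (zonal y (Suc d)) a + v * mul_norm2 (zonal y d) a"
          by (simp add: u_def v_def q_def)
        also have "mul_linear y (zonal y (Suc d)) a = mul_linear y (\<lambda>a. \<kappa> * exp_series y a + 1 * mul_norm2 G a) a"
          by (rule mul_linear_cong_degree[OF a G])
        also have "\<dots> = \<kappa> * (real (Suc (Suc d)) * exp_series y a) + mul_norm2 (mul_linear y G) a"
          unfolding mul_linear_lincomb mul_linear_exp_series mul_linear_norm2 using a
          by (simp add: degree_set_def)
        finally show ?thesis unfolding mul_norm2_lincomb by (simp add: algebra_simps)
      qed
      then show ?thesis by blast
    qed
    moreover have "u * \<kappa> * real (Suc (Suc d)) > 0" using u \<kappa> by simp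
    ultimately show ?case by blast
  qed
  then show ?thesis using that by blast
qed

text \<open>
  By harmonicity, a fixed positive multiple of \<open>P\<^sub>d(\<langle>x,y\<rangle>)\<close> is the Fischer product of two zonal
  harmonics, so the double sum is a sum of squares.
\<close>
theorem gegenbauer_positive_definite:
  fixes C :: "(real ^ 'n::finite) set"
  assumes n: "CARD('n) \<ge> 2" and C: "C \<subseteq> sphere 0 1"
  shows "(\<Sum>x\<in>C. \<Sum>y\<in>C. gegenbauer CARD('n) d (x \<bullet> y)) \<ge> 0"
proof -
  obtain \<kappa> where \<kappa>: "\<kappa> > 0" and lead: "\<And>y :: real ^ 'n. \<exists>G. \<forall>a\<in>degree_set d.
      zonal y d a = \<kappa> * exp_series y a + 1 * mul_norm2 G a"
    by (rule zonal_leading[OF n, where d = d]) blast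
  have key: "\<kappa> * gegenbauer CARD('n) d (x \<bullet> y) = fischer d (zonal x d) (zonal y d)"
    if "x \<in> C" "y \<in> C" for x y
  proof -
    have xy: "norm x = 1" "norm y = 1" using that C by auto
    obtain G where G: "\<And>a. a \<in> degree_set d \<Longrightarrow> zonal y d a = \<kappa> * exp_series y a + 1 * mul_norm2 G a"
      using lead by blast
    have "fischer d (zonal x d) (zonal y d) = fischer d (\<lambda>a. \<kappa> * exp_series y a + 1 * mul_norm2 G a) (zonal x d)"
      unfolding fischer_sym[of d "zonal x d"] by (simp add: fischer_def G)
    also have "\<dots> = \<kappa> * fischer d (zonal x d) (exp_series y)"
      unfolding fischer_lincomb using zonal_derivatives[OF xy(1) n, of d]
      by (simp add: fischer_mul_norm2_harmonic fischer_sym[of d "exp_series y"])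
    finally show ?thesis by (simp add: eval_zonal[OF xy])
  qed
  have "\<kappa> * (\<Sum>x\<in>C. \<Sum>y\<in>C. gegenbauer CARD('n) d (x \<bullet> y))
      = (\<Sum>x\<in>C. \<Sum>y\<in>C. fischer d (zonal x d) (zonal y d))"
    by (simp add: sum_distrib_left key)
  also have "\<dots> = (\<Sum>x\<in>C. \<Sum>a\<in>degree_set d. \<Sum>y\<in>C. (\<Prod>i\<in>UNIV. fact (a i)) * zonal x d a * zonal y d a)"
    unfolding fischer_def by (intro sum.cong refl sum.swap)
  also have "\<dots> = (\<Sum>a\<in>degree_set d. \<Sum>x\<in>C. \<Sum>y\<in>C. (\<Prod>i\<in>UNIV. fact (a i)) * zonal x d a * zonal y d a)"
    by (rule sum.swap)
  also have "\<dots> = (\<Sum>a\<in>degree_set d. (\<Prod>i\<in>UNIV. fact (a i)) * (\<Sum>x\<in>C. zonal x d a)\<^sup>2)"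
  proof (intro sum.cong refl)
    fix a :: "'n \<Rightarrow> nat"
    have "(\<Sum>x\<in>C. zonal x d a)\<^sup>2 = (\<Sum>x\<in>C. \<Sum>y\<in>C. zonal x d a * zonal y d a)"
      by (simp only: power2_eq_square sum_product)
    then show "(\<Sum>x\<in>C. \<Sum>y\<in>C. (\<Prod>i\<in>UNIV. fact (a i)) * zonal x d a * zonal y d a)
        = (\<Prod>i\<in>UNIV. fact (a i)) * (\<Sum>x\<in>C. zonal x d a)\<^sup>2"
      by (simp only: sum_distrib_left mult.assoc)
  qed
  also have "\<dots> \<ge> 0" by (intro sum_nonneg mult_nonneg_nonneg prod_nonneg) auto
  finally show ?thesis using \<kappa> by (simp add: zero_le_mult_iff)
qed

section \<open>Products over the leading nodes of a discrete measure\<close>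

text \<open>
  Otherwise \<open>p\<close> has a root \<open>z\<close> at or beyond the last node. Pairing \<open>p = (t - z) s\<close> with \<open>s\<close>
  then gives a sum of terms of one sign, so \<open>s\<close> vanishes at all nodes but the last, which is
  too many.
\<close>
lemma orth_poly_positive_at_end:
  fixes x w :: "nat \<Rightarrow> real" and p :: "real poly"
  assumes mono: "strict_mono_on {..M} x" and w: "\<And>i. i \<le> M \<Longrightarrow> w i > 0"
    and deg: "degree p = m" "m \<le> M" and lead: "lead_coeff p > 0"
    and orth: "\<And>g. degree g < m \<Longrightarrow> (\<Sum>i\<le>M. w i * poly p (x i) * poly g (x i)) = 0"
  shows "poly p (x M) > 0"
proof (cases "m = 0")
  case True
  then show ?thesis using deg lead by (auto elim!: degree_eq_zeroE)
next
  case False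
  show ?thesis
  proof (rule ccontr)
    assume "\<not> poly p (x M) > 0"
    then have "poly p (x M) \<le> 0" by simp
    moreover have "\<exists>y. \<forall>z\<ge>y. poly p z \<ge> lead_coeff p" by (rule poly_pinfty_gt_lc[OF lead])
    then obtain y where y: "\<And>z. z \<ge> y \<Longrightarrow> poly p z \<ge> lead_coeff p" by blast
    have "poly p (max y (x M)) \<ge> 0" using y[of "max y (x M)"] lead by simp
    ultimately obtain z where z: "z \<ge> x M" "poly p z = 0"
      using IVT[of "poly p" "x M" 0 "max y (x M)"] by (auto simp: poly_isCont)
    then obtain s where s: "p = [:- z, 1:] * s" by (metis poly_eq_0_iff_dvd dvdE)
    have s0: "s \<noteq> 0" using s lead by auto
    have ds: "degree s = m - 1" using deg s s0 by (simp add: degree_mult_eq del: mult_pCons_left)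
    have "(\<Sum>i\<le>M. w i * (z - x i) * (poly s (x i))\<^sup>2) = - (\<Sum>i\<le>M. w i * poly p (x i) * poly s (x i))"
      by (simp add: s sum_negf[symmetric] power2_eq_square algebra_simps)
    also have "\<dots> = 0" using orth[of s] ds False by simp
    finally have sum0: "(\<Sum>i\<le>M. w i * (z - x i) * (poly s (x i))\<^sup>2) = 0" .
    have le: "x i \<le> z" if "i \<le> M" for i
      using that z mono by (cases "i = M") (force dest: strict_mono_onD[of _ x i M])+
    have "\<forall>i\<in>{..M}. w i * (z - x i) * (poly s (x i))\<^sup>2 = 0"
      using sum0 le w
      by (subst sum_nonneg_eq_0_iff[symmetric]) (auto intro!: mult_nonneg_nonneg intro: less_imp_le)
    moreover have "x i < z" if "i < M" for i
      using that z mono strict_mono_onD[of "{..M}" x i M] by auto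
    ultimately have "poly s (x i) = 0" if "i < M" for i
      using that w[of i] by (metis atMost_iff diff_gt_0_iff_gt less_imp_le mult_eq_0_iff
          order_less_irrefl power_eq_0_iff)
    then have "x ` {..<M} \<subseteq> {t. poly s t = 0}" by auto
    then have "card (x ` {..<M}) \<le> degree s"
      using card_poly_roots_bound[OF s0] poly_roots_finite[OF s0] card_mono order_trans by blast
    moreover have "inj_on x {..<M}"
      using mono by (intro inj_onI) (metis lessThan_iff less_imp_le atMost_iff linorder_neqE_nat strict_mono_onD less_irrefl)
    ultimately show False using ds deg False by (simp add: card_image)
  qed
qed

text \<open>
  Induction on the number of nodes. The product over all nodes but the last one is supported
  on the last node, where all the orthogonal polynomials are positive. A shorter product does
  not see the last node \<open>x\<^sub>M\<close>: removing this node and multiplying the weights by \<open>x\<^sub>M - x\<^sub>i\<close>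
  replaces the orthogonal polynomials by their reproducing kernels at \<open>x\<^sub>M\<close>, which are positive
  combinations of the old orthogonal polynomials.
\<close>
lemma node_products_expand:
  fixes x :: "nat \<Rightarrow> real"
  assumes "strict_mono_on {..<M} x"
    and "\<And>i. i < M \<Longrightarrow> w i > 0"
    and "\<And>m. m < M \<Longrightarrow> degree (p m) = m"
    and "\<And>m. m < M \<Longrightarrow> lead_coeff (p m) > 0"
    and "\<And>m g. m < M \<Longrightarrow> degree g < m \<Longrightarrow> (\<Sum>i<M. w i * poly (p m) (x i) * poly g (x i)) = 0"
    and "j < M"
  shows "\<exists>c. (\<forall>m. c m \<ge> 0) \<and> (\<Prod>i<j. [:- x i, 1:]) = (\<Sum>m\<le>j. smult (c m) (p m :: real poly))"
  using assms
proof (induction M arbitrary: w p)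
  case 0 then show ?case by simp
next
  case (Suc M)
  note mono = Suc.prems(1)[unfolded lessThan_Suc_atMost]
  note w = Suc.prems(2)
  note deg = Suc.prems(3)
  note lead = Suc.prems(4)
  note orth = Suc.prems(5)[unfolded lessThan_Suc_atMost]
  define ip where "ip f g = (\<Sum>i\<le>M. w i * poly f (x i) * poly g (x i))" for f g :: "real poly"
  have ip_comm: "ip f g = ip g f" for f g by (simp add: ip_def mult_ac)
  have ip_sum: "ip (\<Sum>l\<in>A. smult (c l) (f l)) g = (\<Sum>l\<in>A. c l * ip (f l) g)" for A c and f :: "nat \<Rightarrow> _" and g
    unfolding ip_def poly_sum poly_smult sum_distrib_left sum_distrib_right
    by (subst sum.swap) (simp add: mult_ac)
  have pos_end: "poly (p m) (x M) > 0" if "m \<le> M" for m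
    using that lead[of m] by (intro orth_poly_positive_at_end[OF mono, of w _ m]) (auto simp: w deg orth)
  have orth': "ip (p l) (p m) = 0" if "l \<le> M" "m \<le> M" "l \<noteq> m" for l m
    using that orth[of l "p m"] orth[of m "p l"] deg[of l] deg[of m] ip_comm[of "p l" "p m"]
    unfolding ip_def by (cases l m rule: linorder_cases) auto
  have norm: "ip (p m) (p m) > 0" if "m \<le> M" for m
  proof -
    have "0 < w M * poly (p m) (x M) * poly (p m) (x M)" using pos_end[OF that] w[of M] by simp
    also have "\<dots> = (\<Sum>i\<in>{M}. w i * poly (p m) (x i) * poly (p m) (x i))" by simp
    also have "\<dots> \<le> ip (p m) (p m)" unfolding ip_def
      by (rule sum_mono2) (use mult_nonneg_nonneg[OF less_imp_le[OF w] zero_le_square] in \<open>auto simp: mult.assoc\<close>)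
    finally show ?thesis .
  qed
  have expand: "q = (\<Sum>l\<le>m. smult (ip q (p l) / ip (p l) (p l)) (p l))" if "degree q \<le> m" "m \<le> M" for q m
  proof -
    have "p l \<noteq> 0" if "l \<le> m" for l using lead[of l] that \<open>m \<le> M\<close> by auto
    moreover have "degree (p l) = l" if "l \<le> m" for l using deg[of l] that \<open>m \<le> M\<close> by simp
    ultimately obtain c where c: "q = (\<Sum>l\<le>m. smult (c l) (p l))"
      using poly_basis_expansion[of m p q] \<open>degree q \<le> m\<close> by blast
    have "ip q (p l) / ip (p l) (p l) = c l" if "l \<le> m" for l
    proof -
      have "ip q (p l) = (\<Sum>i\<le>m. c i * ip (p i) (p l))" unfolding c ip_sum ..
      also have "\<dots> = (\<Sum>i\<le>m. if i = l then c l * ip (p l) (p l) else 0)"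
        using that \<open>m \<le> M\<close> by (intro sum.cong) (auto simp: orth')
      finally show ?thesis using norm[of l] that \<open>m \<le> M\<close> by simp
    qed
    then have "(\<Sum>l\<le>m. smult (ip q (p l) / ip (p l) (p l)) (p l)) = (\<Sum>l\<le>m. smult (c l) (p l))"
      by (intro sum.cong) auto
    with c show ?thesis by simp
  qed
  show ?case
  proof (cases "j = M")
    case True
    let ?G = "\<Prod>i<j. [:- x i, 1:]"
    have dG: "degree ?G \<le> M" using degree_prod_sum_le[of "{..<j}" "\<lambda>i. [:- x i, 1:]"] True by simp
    define c where "c l = (if l \<le> M then ip ?G (p l) / ip (p l) (p l) else 0)" for l
    have G0: "poly ?G (x i) = 0" if "i < M" for i using that True by (auto simp: poly_prod)
    have GM: "poly ?G (x M) > 0"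
      unfolding poly_prod using True strict_mono_onD[OF mono] by (intro prod_pos) auto
    have "ip ?G (p l) > 0" if "l \<le> M" for l
    proof -
      have "ip ?G (p l) = (\<Sum>i\<le>M. if i = M then w M * poly ?G (x M) * poly (p l) (x M) else 0)"
        unfolding ip_def using G0 by (intro sum.cong) (auto simp del: poly_prod)
      then show ?thesis using GM pos_end[OF that] w[of M] by simp
    qed
    then have "\<forall>l. c l \<ge> 0" using norm by (auto simp: c_def less_imp_le)
    moreover have "?G = (\<Sum>m\<le>j. smult (c m) (p m))"
      using expand[OF dG order_refl] True by (simp add: c_def)
    ultimately show ?thesis by blast
  next
    case False
    then have jM: "j < M" using Suc.prems by simp
    \<comment> \<open>coefficients of the reproducing kernel at the removed node\<close>
    define a where "a l = poly (p l) (x M) / ip (p l) (p l)" for l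
    have a_pos: "a l > 0" if "l \<le> M" for l using pos_end norm that by (simp add: a_def)
    define p' where "p' m = (\<Sum>l\<le>m. smult (a l) (p l))" for m
    have p'_step: "p' (Suc m) = p' m + smult (a (Suc m)) (p (Suc m))" for m by (simp add: p'_def)
    have degle: "degree (p' m) \<le> m" if "m \<le> M" for m
      unfolding p'_def using that deg by (intro degree_sum_le) (auto simp: le_trans[OF degree_smult_le])
    have deg': "degree (p' m) = m \<and> lead_coeff (p' m) > 0" if "m < M" for m
    proof (cases m)
      case 0 then show ?thesis using deg[of 0] lead[of 0] a_pos[of 0] that by (simp add: p'_def)
    next
      case (Suc m')
      have "degree (smult (a m) (p m)) = m" using deg[of m] a_pos[of m] that by simp
      moreover have "degree (p' m') < m" using degle[of m'] that Suc by simp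
      moreover have "p' m = p' m' + smult (a m) (p m)" by (simp add: Suc p'_step)
      moreover have "coeff (p' m') m = 0" using \<open>degree (p' m') < m\<close> by (rule coeff_eq_0)
      ultimately show ?thesis using a_pos[of m] lead[of m] deg[of m] that
        by (simp add: degree_add_eq_right)
    qed
    have repr: "ip (p' m) q = poly q (x M)" if "degree q \<le> m" "m \<le> M" for q m
    proof -
      have "ip (p' m) q = (\<Sum>l\<le>m. a l * ip q (p l))" unfolding p'_def ip_sum by (simp add: ip_comm)
      also have "\<dots> = (\<Sum>l\<le>m. ip q (p l) / ip (p l) (p l) * poly (p l) (x M))"
        by (simp add: a_def mult_ac)
      also have "\<dots> = poly q (x M)"
        by (subst (2) expand[OF that]) (simp add: poly_sum)
      finally show ?thesis .
    qed
    have orth'': "(\<Sum>i<M. (w i * (x M - x i)) * poly (p' m) (x i) * poly g (x i)) = 0"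
      if "m < M" "degree g < m" for m g
    proof -
      have "(\<Sum>i<M. (w i * (x M - x i)) * poly (p' m) (x i) * poly g (x i)) = ip (p' m) ([:x M, -1:] * g)"
        unfolding ip_def lessThan_Suc_atMost[symmetric] by (simp add: algebra_simps)
      also have "degree ([:x M, -1:] * g) \<le> m"
        using degree_mult_le[of "[:x M, -1:]" g] that by simp
      then have "ip (p' m) ([:x M, -1:] * g) = 0" using repr[of "[:x M, -1:] * g" m] that by simp
      finally show ?thesis .
    qed
    have "\<exists>c. (\<forall>m. c m \<ge> 0) \<and> (\<Prod>i<j. [:- x i, 1:]) = (\<Sum>m\<le>j. smult (c m) (p' m))"
    proof (rule Suc.IH[of "\<lambda>i. w i * (x M - x i)"])
      show "strict_mono_on {..<M} x" using mono by (auto simp: strict_mono_on_def)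
      show "w i * (x M - x i) > 0" if "i < M" for i
        using that w[of i] strict_mono_onD[OF mono, of i M] by simp
      show "degree (p' m) = m" "lead_coeff (p' m) > 0" if "m < M" for m
        using deg'[OF that] by blast+
    qed (use orth'' jM in auto)
    then obtain c where c: "\<And>m. c m \<ge> 0" "(\<Prod>i<j. [:- x i, 1:]) = (\<Sum>m\<le>j. smult (c m) (p' m))" by blast
    define e where "e l = (if l \<le> j then (\<Sum>m\<in>{l..j}. c m * a l) else 0)" for l
    have "\<forall>l. e l \<ge> 0" using c jM by (auto simp: e_def intro!: sum_nonneg mult_nonneg_nonneg less_imp_le[OF a_pos])
    moreover have "(\<Sum>m\<le>j. smult (c m) (p' m)) = (\<Sum>l\<le>j. smult (e l) (p l))"
    proof -
      have "(\<Sum>m\<le>j. smult (c m) (p' m)) = (\<Sum>m\<le>j. \<Sum>l\<le>m. smult (c m * a l) (p l))"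
        by (simp add: p'_def smult_sum_right)
      also have "\<dots> = (\<Sum>l\<le>j. \<Sum>m\<in>{l..j}. smult (c m * a l) (p l))"
        unfolding sum.Sigma[OF finite_atMost ballI[OF finite_atMost]]
          sum.Sigma[OF finite_atMost ballI[OF finite_atLeastAtMost]]
        by (rule sum.reindex_bij_witness[of _ prod.swap prod.swap]) auto
      also have "\<dots> = (\<Sum>l\<le>j. smult (e l) (p l))"
        by (intro sum.cong) (auto simp: e_def smult_sum)
      finally show ?thesis .
    qed
    ultimately show ?thesis using c by auto
  qed
qed

section \<open>Products over the nodes of a spherical quadrature\<close>

text \<open>
  The two equations come from testing the polynomial over the inner nodes with parity kernels
  of either parity. If the conclusion failed, eliminating the summand \<open>y\<close> would contradict
  \<open>D' < N \<le> D\<close>.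
\<close>
lemma parity_gap:
  fixes x y q N D D' :: real
  assumes "x > 0" "q > 0" "N > 0" "y > 0" "N \<le> D" "D' < N"
    and "D * (x / N + q * y) = x + y" and "D' * (x / N - q * y) = x - y"
  shows "q * y \<le> x / N"
proof (rule ccontr)
  define a where "a = x / N"
  define b where "b = q * y"
  have x: "x = N * a" using assms by (simp add: a_def)
  have a: "a > 0" and b: "b > 0" using assms by (simp_all add: a_def b_def)
  assume "\<not> q * y \<le> x / N"
  then have "a < b" by (simp add: a_def b_def)
  have "D * (a + b) = 2 * (N * a) + D' * (b - a)"
  proof -
    have "D * (a + b) = x + y" "D' * (a - b) = x - y" using assms(7,8) by (simp_all add: a_def b_def)
    then show ?thesis by (simp add: x algebra_simps)
  qed
  also have "\<dots> < 2 * (N * a) + N * (b - a)"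
    using \<open>a < b\<close> assms by (simp add: mult_strict_right_mono)
  also have "\<dots> = N * (a + b)" by (simp add: algebra_simps)
  also have "\<dots> \<le> D * (a + b)" using a b assms by (intro mult_right_mono) auto
  finally show False by simp
qed

lemma sum_shift_2: "(\<Sum>i=2..k. F i) = (\<Sum>i<k - 1. F (i + 2 :: nat))"
  by (rule sum.reindex_bij_witness[of _ "\<lambda>i. i + 2" "\<lambda>i. i - 2"]) (auto simp del: add_2_eq_Suc')

context sphere_dimension begin

lemma parity_kernel_degree: "degree (parity_kernel m) = m \<and> lead_coeff (parity_kernel m) > 0"
proof (induction m rule: induct_nat_012)
  case 0
  have "{j. j = 0 \<and> even j} = {0::nat}" by auto
  then show ?case by (simp add: parity_kernel_def)
next
  case 1
  have "{j. j \<le> Suc 0 \<and> even (Suc 0 + j)} = {Suc 0}" by (auto simp: le_Suc_eq)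
  then show ?case using harm_dim_pos[of "Suc 0"] by (simp add: parity_kernel_def)
next
  case (ge2 m)
  have "degree (parity_kernel m) < degree (smult (harm_dim (Suc (Suc m))) (P (Suc (Suc m))))"
    using ge2 harm_dim_pos[of "Suc (Suc m)"] by simp
  moreover have "coeff (parity_kernel m) (Suc (Suc m)) = 0" by (rule coeff_eq_0) (use ge2 in simp)
  ultimately show ?case
    using P_lead[of "Suc (Suc m)"] harm_dim_pos[of "Suc (Suc m)"] by (simp add: parity_kernel_step degree_add_eq_right)
qed

lemma geg_positive_K: "geg_positive (parity_kernel m)"
  unfolding parity_kernel_def by (intro geg_positive_sum geg_positive_P less_imp_le[OF harm_dim_pos])

lemma P_at_minus_1: "poly (P l) (-1) = (-1) ^ l"
  using geg_minus[of n l 1] geg_1[OF n_ge_2] by simp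

lemma mean_product_zero: "degree g < m \<Longrightarrow> mean (P m * g) = 0"
  using mean_high_degree[of g m] by (simp add: mult.commute)

end

text \<open>
  The term \<open>poly p 1 / real N\<close> makes \<open>1\<close> an additional node, of weight \<open>1/N\<close>.
\<close>
locale design_quadrature = sphere_dimension +
  fixes N \<tau> k :: nat and \<alpha> \<rho> :: "nat \<Rightarrow> real"
  assumes N_pos: "N > 0"
    and k_pos: "k \<ge> 1"
    and node_ge: "-1 \<le> \<alpha> 1"
    and node_mono: "strict_mono_on {1..k} \<alpha>"
    and node_less_1: "\<alpha> k < 1"
    and weight_pos: "\<And>i. i \<in> {1..k} \<Longrightarrow> \<rho> i > 0"
    and quadrature: "\<And>p. degree p \<le> \<tau> \<Longrightarrow> mean p = poly p 1 / real N + (\<Sum>i=1..k. \<rho> i * poly p (\<alpha> i))"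
begin

lemma node_less: "1 \<le> i \<Longrightarrow> i < j \<Longrightarrow> j \<le> k \<Longrightarrow> \<alpha> i < \<alpha> j"
  using node_mono by (auto simp: strict_mono_on_def)

lemma node_range:
  assumes "i \<in> {1..k}"
  shows "\<alpha> i \<in> {-1..<1}"
proof -
  have "\<alpha> 1 \<le> \<alpha> i" "\<alpha> i \<le> \<alpha> k"
    using assms node_less[of 1 i] node_less[of i k] by (cases "i = 1"; cases "i = k"; force)+
  then show ?thesis using node_ge node_less_1 by simp
qed

lemma node_interior: "i \<in> {2..k} \<Longrightarrow> \<alpha> i \<in> {-1<..<1}"
  using node_range[of i] node_less[of 1 i] node_ge by auto

text \<open>
  With \<open>1\<close> as the last node, the quadrature has \<open>k + 1\<close> nodes and degree \<open>2k - 1\<close>. This makes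
  \<open>P\<^sub>0, \<dots>, P\<^sub>k\<close> orthogonal for it, so even the full product is covered.
\<close>
lemma odd_partial_products:
  assumes "\<tau> = 2 * k - 1" "j \<le> k"
  shows "geg_positive (\<Prod>i<j. [:- \<alpha> (i + 1), 1:])"
proof -
  \<comment> \<open>the quadrature as a discrete measure, with the node \<open>1\<close> in the last place\<close>
  define x where "x i = (if i < k then \<alpha> (i + 1) else 1)" for i
  define w where "w i = (if i < k then \<rho> (i + 1) else 1 / real N)" for i
  have "\<exists>c. (\<forall>m. c m \<ge> 0) \<and> (\<Prod>i<j. [:- x i, 1:]) = (\<Sum>m\<le>j. smult (c m) (P m))"
  proof (rule node_products_expand)
    show "strict_mono_on {..<Suc k} x"
    proof (rule strict_mono_onI)
      fix i j assume "i \<in> {..<Suc k}" "j \<in> {..<Suc k}" "i < j"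
      then show "x i < x j"
        using node_less[of "i + 1" "j + 1"] node_range[of "i + 1"] by (auto simp: x_def)
    qed
    show "w i > 0" if "i < Suc k" for i
      using weight_pos[of "i + 1"] N_pos by (simp add: w_def)
    show "(\<Sum>i<Suc k. w i * poly (P m) (x i) * poly g (x i)) = 0" if "m < Suc k" "degree g < m" for m g
    proof -
      have "degree (P m * g) \<le> \<tau>" using that assms degree_mult_le[of "P m" g] by simp
      from quadrature[OF this] have "poly g 1 / real N + (\<Sum>i=1..k. \<rho> i * poly (P m * g) (\<alpha> i)) = 0"
        using mean_product_zero[OF that(2)] geg_1[OF n_ge_2] by simp
      then show ?thesis
        by (simp add: x_def w_def sum.atLeast1_atMost_eq geg_1[OF n_ge_2] mult_ac add.commute)
    qed
  qed (use assms P_lead in auto)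
  moreover have "(\<Prod>i<j. [:- x i, 1:]) = (\<Prod>i<j. [:- \<alpha> (i + 1), 1:])"
    using assms by (intro prod.cong) (auto simp: x_def)
  ultimately show ?thesis by (auto intro!: geg_positive_sum geg_positive_P)
qed

definition tail_product :: "real poly" where "tail_product = (\<Prod>i<k - 1. [:- \<alpha> (i + 2), 1:])"

lemma tail_product_degree: "degree tail_product \<le> k - 1"
  unfolding tail_product_def using degree_prod_sum_le[of "{..<k - 1}" "\<lambda>i. [:- \<alpha> (i + 2), 1:]"] by simp

lemma tail_product_at_1: "poly tail_product 1 > 0"
  unfolding tail_product_def poly_prod using node_interior by (intro prod_pos) auto

lemma tail_product_at_minus_1: "(-1) ^ (k - 1) * poly tail_product (-1) > 0"
proof -
  have "(-1) ^ (k - 1) * poly tail_product (-1) = (\<Prod>i<k - 1. \<alpha> (i + 2) + 1)"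
  proof -
    have "(-1) ^ (k - 1) = (\<Prod>i<k - 1. -1 :: real)" by simp
    then show ?thesis
      unfolding tail_product_def poly_prod by (simp only: prod.distrib[symmetric]) (simp add: add.commute)
  qed
  also have "\<dots> > 0"
  proof (intro prod_pos)
    fix i assume "i \<in> {..<k - 1}"
    then have "i + 2 \<in> {2..k}" by auto
    then show "\<alpha> (i + 2) + 1 > 0" using node_interior by fastforce
  qed
  finally show ?thesis .
qed

lemma tail_product_quadrature:
  assumes "\<alpha> 1 = -1" "degree (tail_product * q) \<le> \<tau>"
  shows "mean (tail_product * q) = poly tail_product 1 * poly q 1 / real N + \<rho> 1 * (poly tail_product (-1) * poly q (-1))"
proof -
  have z: "poly tail_product (\<alpha> i) = 0" if "i \<in> {2..k}" for i
  proof -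
    have "i - 2 < k - 1" "i - 2 + 2 = i" using that by auto
    then show ?thesis unfolding tail_product_def poly_prod by (intro prod_zero) (auto intro!: bexI[of _ "i - 2"])
  qed
  have "(\<Sum>i=1..k. \<rho> i * poly (tail_product * q) (\<alpha> i)) = (\<Sum>i\<in>{1}. \<rho> i * poly (tail_product * q) (\<alpha> i))"
    using k_pos by (intro sum.mono_neutral_right) (auto simp: z)
  then show ?thesis using quadrature[OF assms(2)] assms(1) by simp
qed

text \<open>
  If \<open>-1\<close> is a node, only \<open>1\<close> and \<open>-1\<close> contribute to the quadrature of a multiple of
  \<open>tail_product\<close>. The mean of its product with a parity kernel, evaluated once by quadrature
  and once by reproduction, relates the two contributions.
\<close>
lemma tail_product_kernel:
  assumes "\<alpha> 1 = -1" "m + (k - 1) \<le> \<tau>" "k \<le> m + 2"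
  shows "poly (parity_kernel m) 1 * (poly tail_product 1 / real N + (-1) ^ m * \<rho> 1 * poly tail_product (-1))
    = (poly tail_product 1 + (-1) ^ m * poly tail_product (-1)) / 2"
proof -
  have d: "degree (tail_product * parity_kernel m) \<le> \<tau>"
    using degree_mult_le[of tail_product "parity_kernel m"] tail_product_degree parity_kernel_degree[of m] assms by linarith
  have "degree tail_product \<le> Suc m" using tail_product_degree assms by linarith
  from parity_kernel_reproduces[OF this] show ?thesis
    unfolding tail_product_quadrature[OF assms(1) d] parity_kernel_minus by (simp add: algebra_simps)
qed

text \<open>
  Suppose that \<open>-1\<close> is a node, and let \<open>x\<close> and \<open>y\<close> be the absolute values of \<open>tail_product\<close> at
  \<open>1\<close> and \<open>-1\<close>. Testing with \<open>P\<^sub>k\<close> gives \<open>x/N = \<rho>\<^sub>1 y\<close>, testing with \<open>parity_kernel k\<close> then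
  gives \<open>x = y\<close>, and \<open>parity_kernel (k - 1)\<close> finally gives \<open>N = D(n, 2k - 1)\<close>.
\<close>
lemma odd_first_node:
  assumes \<tau>: "\<tau> = 2 * k - 1" and N: "2 * ((n + k - 2) choose (n - 1)) < N"
  shows "\<alpha> 1 > -1"
proof (rule ccontr)
  assume "\<not> \<alpha> 1 > -1"
  then have a: "\<alpha> 1 = -1" using node_ge by simp
  define x where "x = poly tail_product 1"
  define y where "y = (-1) ^ (k - 1) * poly tail_product (-1)"
  obtain j where k: "k = Suc j" using k_pos by (cases k) auto
  have xy: "x > 0" "y > 0" using tail_product_at_1 tail_product_at_minus_1 by (simp_all add: x_def y_def)
  have y': "(-1) ^ k * poly tail_product (-1) = - y" by (simp add: y_def k)
  have d: "degree (tail_product * P k) \<le> \<tau>"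
    using degree_mult_le[of tail_product "P k"] tail_product_degree \<tau> by simp
  have "mean (tail_product * P k) = 0" using tail_product_degree k by (intro mean_high_degree) simp
  then have 1: "x / real N - \<rho> 1 * y = 0"
    unfolding tail_product_quadrature[OF a d] P_at_minus_1 geg_1[OF n_ge_2]
    using y' by (simp add: x_def mult_ac)
  have 2: "x = y"
    using tail_product_kernel[OF a, of k] \<tau> 1 y' by (simp add: x_def mult_ac)
  have C: "poly (parity_kernel (k - 1)) 1 = real ((n + k - 2) choose (n - 1))" using parity_kernel_at_1[of "k - 1"] k by simp
  have "poly (parity_kernel (k - 1)) 1 * (x / real N + \<rho> 1 * y) = (x + y) / 2"
    using tail_product_kernel[OF a, of "k - 1"] \<tau> k by (simp add: x_def y_def mult_ac)
  then have "real ((n + k - 2) choose (n - 1)) * (2 * (x / real N)) = x"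
    unfolding C using 1 2 by simp
  then have "2 * real ((n + k - 2) choose (n - 1)) = real N" using xy N_pos by (simp add: field_simps)
  then show False using N by linarith
qed

text \<open>
  The factor \<open>1 - t\<^sup>2\<close> in the weights removes the nodes \<open>1\<close> and \<open>-1\<close>. The parity kernels are
  orthogonal for the new measure, because \<open>(1 - t\<^sup>2) g\<close> vanishes at both points where they
  evaluate.
\<close>
lemma even_partial_products:
  assumes \<tau>: "\<tau> = 2 * k - 2" and a: "\<alpha> 1 = -1" and j: "j < k - 1"
  shows "geg_positive (\<Prod>i<j. [:- \<alpha> (i + 2), 1:])"
proof -
  define w where "w i = \<rho> (i + 2) * (1 - (\<alpha> (i + 2))\<^sup>2)" for i
  have int: "\<alpha> (i + 2) \<in> {-1<..<1}" if "i < k - 1" for i using that by (intro node_interior) auto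
  have "\<exists>c. (\<forall>m. c m \<ge> 0) \<and> (\<Prod>i<j. [:- \<alpha> (i + 2), 1:]) = (\<Sum>m\<le>j. smult (c m) (parity_kernel m))"
  proof (rule node_products_expand[where x = "\<lambda>i. \<alpha> (i + 2)", OF _ _ _ _ _ j])
    show "strict_mono_on {..<k - 1} (\<lambda>i. \<alpha> (i + 2))"
      by (intro strict_mono_onI node_less) auto
    show "w i > 0" if "i < k - 1" for i
      using that weight_pos[of "i + 2"] int[OF that]
      by (auto simp: w_def abs_square_less_1 abs_less_iff intro!: mult_pos_pos)
    show "(\<Sum>i<k - 1. w i * poly (parity_kernel m) (\<alpha> (i + 2)) * poly g (\<alpha> (i + 2))) = 0"
      if "m < k - 1" "degree g < m" for m g
    proof -
      let ?q = "[:1, 0, -1:] * g"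
      have dq: "degree ?q \<le> Suc m" using degree_mult_le[of "[:1, 0, -1:]" g] that by simp
      have d: "degree (?q * parity_kernel m) \<le> \<tau>"
        using degree_mult_le[of ?q "parity_kernel m"] dq parity_kernel_degree[of m] that \<tau> by linarith
      have "mean (?q * parity_kernel m) = 0" using parity_kernel_reproduces[OF dq] by simp
      moreover have "mean (?q * parity_kernel m) = (\<Sum>i=1..k. \<rho> i * poly (?q * parity_kernel m) (\<alpha> i))"
        using quadrature[OF d] by simp
      \<comment> \<open>the factor \<open>1 - t\<^sup>2\<close> of \<open>?q\<close> vanishes at the first node\<close>
      moreover have "\<dots> = (\<Sum>i=2..k. \<rho> i * poly (?q * parity_kernel m) (\<alpha> i))"
      proof (intro sum.mono_neutral_right ballI)
        fix i assume "i \<in> {1..k} - {2..k}"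
        then have "i = 1" by auto
        then show "\<rho> i * poly (?q * parity_kernel m) (\<alpha> i) = 0" using a by simp
      qed auto
      moreover have "\<dots> = (\<Sum>i<k - 1. \<rho> (i + 2) * poly (?q * parity_kernel m) (\<alpha> (i + 2)))"
        by (rule sum_shift_2)
      ultimately show ?thesis by (simp add: w_def power2_eq_square algebra_simps)
    qed
    show "degree (parity_kernel m) = m" "lead_coeff (parity_kernel m) > 0" for m using parity_kernel_degree by blast+
  qed
  then show ?thesis by (auto intro!: geg_positive_sum geg_positive_K)
qed

text \<open>
  The Gegenbauer coefficients of \<open>tail_product\<close> are alternately positive multiples of the sum
  and of the difference of the absolute contributions of the nodes \<open>1\<close> and \<open>-1\<close>; \<open>parity_gap\<close>
  gives the sign of the difference.
\<close>
lemma even_full_product: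
  assumes \<tau>: "\<tau> = 2 * k - 2" and k2: "k \<ge> 2" and a: "\<alpha> 1 = -1"
    and N: "N \<le> 2 * ((n + k - 2) choose (n - 1))" "2 * ((n + k - 3) choose (n - 1)) < N"
  shows "geg_positive tail_product"
proof -
  obtain j where k: "k = Suc (Suc j)" using k2 by (metis add_2_eq_Suc le_Suc_ex)
  define x where "x = poly tail_product 1"
  define y where "y = (-1) ^ (k - 1) * poly tail_product (-1)"
  have xy: "x > 0" "y > 0" using tail_product_at_1 tail_product_at_minus_1 by (simp_all add: x_def y_def)
  have y': "(-1) ^ (k - 2) * poly tail_product (-1) = - y" by (simp add: y_def k)
  have C: "poly (parity_kernel (k - 1)) 1 = real ((n + k - 2) choose (n - 1))"
    "poly (parity_kernel (k - 2)) 1 = real ((n + k - 3) choose (n - 1))"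
    using parity_kernel_at_1[of "k - 1"] parity_kernel_at_1[of "k - 2"] k by (simp_all add: numeral_3_eq_3)
  have 1: "2 * poly (parity_kernel (k - 1)) 1 * (x / real N + \<rho> 1 * y) = x + y"
    using tail_product_kernel[OF a, of "k - 1"] \<tau> k by (simp add: x_def y_def mult_ac)
  have 2: "2 * poly (parity_kernel (k - 2)) 1 * (x / real N - \<rho> 1 * y) = x - y"
    using tail_product_kernel[OF a, of "k - 2"] \<tau> k y' by (simp add: x_def mult_ac)
  have "\<rho> 1 > 0" using weight_pos[of 1] k by simp
  moreover have "real N \<le> 2 * real ((n + k - 2) choose (n - 1))" "2 * real ((n + k - 3) choose (n - 1)) < real N"
    using N by linarith+
  ultimately have gap: "\<rho> 1 * y \<le> x / real N"
    using N_pos by (intro parity_gap[OF xy(1) _ _ xy(2) _ _ 1[unfolded C] 2[unfolded C]]) auto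
  show ?thesis unfolding geg_positive_def
  proof
    fix l
    show "mean (tail_product * P l) \<ge> 0"
    proof (cases "l < k")
      case False
      then show ?thesis using tail_product_degree k by (subst mean_high_degree) auto
    next
      case True
      then have d: "degree (tail_product * P l) \<le> \<tau>"
        using degree_mult_le[of tail_product "P l"] tail_product_degree \<tau> by simp
      have "mean (tail_product * P l) = x / real N + \<rho> 1 * ((-1) ^ l * poly tail_product (-1))"
        unfolding tail_product_quadrature[OF a d] P_at_minus_1 geg_1[OF n_ge_2] by (simp add: x_def mult_ac)
      moreover have "(-1) ^ l * poly tail_product (-1) = y \<or> (-1) ^ l * poly tail_product (-1) = - y"
        by (cases "even l"; cases "even (k - 1)") (simp_all add: y_def)
      moreover have "0 \<le> \<rho> 1 * y" "0 \<le> x / real N" using \<open>\<rho> 1 > 0\<close> xy by simp_all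
      ultimately show ?thesis using gap by (elim disjE) simp_all
    qed
  qed
qed

end

section \<open>Newton interpolation of absolutely monotone functions\<close>

text \<open>
  All derivatives are carried along because those of an iterated difference quotient have to
  be exhibited again.
\<close>
definition derivative_tower :: "(nat \<Rightarrow> real \<Rightarrow> real) \<Rightarrow> bool" where
  "derivative_tower D \<longleftrightarrow> (\<forall>i. \<forall>t\<in>{-1..<1}.
     (D i has_real_derivative D (Suc i) t) (at t within {-1..<1}) \<and> D i t \<ge> 0)"

lemma tower_continuous: "derivative_tower D \<Longrightarrow> continuous_on {-1..<1} (D i)"
  unfolding derivative_tower_def by (meson DERIV_continuous continuous_on_eq_continuous_within)

lemma segment_in_domain:
  fixes a t s :: real
  assumes "a \<in> {-1..<1}" "t \<in> {-1..<1}" "s \<in> {0..1}"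
  shows "a + s * (t - a) \<in> {-1..<1}"
proof -
  have "a + s * (t - a) = (1 - s) *\<^sub>R a + s *\<^sub>R t" by (simp add: algebra_simps)
  moreover have "convex {-1..<1::real}" by simp
  ultimately show ?thesis using assms convexD_alt[of "{-1..<1}" a t s] by auto
qed

text \<open>
  The difference quotient is the average of the derivative over the segment from \<open>a\<close> to \<open>t\<close>.
  Differentiating under the integral sign gives its derivatives as integrals of nonnegative
  functions, also at \<open>t = a\<close>.
\<close>
lemma difference_quotient_tower:
  assumes D: "derivative_tower D" and a: "a \<in> {-1..<1}"
  obtains E where "derivative_tower E" "\<And>t. t \<in> {-1..<1} \<Longrightarrow> D 0 t = D 0 a + (t - a) * E 0 t"
proof -
  \<comment> \<open>the chain rule contributes a factor \<open>s\<close> to each derivative\<close>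
  define E where "E i t = integral {0..1} (\<lambda>s. s ^ i * D (Suc i) (a + s * (t - a)))" for i t
  have dom: "a + s * (t - a) \<in> {-1..<1}" if "t \<in> {-1..<1}" "s \<in> {0..1}" for s t
    using segment_in_domain[OF a that] .
  have cont: "continuous_on {0..1} (\<lambda>s. s ^ j * D i (a + s * (t - a)))" if "t \<in> {-1..<1}" for i j t
    by (intro continuous_intros continuous_on_compose2[OF tower_continuous[OF D]]) (use dom that in auto)
  have "(E i has_real_derivative E (Suc i) t) (at t within {-1..<1}) \<and> E i t \<ge> 0"
    if t: "t \<in> {-1..<1}" for i t
  proof
    have "((\<lambda>t. integral (cbox 0 1) (\<lambda>s. s ^ i * D (Suc i) (a + s * (t - a)))) has_real_derivative
        integral (cbox 0 1) (\<lambda>s. s ^ Suc i * D (Suc (Suc i)) (a + s * (t - a)))) (at t within {-1..<1})"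
    proof (rule leibniz_rule_field_derivative)
      fix x s :: real assume x: "x \<in> {-1..<1}" and s: "s \<in> cbox 0 1"
      have "(D (Suc i) has_real_derivative D (Suc (Suc i)) (a + s * (x - a)))
          (at (a + s * (x - a)) within {-1..<1})"
        using D dom[of x s] x s unfolding derivative_tower_def by auto
      then have "(D (Suc i) has_real_derivative D (Suc (Suc i)) (a + s * (x - a)))
          (at (a + s * (x - a)) within (\<lambda>x. a + s * (x - a)) ` {-1..<1})"
        by (rule DERIV_subset) (use dom s in auto)
      moreover have "((\<lambda>x. a + s * (x - a)) has_real_derivative s) (at x within {-1..<1})"
        by (auto intro!: derivative_eq_intros)
      ultimately have "((D (Suc i) \<circ> (\<lambda>x. a + s * (x - a))) has_real_derivative
          D (Suc (Suc i)) (a + s * (x - a)) * s) (at x within {-1..<1})"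
        by (rule DERIV_image_chain)
      then have "((\<lambda>x. D (Suc i) (a + s * (x - a))) has_real_derivative
          D (Suc (Suc i)) (a + s * (x - a)) * s) (at x within {-1..<1})"
        by (simp add: o_def)
      from DERIV_cmult[OF this, of "s ^ i"]
      show "((\<lambda>x. s ^ i * D (Suc i) (a + s * (x - a))) has_real_derivative
          s ^ Suc i * D (Suc (Suc i)) (a + s * (x - a))) (at x within {-1..<1})"
        by (rule DERIV_cong) simp
    next
      show "continuous_on ({-1..<1} \<times> cbox 0 1)
          (\<lambda>(t, s). s ^ Suc i * D (Suc (Suc i)) (a + s * (t - a)))"
        unfolding split_beta
        by (intro continuous_intros continuous_on_compose2[OF tower_continuous[OF D]]) (use dom in auto)
    qed (use t cont in \<open>auto intro!: integrable_continuous_real simp del: power_Suc\<close>)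
    then show "(E i has_real_derivative E (Suc i) t) (at t within {-1..<1})"
      by (simp add: E_def[abs_def])
    show "E i t \<ge> 0" unfolding E_def
      by (intro integral_nonneg integrable_continuous_real cont t mult_nonneg_nonneg)
         (use D dom[OF t] in \<open>auto simp: derivative_tower_def\<close>)
  qed
  then have "derivative_tower E" by (auto simp: derivative_tower_def)
  moreover have "D 0 t = D 0 a + (t - a) * E 0 t" if t: "t \<in> {-1..<1}" for t
  proof -
    have "((\<lambda>s. (t - a) * D (Suc 0) (a + s * (t - a))) has_integral
        (D 0 (a + 1 * (t - a)) - D 0 (a + 0 * (t - a)))) {0..1}"
    proof (rule fundamental_theorem_of_calculus)
      fix s :: real assume s: "s \<in> {0..1}"
      have "(D 0 has_real_derivative D (Suc 0) (a + s * (t - a)))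
          (at (a + s * (t - a)) within {-1..<1})"
        using D dom[OF t s] unfolding derivative_tower_def by auto
      then have "(D 0 has_real_derivative D (Suc 0) (a + s * (t - a)))
          (at (a + s * (t - a)) within (\<lambda>s. a + s * (t - a)) ` {0..1})"
        by (rule DERIV_subset) (use dom t in auto)
      moreover have "((\<lambda>s. a + s * (t - a)) has_real_derivative (t - a)) (at s within {0..1})"
        by (auto intro!: derivative_eq_intros)
      ultimately have "((D 0 \<circ> (\<lambda>s. a + s * (t - a))) has_real_derivative
          D (Suc 0) (a + s * (t - a)) * (t - a)) (at s within {0..1})"
        by (rule DERIV_image_chain)
      then show "((\<lambda>s. D 0 (a + s * (t - a))) has_vector_derivative
          (t - a) * D (Suc 0) (a + s * (t - a))) (at s within {0..1})"
        by (simp add: o_def has_real_derivative_iff_has_vector_derivative mult.commute)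
    qed simp
    from integral_unique[OF this]
    have "(t - a) * integral {0..1} (\<lambda>s. D (Suc 0) (a + s * (t - a))) = D 0 t - D 0 a" by simp
    then show ?thesis by (simp add: E_def)
  qed
  ultimately show ?thesis using that by blast
qed

text \<open>
  The coefficient \<open>c j\<close> is the value at the node \<open>x j\<close> of the \<open>j\<close>-th iterated difference
  quotient. Repeated nodes are allowed.
\<close>
lemma newton_form:
  fixes x :: "nat \<Rightarrow> real" and m :: nat
  assumes D: "derivative_tower D" and x: "\<And>j. j < m \<Longrightarrow> x j \<in> {-1..<1}"
  obtains c E where "\<And>j. c j \<ge> 0" "derivative_tower E"
    "\<And>t. t \<in> {-1..<1} \<Longrightarrow> D 0 t = poly (\<Sum>j<m. smult (c j) (\<Prod>i<j. [:- x i, 1:])) t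
        + poly (\<Prod>i<m. [:- x i, 1:]) t * E 0 t"
proof -
  have "\<exists>c E. (\<forall>j. c j \<ge> 0) \<and> derivative_tower E \<and>
    (\<forall>t\<in>{-1..<1}. D 0 t = poly (\<Sum>j<m. smult (c j) (\<Prod>i<j. [:- x i, 1:])) t
        + poly (\<Prod>i<m. [:- x i, 1:]) t * E 0 t)"
    using x
  proof (induction m)
    case 0
    show ?case using D by (intro exI[of _ "\<lambda>_. 0"] exI[of _ D]) simp
  next
    case (Suc m)
    then obtain c E where c: "\<forall>j. c j \<ge> 0" and E: "derivative_tower E"
      and eq: "\<forall>t\<in>{-1..<1}. D 0 t = poly (\<Sum>j<m. smult (c j) (\<Prod>i<j. [:- x i, 1:])) t
        + poly (\<Prod>i<m. [:- x i, 1:]) t * E 0 t" by auto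
    have xm: "x m \<in> {-1..<1}" using Suc.prems by simp
    obtain F where F: "derivative_tower F"
      and eqF: "\<And>t. t \<in> {-1..<1} \<Longrightarrow> E 0 t = E 0 (x m) + (t - x m) * F 0 t"
      using difference_quotient_tower[OF E xm] by blast
    have "E 0 (x m) \<ge> 0" using E xm by (auto simp: derivative_tower_def)
    with c have "\<forall>j. (c(m := E 0 (x m))) j \<ge> 0" by simp
    moreover have "D 0 t = poly (\<Sum>j<Suc m. smult ((c(m := E 0 (x m))) j) (\<Prod>i<j. [:- x i, 1:])) t
        + poly (\<Prod>i<Suc m. [:- x i, 1:]) t * F 0 t" if t: "t \<in> {-1..<1}" for t
      using eq[rule_format, OF t] eqF[OF t] by (simp add: poly_mult algebra_simps)
    ultimately show ?case using F by blast
  qed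
  then show ?thesis using that by blast
qed

section \<open>Delsarte-Goethals-Seidel numbers\<close>

text \<open>
  By Pascal's rule both the step from odd to even and the step from even to odd \<open>m\<close> add the
  binomial coefficient \<open>(n + l - 2) choose (n - 2)\<close>.
\<close>
lemma dgs_strict:
  assumes n: "n \<ge> 2" and m: "m \<ge> 1"
  shows "dgs_number n m < dgs_number n (m + 1)"
proof -
  define l where "l = (m + 1) div 2"
  have l: "l \<ge> 1" using m by (simp add: l_def)
  have pascal: "n + l - 1 choose (n - 1) = (n + l - 2 choose (n - 1)) + (n + l - 2 choose (n - 2))"
    if "l \<ge> 1" for l
  proof -
    have "n + l - 1 = Suc (n + l - 2)" "n - 1 = Suc (n - 2)" using n that by simp_all
    then show ?thesis by (simp only: binomial_Suc_Suc add.commute)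
  qed
  have pos: "n + l - 2 choose (n - 2) > 0" for l by (simp add: zero_less_binomial_iff)
  show ?thesis
  proof (cases "odd m")
    case True
    then have "(m + 1) div 2 = l" by (simp add: l_def)
    then show ?thesis using True pascal[OF l] pos[of l] by (simp add: dgs_number_def Let_def)
  next
    case False
    then have e: "m div 2 = l" "(m + 1 + 1) div 2 = l + 1" by (simp_all add: l_def)
    have "n + (l + 1) - 2 = n + l - 1" by simp
    then show ?thesis using False e pascal[OF l] pos[of l] by (simp add: dgs_number_def Let_def)
  qed
qed

lemma levenshtein_tau_bounds:
  assumes n: "n \<ge> 2" and N: "N \<ge> 3"
  defines "T \<equiv> levenshtein_tau n N"
  shows "T \<ge> 1 \<and> dgs_number n T < N \<and> N \<le> dgs_number n (T + 1)"
proof -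
  have mono: "dgs_number n a < dgs_number n b" if "1 \<le> a" "a < b" for a b
    using that(2,1)
  proof (induction b rule: less_Suc_induct)
    case (1 b) then show ?case using dgs_strict[OF n, of b] by simp
  next
    case (2 a b c) then show ?case by simp
  qed
  have lower: "dgs_number n (Suc m) \<ge> m" for m
  proof (induction m)
    case (Suc m) then show ?case using dgs_strict[OF n, of "Suc m"] by simp
  qed simp
  have d1: "dgs_number n 1 = 2" using n by (simp add: dgs_number_def)
  define T0 where "T0 = (LEAST m. N \<le> dgs_number n (m + 1))"
  have ex: "N \<le> dgs_number n (T0 + 1)"
    unfolding T0_def by (rule LeastI[of _ N]) (use lower in simp)
  have "T0 \<noteq> 0"
  proof
    assume "T0 = 0" with ex have "N \<le> dgs_number n 1" by simp
    then show False using d1 N by simp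
  qed
  then have T0: "T0 \<ge> 1" by simp
  have "\<not> N \<le> dgs_number n (T0 - 1 + 1)"
    using T0 unfolding T0_def by (intro not_less_Least) simp
  then have "dgs_number n T0 < N" using T0 by simp
  with T0 ex have P: "T0 \<ge> 1 \<and> dgs_number n T0 < N \<and> N \<le> dgs_number n (T0 + 1)" by simp
  show ?thesis unfolding T_def levenshtein_tau_def
  proof (rule theI[where P = "\<lambda>m. m \<ge> 1 \<and> dgs_number n m < N \<and> N \<le> dgs_number n (m + 1)", OF P])
    fix S assume S: "S \<ge> 1 \<and> dgs_number n S < N \<and> N \<le> dgs_number n (S + 1)"
    have le: "a \<le> b" if "1 \<le> a \<and> dgs_number n a < N \<and> N \<le> dgs_number n (a + 1)"
      "1 \<le> b \<and> dgs_number n b < N \<and> N \<le> dgs_number n (b + 1)" for a b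
    proof (rule ccontr)
      assume "\<not> a \<le> b"
      then have "b + 1 = a \<or> b + 1 < a" by auto
      then show False using mono[of "b + 1" a] that by auto
    qed
    show "S = T0" using le[OF S P] le[OF P S] by simp
  qed
qed

lemma num_nodes_eq: "num_nodes m = m div 2 + 1"
proof -
  have "\<lceil>(real m + 1) / 2\<rceil> = int (m div 2 + 1)"
  proof (cases "even m")
    case True
    then obtain j where "m = 2 * j" by (elim evenE)
    then show ?thesis by (simp add: ceiling_eq_iff)
  next
    case False
    then obtain j where "m = 2 * j + 1" by (elim oddE)
    then show ?thesis by (simp add: ceiling_eq_iff)
  qed
  then show ?thesis by (simp add: num_nodes_def)
qed

section \<open>Hermite interpolation\<close>

lemma within_not_bot: "a \<in> {-1..<1} \<Longrightarrow> at a within {-1..<1::real} \<noteq> bot"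
proof -
  assume a: "a \<in> {-1..<1}"
  have "a \<in> closure {a<..<1}" using a by (simp add: closure_greaterThanLessThan)
  moreover have "closure {a<..<1} \<subseteq> closure ({-1..<1} - {a})" using a by (intro closure_mono) auto
  ultimately show ?thesis by (auto simp: at_within_eq_bot_iff)
qed

lemma tower_derivative:
  "derivative_tower D \<Longrightarrow> t \<in> {-1..<1} \<Longrightarrow> (D i has_real_derivative D (Suc i) t) (at t within {-1..<1})"
  by (simp add: derivative_tower_def)

lemma matches_iff:
  assumes h: "\<And>t. t \<in> {-1..<1} \<Longrightarrow> h t = ereal (D 0 t)" and D: "derivative_tower D" and a: "a \<in> {-1..<1}"
  shows "matches_to_first_order h f a \<longleftrightarrow> poly f a = D 0 a \<and> poly (pderiv f) a = D 1 a"
proof -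
  have "(D 0 has_real_derivative D 1 a) (at a within {-1..<1})"
    using D a by (auto simp: derivative_tower_def)
  then have d: "((\<lambda>t. real_of_ereal (h t)) has_real_derivative D 1 a) (at a within {-1..<1})"
    by (rule has_field_derivative_transform_within[where d = 1]) (use a h in auto)
  have "((\<lambda>t. real_of_ereal (h t)) has_real_derivative z) (at a within {-1..<1}) \<longleftrightarrow> z = D 1 a" for z
    using has_field_derivative_unique[OF _ d within_not_bot[OF a], of z] d by blast
  then show ?thesis unfolding matches_to_first_order_def by (simp add: h[OF a])
qed

lemma double_root_dvd:
  fixes q :: "real poly"
  assumes "poly q a = 0" "poly (pderiv q) a = 0"
  shows "[:- a, 1:]\<^sup>2 dvd q"
proof -
  have "[:- a, 1:] dvd q" using assms(1) by (simp add: poly_eq_0_iff_dvd)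
  then obtain s where s: "q = [:- a, 1:] * s" by (elim dvdE)
  have "poly s a = 0" using assms(2) by (simp add: s pderiv_mult pderiv_pCons del: mult_pCons_left)
  then have "[:- a, 1:] dvd s" by (simp add: poly_eq_0_iff_dvd)
  then show ?thesis unfolding s power2_eq_square by (intro mult_dvd_mono) auto
qed

lemma double_root_deriv:
  fixes q :: "real poly"
  assumes "[:- a, 1:]\<^sup>2 dvd q"
  shows "poly q a = 0" "poly (pderiv q) a = 0"
proof -
  obtain s where s: "q = [:- a, 1:]\<^sup>2 * s" using assms by (elim dvdE)
  show "poly q a = 0" "poly (pderiv q) a = 0"
    by (simp_all add: s pderiv_mult pderiv_power power2_eq_square pderiv_pCons del: mult_pCons_left)
qed

text \<open>
  Value and derivative of the remainder vanish at a double root of \<open>q\<close>. All derivatives are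
  taken within \<open>[-1,1)\<close>, which makes them unique at \<open>-1\<close> as well.
\<close>
lemma remainder_double_root:
  assumes D: "derivative_tower D" and E: "derivative_tower E" and a: "a \<in> {-1..<1}"
    and eq: "\<And>t. t \<in> {-1..<1} \<Longrightarrow> D 0 t = poly f t + poly q t * E 0 t"
    and dvd: "[:- a, 1:]\<^sup>2 dvd q"
  shows "poly f a = D 0 a \<and> poly (pderiv f) a = D 1 a"
proof
  show "poly f a = D 0 a" using eq[OF a] double_root_deriv[OF dvd] by simp
  have "((\<lambda>t. poly f t + poly q t * E 0 t) has_real_derivative
      poly (pderiv f) a + (poly (pderiv q) a * E 0 a + E (Suc 0) a * poly q a)) (at a within {-1..<1})"
    using E a unfolding derivative_tower_def
    by (intro DERIV_add DERIV_mult has_field_derivative_at_within[OF poly_DERIV]) auto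
  then have 1: "((\<lambda>t. poly f t + poly q t * E 0 t) has_real_derivative poly (pderiv f) a) (at a within {-1..<1})"
    using double_root_deriv[OF dvd] by simp
  have "(D 0 has_real_derivative D 1 a) (at a within {-1..<1})"
    using D a by (auto simp: derivative_tower_def)
  then have 2: "((\<lambda>t. poly f t + poly q t * E 0 t) has_real_derivative D 1 a) (at a within {-1..<1})"
    by (rule has_field_derivative_transform_within[where d = 1]) (use a eq in auto)
  show "poly (pderiv f) a = D 1 a" by (rule has_field_derivative_unique[OF 1 2 within_not_bot[OF a]])
qed

lemma double_roots_degree:
  fixes q :: "real poly"
  assumes "finite S" "\<And>a. a \<in> S \<Longrightarrow> poly q a = 0 \<and> poly (pderiv q) a = 0"
    and "finite T" "\<And>a. a \<in> T \<Longrightarrow> poly q a = 0" "S \<inter> T = {}"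
    and "degree q < 2 * card S + card T"
  shows "q = 0"
proof (rule ccontr)
  assume q: "q \<noteq> 0"
  have s: "order a q \<ge> 2" if "a \<in> S" for a
    using double_root_dvd[of q a] assms(2)[OF that] q by (simp add: order_divides)
  have t: "order a q \<ge> 1" if "a \<in> T" for a
    using assms(4)[OF that] q by (metis One_nat_def Suc_leI order_root neq0_conv)
  have "2 * card S + card T = (\<Sum>a\<in>S. 2) + (\<Sum>a\<in>T. 1)" by simp
  also have "\<dots> \<le> (\<Sum>a\<in>S. order a q) + (\<Sum>a\<in>T. order a q)" using s t by (intro add_mono sum_mono)
  also have "\<dots> = (\<Sum>a\<in>S \<union> T. order a q)" using assms by (simp add: sum.union_disjoint)
  also have "\<dots> \<le> (\<Sum>a | poly q a = 0. order a q)"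
    using assms q by (intro sum_mono2) (auto simp: poly_roots_finite)
  also have "\<dots> \<le> degree q" by (rule sum_order_le_degree[OF q])
  finally show False using assms by simp
qed

text \<open>
  The \<open>i\<close>-th node of the doubled sequence is \<open>b (i div 2)\<close>; an odd number of factors ends
  between the two copies of a node.
\<close>
lemma doubled_node_product:
  fixes b :: "nat \<Rightarrow> real" and j :: nat
  shows "(\<Prod>i<j. [:- b (i div 2), 1:]) = (\<Prod>i<j div 2. [:- b i, 1:]) * (\<Prod>i<(j + 1) div 2. [:- b i, 1:])"
proof (induction j)
  case (Suc j)
  show ?case
  proof (cases "even j")
    case True
    then have "(Suc j + 1) div 2 = Suc (j div 2)" "Suc j div 2 = j div 2" "(j + 1) div 2 = j div 2" by auto
    then show ?thesis using Suc by (simp add: mult_ac del: mult_pCons_left mult_pCons_right)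
  next
    case False
    then have "(Suc j + 1) div 2 = Suc (j div 2)" "Suc j div 2 = Suc (j div 2)" "(j + 1) div 2 = Suc (j div 2)"
      by (auto elim!: oddE)
    then show ?thesis using Suc by (simp add: mult_ac del: mult_pCons_left mult_pCons_right)
  qed
qed simp

section \<open>The linear programming bound\<close>

context sphere_dimension begin

lemma geg_positive_expansion:
  assumes "geg_positive f"
  obtains c where "\<And>l. c l \<ge> 0" "c 0 = mean f" "\<And>t. poly f t = (\<Sum>l\<le>degree f. c l * gegenbauer n l t)"
proof
  let ?c = "\<lambda>l. mean (f * P l) * harm_dim l"
  show "?c l \<ge> 0" for l using assms harm_dim_pos[of l] by (simp add: geg_positive_def)
  show "?c 0 = mean f" by simp
  show "poly f t = (\<Sum>l\<le>degree f. ?c l * gegenbauer n l t)" for t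
    by (subst expansion_coeffs[OF order_refl]) (simp add: poly_sum poly_geg_poly)
qed

lemma geg_positive_in_lp_class:
  assumes f: "geg_positive f" and le: "\<And>t. t \<in> {-1..1} \<Longrightarrow> ereal (poly f t) \<le> h t"
  shows "poly f \<in> lp_class n h"
proof -
  obtain c where c: "\<And>l. c l \<ge> 0" "\<And>t. poly f t = (\<Sum>l\<le>degree f. c l * gegenbauer n l t)"
    by (rule geg_positive_expansion[OF f]) blast
  define e where "e l = (if l \<le> degree f then c l else 0)" for l
  have s: "(\<lambda>l. e l * gegenbauer n l t) sums poly f t" for t
  proof -
    have "(\<lambda>l. e l * gegenbauer n l t) sums (\<Sum>l\<le>degree f. e l * gegenbauer n l t)"
      by (rule sums_finite) (auto simp: e_def)
    then show ?thesis unfolding c(2) by (simp add: e_def)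
  qed
  have "e sums poly f 1" using s[of 1] geg_1[OF n_ge_2] by (simp add: poly_geg_poly[symmetric])
  then show ?thesis using s le c(1) by (auto simp: lp_class_def e_def intro!: exI[of _ e])
qed

text \<open>
  The double sum of \<open>f\<close> over all pairs of points is at least the contribution of the constant
  term, by positive definiteness; the diagonal contributes \<open>N f(1)\<close>.
\<close>
lemma lp_energy_bound:
  fixes C :: "(real ^ 'd::finite) set"
  assumes d: "n = CARD('d)" and C: "C \<subseteq> sphere 0 1" "finite C" "card C = N" and N: "N > 0"
    and f: "geg_positive f" and le: "\<And>t. t \<in> {-1..1} \<Longrightarrow> ereal (poly f t) \<le> h t"
  shows "ereal (lp_objective n N (poly f)) \<le> energy C h"
proof -
  obtain c where c: "\<And>l. c l \<ge> 0" "c 0 = mean f" "\<And>t. poly f t = (\<Sum>l\<le>degree f. c l * gegenbauer n l t)"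
    by (rule geg_positive_expansion[OF f]) blast
  have nrm: "norm x = 1" if "x \<in> C" for x using that C by auto
  have "mean f * (real N)\<^sup>2 = (\<Sum>l\<in>{0}. c l * (\<Sum>x\<in>C. \<Sum>y\<in>C. gegenbauer n l (x \<bullet> y)))"
    using C by (simp add: c power2_eq_square)
  also have "\<dots> \<le> (\<Sum>l\<le>degree f. c l * (\<Sum>x\<in>C. \<Sum>y\<in>C. gegenbauer n l (x \<bullet> y)))"
    using gegenbauer_positive_definite[of C] n_ge_2 C c(1) unfolding d
    by (intro sum_mono2) auto
  also have "\<dots> = (\<Sum>x\<in>C. \<Sum>y\<in>C. poly f (x \<bullet> y))"
  proof -
    have "(\<Sum>l\<le>degree f. c l * (\<Sum>x\<in>C. \<Sum>y\<in>C. gegenbauer n l (x \<bullet> y)))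
        = (\<Sum>l\<le>degree f. \<Sum>x\<in>C. \<Sum>y\<in>C. c l * gegenbauer n l (x \<bullet> y))"
      by (simp add: sum_distrib_left)
    also have "\<dots> = (\<Sum>x\<in>C. \<Sum>l\<le>degree f. \<Sum>y\<in>C. c l * gegenbauer n l (x \<bullet> y))"
      by (rule sum.swap)
    also have "\<dots> = (\<Sum>x\<in>C. \<Sum>y\<in>C. \<Sum>l\<le>degree f. c l * gegenbauer n l (x \<bullet> y))"
      by (intro sum.cong refl sum.swap)
    finally show ?thesis by (simp add: c(3))
  qed
  also have "\<dots> = (\<Sum>x\<in>C. poly f 1 + (\<Sum>y\<in>C - {x}. poly f (x \<bullet> y)))"
    using C nrm by (intro sum.cong refl) (simp add: sum.remove dot_square_norm)
  also have "\<dots> = real N * poly f 1 + (\<Sum>x\<in>C. \<Sum>y\<in>C - {x}. poly f (x \<bullet> y))"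
    using C by (simp add: sum.distrib)
  finally have "mean f * (real N)\<^sup>2 \<le> real N * poly f 1 + (\<Sum>x\<in>C. \<Sum>y\<in>C - {x}. poly f (x \<bullet> y))" .
  moreover have "lp_objective n N (poly f) = mean f * (real N)\<^sup>2 - real N * poly f 1"
    using N by (simp add: lp_objective_def mean_def[symmetric] power2_eq_square field_simps)
  ultimately have "lp_objective n N (poly f) \<le> (\<Sum>x\<in>C. \<Sum>y\<in>C - {x}. poly f (x \<bullet> y))" by simp
  also have "ereal \<dots> = (\<Sum>x\<in>C. \<Sum>y\<in>C - {x}. ereal (poly f (x \<bullet> y)))" by simp
  also have "\<dots> \<le> energy C h" unfolding energy_def
  proof (intro sum_mono le)
    fix x y assume "x \<in> C" "y \<in> C - {x}"
    then show "x \<bullet> y \<in> {-1..1}" using Cauchy_Schwarz_ineq2[of x y] nrm[of x] nrm[of y] by (auto simp: abs_le_iff)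
  qed
  finally show ?thesis by simp
qed

end

lemma le_at_endpoint:
  assumes "\<And>t. t \<in> {-1..<1} \<Longrightarrow> ereal (poly f t) \<le> h t" "(h \<longlongrightarrow> h 1) (at_left 1)" "t \<in> {-1..1}"
  shows "ereal (poly f t) \<le> h t"
proof (cases "t = 1")
  case True
  have "((\<lambda>t. ereal (poly f t)) \<longlongrightarrow> ereal (poly f 1)) (at_left 1)"
    by (intro tendsto_intros)
  moreover have "\<forall>\<^sub>F t in at_left 1. ereal (poly f t) \<le> h t"
    using eventually_at_left[of "-1" "1::real"] assms(1) by (auto intro!: exI[of _ "-1"])
  ultimately have "ereal (poly f 1) \<le> h 1"
    using tendsto_le[OF _ assms(2)] by (metis trivial_limit_at_left_real)
  then show ?thesis using True by simp
qed (use assms in auto)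

section \<open>Optimality of the Hermite interpolant\<close>

context design_quadrature begin

lemma objective_quadrature:
  assumes "degree p \<le> \<tau>"
  shows "lp_objective n N (poly p) = (real N)\<^sup>2 * (\<Sum>i=1..k. \<rho> i * poly p (\<alpha> i))"
  using quadrature[OF assms] by (simp add: lp_objective_def mean_def)

lemma universal_bound_real:
  assumes "\<And>t. t \<in> {-1..<1} \<Longrightarrow> h t = ereal (D t)"
  shows "universal_bound k N \<alpha> \<rho> h = ereal ((real N)\<^sup>2 * (\<Sum>i=1..k. \<rho> i * D (\<alpha> i)))"
proof -
  have "(\<Sum>i=1..k. ereal (\<rho> i) * h (\<alpha> i)) = (\<Sum>i=1..k. ereal (\<rho> i * D (\<alpha> i)))"
    using node_range assms by (intro sum.cong) auto
  then show ?thesis by (simp add: universal_bound_def)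
qed

text \<open>
  A touching point in the open interval is a local minimum of the difference.
\<close>
lemma touching_matches:
  assumes h: "\<And>t. t \<in> {-1..<1} \<Longrightarrow> h t = ereal (D 0 t)" and D: "derivative_tower D"
    and a: "a \<in> {-1<..<1}" and le: "\<And>t. t \<in> {-1..<1} \<Longrightarrow> poly u t \<le> D 0 t" and eq: "poly u a = D 0 a"
  shows "matches_to_first_order h u a"
proof -
  have a': "a \<in> {-1..<1}" using a by auto
  have "at a within {-1..<1} = at a" using a by (intro at_within_open_subset[of a "{-1<..<1}"]) auto
  then have "(D 0 has_real_derivative D 1 a) (at a)" using tower_derivative[OF D a', of 0] by simp
  then have "((\<lambda>t. D 0 t - poly u t) has_real_derivative D 1 a - poly (pderiv u) a) (at a)"
    by (intro DERIV_diff poly_DERIV)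
  moreover have "min (a + 1) (1 - a) > 0" using a by auto
  moreover have "\<forall>y. \<bar>a - y\<bar> < min (a + 1) (1 - a) \<longrightarrow> D 0 a - poly u a \<le> D 0 y - poly u y"
  proof (intro allI impI)
    fix y assume "\<bar>a - y\<bar> < min (a + 1) (1 - a)"
    then have "y \<in> {-1..<1}" by (simp add: abs_less_iff)
    then show "D 0 a - poly u a \<le> D 0 y - poly u y" using le[of y] eq by simp
  qed
  ultimately have "D 1 a - poly (pderiv u) a = 0" by (rule DERIV_local_min)
  then show ?thesis using matches_iff[OF h D a'] eq by auto
qed

text \<open>
  The nodes are doubled in increasing order; in the even case the simple node \<open>-1\<close> comes last,
  so that it occurs in the remainder only and not in a Newton basis polynomial.
\<close>
lemma newton_interpolant:
  assumes D: "derivative_tower D" and h: "\<And>t. t \<in> {-1..<1} \<Longrightarrow> h t = ereal (D 0 t)"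
    and shape: "\<tau> = 2 * k - 1 \<or> \<tau> = 2 * k - 2 \<and> k \<ge> 2 \<and> \<alpha> 1 = -1 \<and> geg_positive tail_product"
  obtains f where "degree f \<le> \<tau>" "geg_positive f" "\<And>t. t \<in> {-1..<1} \<Longrightarrow> poly f t \<le> D 0 t"
    "hermite_interpolant \<tau> k \<alpha> h f"
proof -
  \<comment> \<open>the number of double nodes, and the double nodes in increasing order\<close>
  define c where "c = (if odd \<tau> then k else k - 1)"
  define b where "b i = (if odd \<tau> then \<alpha> (i + 1) else \<alpha> (i + 2))" for i
  \<comment> \<open>among the indices up to \<open>\<tau>\<close>, the value \<open>-1\<close> occurs in the even case only, where \<open>\<tau> = 2 * c\<close>\<close>
  define x where "x j = (if j < 2 * c then b (j div 2) else -1)" for j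
  define A where "A a = (\<Prod>i<a. [:- b i, 1:])" for a
  have \<tau>: "\<tau> = (if odd \<tau> then 2 * c - 1 else 2 * c)" "c \<ge> 1"
    using shape k_pos by (auto simp: c_def)
  have b_node: "b i \<in> {-1..<1}" if "i < c" for i
    using that node_range[of "i + 1"] node_range[of "i + 2"] by (auto simp: b_def c_def split: if_splits)
  have A_pos: "geg_positive (A a)" if "a \<le> c" for a
  proof (cases "odd \<tau>")
    case True
    then have "\<tau> = 2 * k - 1" using shape by auto
    from odd_partial_products[OF this, of a] that True show ?thesis by (simp add: A_def b_def c_def)
  next
    case False
    then have s: "\<tau> = 2 * k - 2" "\<alpha> 1 = -1" "geg_positive tail_product" using shape k_pos by auto
    show ?thesis
    proof (cases "a = k - 1")
      case True
      then show ?thesis using s(3) False by (simp add: A_def b_def tail_product_def)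
    next
      case a: False
      then have "a < k - 1" using that False by (simp add: c_def)
      from even_partial_products[OF s(1,2) this] False show ?thesis by (simp add: A_def b_def)
    qed
  qed
  have prods: "(\<Prod>i<j. [:- x i, 1:]) = A (j div 2) * A ((j + 1) div 2)" if "j \<le> 2 * c" for j
  proof -
    have "(\<Prod>i<j. [:- x i, 1:]) = (\<Prod>i<j. [:- b (i div 2), 1:])"
      using that by (intro prod.cong) (auto simp: x_def)
    then show ?thesis by (simp only: doubled_node_product A_def)
  qed
  have full: "(\<Prod>i<Suc \<tau>. [:- x i, 1:]) = (A c)\<^sup>2 * (if odd \<tau> then 1 else [:1, 1:])"
  proof (cases "odd \<tau>")
    case True
    then have "Suc \<tau> = 2 * c" using \<tau> by simp
    then show ?thesis using prods[of "2 * c"] True by (simp add: power2_eq_square)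
  next
    case False
    then have "\<tau> = 2 * c" using \<tau> by simp
    then show ?thesis using prods[of "2 * c"] by (simp add: power2_eq_square x_def mult.commute)
  qed
  have xr: "x j \<in> {-1..<1}" for j using b_node[of "j div 2"] by (auto simp: x_def)
  obtain e E where e: "\<And>j. e j \<ge> 0" and E: "derivative_tower E"
    and eq: "\<And>t. t \<in> {-1..<1} \<Longrightarrow> D 0 t = poly (\<Sum>j<Suc \<tau>. smult (e j) (\<Prod>i<j. [:- x i, 1:])) t
        + poly (\<Prod>i<Suc \<tau>. [:- x i, 1:]) t * E 0 t"
    using newton_form[OF D, of "Suc \<tau>" x] xr by blast
  define f where "f = (\<Sum>j<Suc \<tau>. smult (e j) (\<Prod>i<j. [:- x i, 1:]))"
  define q where "q = (A c)\<^sup>2 * (if odd \<tau> then 1 else [:1, 1:])"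
  have eq': "D 0 t = poly f t + poly q t * E 0 t" if "t \<in> {-1..<1}" for t
    using eq[OF that] unfolding f_def q_def full .
  have deg: "degree f \<le> \<tau>"
    unfolding f_def
  proof (intro degree_sum_le)
    fix j assume j: "j \<in> {..<Suc \<tau>}"
    have "degree (\<Prod>i<j. [:- x i, 1:]) \<le> j"
      using degree_prod_sum_le[of "{..<j}" "\<lambda>i. [:- x i, 1:]"] by simp
    then show "degree (smult (e j) (\<Prod>i<j. [:- x i, 1:])) \<le> \<tau>"
      using j degree_smult_le[of "e j" "\<Prod>i<j. [:- x i, 1:]"] by simp
  qed simp
  have pos: "geg_positive f"
    unfolding f_def
  proof (intro geg_positive_sum e)
    fix j assume "j \<in> {..<Suc \<tau>}"
    then have j: "j \<le> 2 * c" using \<tau> by (auto split: if_splits)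
    then have "(j + 1) div 2 \<le> c" "j div 2 \<le> c"
      using \<open>j \<in> {..<Suc \<tau>}\<close> \<tau> by (auto split: if_splits)
    then show "geg_positive (\<Prod>i<j. [:- x i, 1:])"
      unfolding prods[OF j] by (intro geg_positive_mult A_pos)
  qed
  have le: "poly f t \<le> D 0 t" if t: "t \<in> {-1..<1}" for t
  proof -
    have "poly q t \<ge> 0" using t by (simp add: q_def)
    moreover have "E 0 t \<ge> 0" using E t by (simp add: derivative_tower_def)
    ultimately show ?thesis using eq'[OF t] by simp
  qed
  have dbl: "matches_to_first_order h f (b i)" if "i < c" for i
  proof -
    have "[:- b i, 1:] dvd A c" unfolding A_def using that by (intro dvd_prodI) auto
    then have "[:- b i, 1:]\<^sup>2 dvd q" unfolding q_def by (intro dvd_mult2 dvd_power_same)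
    then show ?thesis using remainder_double_root[OF D E b_node[OF that] eq'] matches_iff[OF h D b_node[OF that]]
      by blast
  qed
  have "hermite_interpolant \<tau> k \<alpha> h f"
  proof (cases "odd \<tau>")
    case True
    have "matches_to_first_order h f (\<alpha> i)" if "i \<in> {1..k}" for i
      using dbl[of "i - 1"] that True by (auto simp: b_def c_def)
    then show ?thesis using True deg by (simp add: hermite_interpolant_def)
  next
    case False
    have "matches_to_first_order h f (\<alpha> i)" if "i \<in> {2..k}" for i
    proof -
      have "i - 2 < c" "i - 2 + 2 = i" using that False by (auto simp: c_def)
      then show ?thesis using dbl[of "i - 2"] False by (simp only: b_def if_False)
    qed
    moreover have "ereal (poly f (-1)) = h (-1)"
      using eq'[of "-1"] h[of "-1"] False by (simp add: q_def)
    ultimately show ?thesis using False deg by (simp add: hermite_interpolant_def)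
  qed
  with deg pos le that show ?thesis by blast
qed

text \<open>
  The difference of two interpolants has at least \<open>\<tau> + 1\<close> roots, counted with multiplicity.
\<close>
lemma hermite_unique:
  assumes D: "derivative_tower D" and h: "\<And>t. t \<in> {-1..<1} \<Longrightarrow> h t = ereal (D 0 t)"
    and shape: "\<tau> = 2 * k - 1 \<or> \<tau> = 2 * k - 2 \<and> \<alpha> 1 = -1"
    and f: "hermite_interpolant \<tau> k \<alpha> h f" and g: "hermite_interpolant \<tau> k \<alpha> h g"
  shows "f = g"
proof -
  define J where "J = (if odd \<tau> then {1..k} else {2..k})"
  define T where "T = (if odd \<tau> then {} else {-1 :: real})"
  have JK: "J \<subseteq> {1..k}" by (auto simp: J_def)
  have "f - g = 0"
  proof (rule double_roots_degree[where S = "\<alpha> ` J" and T = T])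
    fix a assume "a \<in> \<alpha> ` J"
    then obtain i where i: "i \<in> J" "a = \<alpha> i" by blast
    then have "matches_to_first_order h f a" "matches_to_first_order h g a"
      using f g by (auto simp: hermite_interpolant_def J_def split: if_splits)
    then show "poly (f - g) a = 0 \<and> poly (pderiv (f - g)) a = 0"
      using matches_iff[OF h D node_range[of i]] i JK by (auto simp: pderiv_diff)
  next
    fix a assume "a \<in> T"
    then have "a = -1" "even \<tau>" by (auto simp: T_def split: if_splits)
    then have "ereal (poly f a) = ereal (poly g a)" using f g by (simp add: hermite_interpolant_def)
    then show "poly (f - g) a = 0" by simp
  next
    show "\<alpha> ` J \<inter> T = {}" using node_interior by (force simp: J_def T_def)
    have "inj_on \<alpha> J"
      using node_mono JK strict_mono_on_imp_inj_on inj_on_subset by blast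
    then have "card (\<alpha> ` J) = card J" by (rule card_image)
    moreover have "degree (f - g) \<le> \<tau>"
      using f g by (intro degree_diff_le) (auto simp: hermite_interpolant_def)
    ultimately show "degree (f - g) < 2 * card (\<alpha> ` J) + card T"
      using shape k_pos by (auto simp: J_def T_def)
  qed (auto simp: J_def T_def)
  then show ?thesis by simp
qed

end

theorem theorem3p1:
  fixes n N \<tau> k :: nat
    and h :: "real \<Rightarrow> ereal"
    and \<alpha> \<rho> :: "nat \<Rightarrow> real"
  assumes "n = CARD('n::finite)"
    and "n \<ge> 2" and "N \<ge> 3"
    and "absolutely_monotone h"
    and "\<tau> = levenshtein_tau n N" and "k = num_nodes \<tau>"
    and "levenshtein_quadrature n N \<alpha> \<rho>"
  shows "min_energy TYPE('n) N h \<ge> universal_bound k N \<alpha> \<rho> h \<and>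
    (\<exists>!f. hermite_interpolant \<tau> k \<alpha> h f) \<and>
    (\<forall>f. hermite_interpolant \<tau> k \<alpha> h f \<longrightarrow>
       poly f \<in> poly_space \<tau> \<inter> lp_class n h \<and>
       (\<forall>u \<in> poly_space \<tau> \<inter> lp_class n h.
          u \<noteq> poly f \<longrightarrow> lp_objective n N u < lp_objective n N (poly f))) \<and>
    lp_value n N (poly_space \<tau>) h = universal_bound k N \<alpha> \<rho> h"
proof -
  have tau: "\<tau> \<ge> 1" "dgs_number n \<tau> < N" "N \<le> dgs_number n (\<tau> + 1)"
    using levenshtein_tau_bounds[OF assms(2,3)] assms(5) by auto
  have k: "k = \<tau> div 2 + 1" using assms(6) num_nodes_eq by simp
  obtain D where h: "\<And>t. t \<in> {-1..<1} \<Longrightarrow> h t = ereal (D 0 t)" and D: "derivative_tower D"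
    and lim: "(h \<longlongrightarrow> h 1) (at_left 1)"
    using assms(4) unfolding absolutely_monotone_def derivative_tower_def by blast
  interpret sphere_dimension n by unfold_locales (fact assms(2))
  note quad = assms(7)[unfolded levenshtein_quadrature_def Let_def assms(5)[symmetric] assms(6)[symmetric]]
  interpret design_quadrature n N \<tau> k \<alpha> \<rho>
  proof unfold_locales
    show "mean p = poly p 1 / real N + (\<Sum>i=1..k. \<rho> i * poly p (\<alpha> i))" if "degree p \<le> \<tau>" for p
      using quad that by (auto simp: mean_def poly_space_def)
  qed (use quad assms(3) k in auto)
  \<comment> \<open>at every double node touching from below gives equality of derivatives\<close>
  have interior: "\<alpha> i \<in> {-1<..<1}" if "i \<in> {1..k}" "odd \<tau> \<or> i \<ge> 2" for i
  proof (cases "i \<ge> 2")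
    case True
    then show ?thesis using that by (intro node_interior) auto
  next
    case False
    then have "odd \<tau>" "i = 1" using that by auto
    then have t: "\<tau> = 2 * k - 1" using k by auto
    have "2 * ((n + k - 2) choose (n - 1)) < N"
      using tau(2) \<open>odd \<tau>\<close> k by (auto simp: dgs_number_def Let_def elim!: oddE)
    then have "\<alpha> 1 > -1" by (rule odd_first_node[OF t])
    then show ?thesis using node_range[of 1] that \<open>i = 1\<close> by auto
  qed
  have shape: "\<tau> = 2 * k - 1 \<or> \<tau> = 2 * k - 2 \<and> k \<ge> 2 \<and> \<alpha> 1 = -1 \<and> geg_positive tail_product"
  proof (cases "odd \<tau>")
    case True
    then show ?thesis using k by auto
  next
    case False
    then have t: "\<tau> = 2 * k - 2" and k2: "k \<ge> 2" using k tau(1) by auto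
    have a: "\<alpha> 1 = -1" using quad False by simp
    obtain j where j: "k = Suc (Suc j)" using k2 by (metis add_2_eq_Suc le_Suc_ex)
    have \<tau>j: "\<tau> = Suc (Suc (2 * j))" using t j by simp
    have "dgs_number n (\<tau> + 1) = 2 * ((n + k - 2) choose (n - 1))"
      by (simp add: dgs_number_def Let_def \<tau>j j)
    moreover have "dgs_number n (\<tau> - 1) = 2 * ((n + k - 3) choose (n - 1))"
      by (simp add: dgs_number_def Let_def \<tau>j j numeral_3_eq_3)
    moreover have "dgs_number n (\<tau> - 1) < dgs_number n \<tau>"
      using dgs_strict[OF assms(2), of "\<tau> - 1"] by (simp add: \<tau>j)
    ultimately have "geg_positive tail_product" using tau by (intro even_full_product[OF t k2 a]) auto
    then show ?thesis using t k2 a by simp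
  qed
  then have shape': "\<tau> = 2 * k - 1 \<or> \<tau> = 2 * k - 2 \<and> \<alpha> 1 = -1" by auto
  obtain f where f: "degree f \<le> \<tau>" "geg_positive f" "\<And>t. t \<in> {-1..<1} \<Longrightarrow> poly f t \<le> D 0 t"
    "hermite_interpolant \<tau> k \<alpha> h f"
    using newton_interpolant[OF D h shape] by blast
  have uniq: "g = f" if "hermite_interpolant \<tau> k \<alpha> h g" for g
    by (rule hermite_unique[OF D h shape' that f(4)])
  have f_le: "ereal (poly f t) \<le> h t" if "t \<in> {-1..1}" for t
    by (rule le_at_endpoint[OF _ lim that]) (simp add: h f(3))
  have f_lp: "poly f \<in> lp_class n h" by (rule geg_positive_in_lp_class[OF f(2) f_le])
  have f_sp: "poly f \<in> poly_space \<tau>" using f(1) by (auto simp: poly_space_def)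
  have f_nodes: "poly f (\<alpha> i) = D 0 (\<alpha> i)" if "i \<in> {1..k}" for i
  proof -
    have "ereal (poly f (\<alpha> i)) = h (\<alpha> i)"
      using f(4) that shape' by (cases "i = 1")
        (auto simp: hermite_interpolant_def matches_to_first_order_def split: if_splits)
    then show ?thesis using h[OF node_range[OF that]] by simp
  qed
  have ub: "universal_bound k N \<alpha> \<rho> h = ereal (lp_objective n N (poly f))"
  proof -
    have "universal_bound k N \<alpha> \<rho> h = ereal ((real N)\<^sup>2 * (\<Sum>i=1..k. \<rho> i * D 0 (\<alpha> i)))"
      by (rule universal_bound_real) (rule h)
    then show ?thesis unfolding objective_quadrature[OF f(1)] using f_nodes by simp
  qed
  have opt: "lp_objective n N u < lp_objective n N (poly f)"
    if u: "u \<in> poly_space \<tau> \<inter> lp_class n h" "u \<noteq> poly f" for u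
  proof -
    obtain p where p: "u = poly p" "degree p \<le> \<tau>" using u by (auto simp: poly_space_def)
    have p_le: "poly p t \<le> D 0 t" if "t \<in> {-1..<1}" for t
    proof -
      have "ereal (poly p t) \<le> h t" using u(1) that p(1) by (auto simp: lp_class_def)
      then show ?thesis using h[OF that] by simp
    qed
    have "\<exists>i\<in>{1..k}. poly p (\<alpha> i) \<noteq> D 0 (\<alpha> i)"
    proof (rule ccontr)
      assume "\<not> ?thesis"
      then have eq: "poly p (\<alpha> i) = D 0 (\<alpha> i)" if "i \<in> {1..k}" for i using that by blast
      have m: "matches_to_first_order h p (\<alpha> i)" if "i \<in> {1..k}" "odd \<tau> \<or> i \<ge> 2" for i
        by (rule touching_matches[OF h D interior[OF that] p_le eq[OF that(1)]])
      have "hermite_interpolant \<tau> k \<alpha> h p"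
      proof (cases "odd \<tau>")
        case True
        then show ?thesis using m p(2) by (simp add: hermite_interpolant_def)
      next
        case False
        then have "\<alpha> 1 = -1" using shape' k_pos by auto
        then have "ereal (poly p (-1)) = h (-1)" using eq[of 1] k_pos h[of "-1"] by simp
        then show ?thesis using m p(2) False by (simp add: hermite_interpolant_def)
      qed
      then have "p = f" by (rule uniq)
      then show False using u(2) p(1) by simp
    qed
    then obtain i where i: "i \<in> {1..k}" "poly p (\<alpha> i) \<noteq> D 0 (\<alpha> i)" by blast
    have "(\<Sum>i=1..k. \<rho> i * poly p (\<alpha> i)) < (\<Sum>i=1..k. \<rho> i * poly f (\<alpha> i))"
    proof (rule sum_strict_mono_ex1)
      show "\<forall>i\<in>{1..k}. \<rho> i * poly p (\<alpha> i) \<le> \<rho> i * poly f (\<alpha> i)"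
        using p_le node_range f_nodes weight_pos by (auto intro!: mult_left_mono less_imp_le)
      have "poly p (\<alpha> i) < poly f (\<alpha> i)" using i p_le[OF node_range[OF i(1)]] f_nodes[OF i(1)] by simp
      then show "\<exists>i\<in>{1..k}. \<rho> i * poly p (\<alpha> i) < \<rho> i * poly f (\<alpha> i)"
        using i(1) weight_pos[OF i(1)] by (intro bexI[of _ i]) auto
    qed simp
    then show ?thesis using N_pos unfolding p(1) objective_quadrature[OF p(2)] objective_quadrature[OF f(1)]
      by (intro mult_strict_left_mono) auto
  qed
  have "universal_bound k N \<alpha> \<rho> h \<le> min_energy TYPE('n) N h"
    unfolding ub min_energy_def
  proof (rule INF_greatest)
    fix C :: "(real ^ 'n) set"
    assume "C \<in> {C. C \<subseteq> sphere 0 1 \<and> finite C \<and> card C = N}"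
    then show "ereal (lp_objective n N (poly f)) \<le> energy C h"
      by (intro lp_energy_bound[OF assms(1) _ _ _ N_pos f(2) f_le]) auto
  qed
  moreover have "lp_value n N (poly_space \<tau>) h = universal_bound k N \<alpha> \<rho> h"
    unfolding ub lp_value_def
  proof (rule antisym)
    show "(SUP f\<in>poly_space \<tau> \<inter> lp_class n h. ereal (lp_objective n N f)) \<le> ereal (lp_objective n N (poly f))"
    proof (rule SUP_least)
      fix u assume "u \<in> poly_space \<tau> \<inter> lp_class n h"
      then show "ereal (lp_objective n N u) \<le> ereal (lp_objective n N (poly f))"
        using opt[of u] by (cases "u = poly f") auto
    qed
    show "ereal (lp_objective n N (poly f)) \<le> (SUP f\<in>poly_space \<tau> \<inter> lp_class n h. ereal (lp_objective n N f))"
      using f_lp f_sp by (intro SUP_upper) auto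
  qed
  moreover have "\<exists>!f. hermite_interpolant \<tau> k \<alpha> h f" using f(4) uniq by blast
  ultimately show ?thesis using uniq f_lp f_sp opt by blast
qed

end
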